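(* Let $k$ be a field, $r\ge1$, let $\mathcal X\subset\mathbb Z^r$ be a Cubist subset and let $x\in\mathcal X$. Then $\Delta_{V_{\mathcal X}}(x)$, the standard $V_{\mathcal X}$-module corresponding to $x$ with respect to $\succeq^{op}$, possesses a linear projective resolution $$\cdots\to\bigoplus_{\substack{y\in\lambda x\\ d(x,y)=2}}V_{\mathcal X}f_y\langle2\rangle\to\bigoplus_{\substack{y\in\lambda x\\ d(x,y)=1}}V_{\mathcal X}f_y\langle1\rangle\to V_{\mathcal X}f_x\to\Delta_{V_{\mathcal X}}(x).$$ Furthermore, $\Delta_{V_{\mathcal X}}(x)\cong f_{\mathcal X}\Delta_{V,i_x}(x)$, and consequently $D_{V_{\mathcal X}}(q)=\tilde D_{V_{\mathcal X}}(q)$.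
   Context: Combinatorics. $\epsilon_1,\dots,\epsilon_r$ is the standard basis of $\mathbb Z^r$; $x\le y$ means $y-x$ has nonnegative coordinates; $x[n]=x+n(\epsilon_1+\cdots+\epsilon_r)$; $d(x,y)=\sum_i|x_i-y_i|$. A subset $\mathcal X\subset\mathbb Z^r$ is Cubist if $\mathcal X=\mathcal X^-\setminus\mathcal X^-[-1]$ for some nonempty proper ideal (down-closed subset) $\mathcal X^-$ of $(\mathbb Z^r,\le)$. For $1\le i\le r$ put $F_i=\{\sum_{j<i}a_j\epsilon_j-\sum_{j>i}a_j\epsilon_j : a_j\in\{0,1\}\}$ and $C_i=\mathbb Z_{\le0}^{i-1}\times\mathbb Z\times\mathbb Z_{\ge0}^{r-i}$. For each $x\in\mathcal X$ there is a unique $i=i_x$ with $x+F_{i}\subseteq\mathcal X$; put $\lambda x=x+F_{i_x}$, $\mu x=x+C_{i_x}$. The partial order $\succeq$ on $\mathcal X$ is generated by $x\succeq y$ for $y\in\lambda x$; $\succeq^{op}$ is its opposite. Algebras. Paths in quivers are composed from left to right; arrows have degree 1. $V_r$ is the $k$-algebra given by the quiver with vertices (idempotents) $f_x$, $x\in\mathbb Z^r$, arrows $\alpha_{x,i}$ from $x$ to $x+\epsilon_i$ and $\beta_{x,i}$ from $x$ to $x-\epsilon_i$ ($1\le i\le r$), with relations, for all $x$: $\alpha_{x,i}\alpha_{x+\epsilon_i,j}=\alpha_{x,j}\alpha_{x+\epsilon_j,i}$ and $\beta_{x,i}\beta_{x-\epsilon_i,j}=\beta_{x,j}\beta_{x-\epsilon_j,i}$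 for $i\ne j$; $\alpha_{x,i}\beta_{x+\epsilon_i,j}=\beta_{x,j}\alpha_{x-\epsilon_j,i}$ for all $1\le i,j\le r$; and $\sum_{i=1}^r\beta_{x,i}\alpha_{x-\epsilon_i,i}=0$. Put $V_{\mathcal X}=\sum_{x,y\in\mathcal X}f_xV_rf_y$. Modules. Modules are graded left modules $M=\bigoplus f_xM$; $M\langle n\rangle_i=M_{i-n}$. The standard module is $\Delta_{V_{\mathcal X}}(x)=V_{\mathcal X}f_x/\sum_{t\prec x}V_{\mathcal X}f_tV_{\mathcal X}f_x$ (the $t\prec x$ being those strictly larger than $x$ for $\succeq^{op}$), and $D_{V_{\mathcal X}}(q)_{xy}=\sum_i(\dim f_y\Delta_{V_{\mathcal X}}(x)_i)q^i$. $\tilde D_{V_{\mathcal X}}(q)$ is the $\mathcal X\times\mathcal X$ matrix whose $(x,y)$ entry is $q^{d(x,y)}$ if $y\in\mu x$ and $0$ otherwise. For $1\le i\le r$, $P_i$ is the subalgebra of $V_r$ generated by $f_x,\beta_{x,1},\dots,\beta_{x,i-1},\alpha_{x,i+1},\dots,\alpha_{x,r}$ ($x\in\mathbb Z^r$), $L(x)$ is the simple $P_i$-module at $x$ (one-dimensional, in degree 0, with $f_x$ acting as identity), and $\Delta_{V,i}(x)=V_r\otimes_{P_i}L(x)$. For a $V_r$-module $M$, $f_{\mathcal X}M=\bigoplus_{y\in\mathcal X}f_yM$, a $V_{\mathcal X}$-module. *)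

theory Defs
  imports
    "Jordan_Normal_Form.VS_Connect"
    "HOL-Algebra.QuotRing"
    "HOL-Library.Poly_Mapping"
    "HOL-Library.Function_Algebras"
    "HOL-Computational_Algebra.Formal_Laurent_Series"
begin

hide_const (open) Multiset.mult Polynomial.smult

section \<open>Cubist subsets\<close>

text \<open>
  The lattice of rank \<open>r\<close> is rendered as \<open>'r \<Rightarrow> int\<close>, where \<open>'r\<close> is an arbitrary finite linearly
  ordered index type standing for \<open>{1,\<dots>,r}\<close> (so \<open>r \<ge> 1\<close> is automatic).  Order and addition on
  \<open>'r \<Rightarrow> int\<close> are the pointwise ones of the library.
\<close>

type_synonym 'r pt = "'r \<Rightarrow> int"

definition unit_pt :: "'r \<Rightarrow> 'r pt" where
  "unit_pt i = (\<lambda>j. if j = i then 1 else 0)"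

definition shift_pt :: "'r pt \<Rightarrow> int \<Rightarrow> 'r pt" where
  "shift_pt x n = (\<lambda>j. x j + n)"

definition dist_pt :: "('r::finite) pt \<Rightarrow> 'r pt \<Rightarrow> nat" where
  "dist_pt x y = nat (\<Sum>i\<in>UNIV. \<bar>x i - y i\<bar>)"

definition cubist :: "'r pt set \<Rightarrow> bool" where
  "cubist X \<longleftrightarrow>
     (\<exists>I. I \<noteq> {} \<and> I \<noteq> UNIV \<and> (\<forall>x\<in>I. \<forall>y. y \<le> x \<longrightarrow> y \<in> I) \<and>
          X = I - (\<lambda>x. shift_pt x (-1)) ` I)"

definition F_set :: "'r::linorder \<Rightarrow> 'r pt set" where
  "F_set i = {\<lambda>j. if j < i then a j else if j > i then - a j else 0 | a. \<forall>j. a j \<in> {0, 1}}"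

definition C_set :: "'r::linorder \<Rightarrow> 'r pt set" where
  "C_set i = {v. (\<forall>j<i. v j \<le> 0) \<and> (\<forall>j>i. v j \<ge> 0)}"

text \<open>For cubist \<open>X\<close> and \<open>x \<in> X\<close> there is exactly one index as described.\<close>

definition cub_index :: "'r::linorder pt set \<Rightarrow> 'r pt \<Rightarrow> 'r" where
  "cub_index X x = (THE i. (\<lambda>v. x + v) ` F_set i \<subseteq> X)"

definition lambda_set :: "'r::linorder pt set \<Rightarrow> 'r pt \<Rightarrow> 'r pt set" where
  "lambda_set X x = (\<lambda>v. x + v) ` F_set (cub_index X x)"

definition mu_set :: "'r::linorder pt set \<Rightarrow> 'r pt \<Rightarrow> 'r pt set" where
  "mu_set X x = (\<lambda>v. x + v) ` C_set (cub_index X x)"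

definition succeq :: "'r::linorder pt set \<Rightarrow> 'r pt \<Rightarrow> 'r pt \<Rightarrow> bool" where
  "succeq X x y \<longleftrightarrow> (x, y) \<in> {(u, v). u \<in> X \<and> v \<in> lambda_set X u}\<^sup>*"


section \<open>The path algebra\<close>

text \<open>
  Every arrow type starts at every vertex, so a path is given by its source together with an
  arbitrary word of arrow types, read from left to right.  Elements of the path algebra are
  finitely supported functions on paths.
\<close>

datatype 'r arrow = Alpha 'r | Beta 'r

type_synonym 'r path = "'r pt \<times> 'r arrow list"

fun arrow_step :: "'r arrow \<Rightarrow> 'r pt" where
  "arrow_step (Alpha i) = unit_pt i"
| "arrow_step (Beta i) = - unit_pt i"

definition path_target :: "'r path \<Rightarrow> 'r pt" where
  "path_target p = fst p + (\<Sum>a\<leftarrow>snd p. arrow_step a)"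

definition path_mult ::
  "('r path \<Rightarrow>\<^sub>0 'k::field) \<Rightarrow> ('r path \<Rightarrow>\<^sub>0 'k) \<Rightarrow> ('r path \<Rightarrow>\<^sub>0 'k)" where
  "path_mult a b =
     (\<Sum>p\<in>Poly_Mapping.keys a. \<Sum>q\<in>Poly_Mapping.keys b.
        if path_target p = fst q
        then Poly_Mapping.single (fst p, snd p @ snd q)
               (Poly_Mapping.lookup a p * Poly_Mapping.lookup b q)
        else 0)"

definition pm_scale :: "'k::field \<Rightarrow> ('b \<Rightarrow>\<^sub>0 'k) \<Rightarrow> ('b \<Rightarrow>\<^sub>0 'k)" where
  "pm_scale c a = Poly_Mapping.map ((*) c) a"

lemma lookup_pm_scale [simp]:
  "Poly_Mapping.lookup (pm_scale c a) p = c * Poly_Mapping.lookup a p"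
  by (simp add: pm_scale_def Poly_Mapping.map.rep_eq when_def)

interpretation PM: vector_space "pm_scale :: 'k::field \<Rightarrow> ('b \<Rightarrow>\<^sub>0 'k) \<Rightarrow> ('b \<Rightarrow>\<^sub>0 'k)"
  by unfold_locales (auto intro!: poly_mapping_eqI simp: lookup_add algebra_simps)

lemma path_mult_superset:
  assumes "finite S" "Poly_Mapping.keys a \<subseteq> S" "finite T" "Poly_Mapping.keys b \<subseteq> T"
  shows "path_mult a b =
     (\<Sum>p\<in>S. \<Sum>q\<in>T.
        if path_target p = fst q
        then Poly_Mapping.single (fst p, snd p @ snd q)
               (Poly_Mapping.lookup a p * Poly_Mapping.lookup b q)
        else 0)"
proof -
  have 1: "(\<Sum>q\<in>Poly_Mapping.keys b.
        if path_target p = fst q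
        then Poly_Mapping.single (fst p, snd p @ snd q)
               (Poly_Mapping.lookup a p * Poly_Mapping.lookup b q) else 0) =
      (\<Sum>q\<in>T. if path_target p = fst q
        then Poly_Mapping.single (fst p, snd p @ snd q)
               (Poly_Mapping.lookup a p * Poly_Mapping.lookup b q) else 0)" for p
    by (rule sum.mono_neutral_left) (use assms in \<open>auto simp: in_keys_iff\<close>)
  show ?thesis
    unfolding path_mult_def 1
    by (rule sum.mono_neutral_left)
      (use assms in \<open>auto simp: in_keys_iff intro!: sum.neutral\<close>)
qed

lemma path_mult_add_left: "path_mult (a + b) c = path_mult a c + path_mult b c"
proof -
  let ?S = "Poly_Mapping.keys a \<union> Poly_Mapping.keys b"
  have "Poly_Mapping.keys (a + b) \<subseteq> ?S" by (rule Poly_Mapping.keys_add)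
  then show ?thesis
    using path_mult_superset[of ?S "a + b" "Poly_Mapping.keys c" c]
      path_mult_superset[of ?S a "Poly_Mapping.keys c" c]
      path_mult_superset[of ?S b "Poly_Mapping.keys c" c]
    by (auto simp: sum.distrib[symmetric] lookup_add single_add[symmetric] distrib_right
        intro!: sum.cong)
qed

lemma path_mult_add_right: "path_mult a (b + c) = path_mult a b + path_mult a c"
proof -
  let ?S = "Poly_Mapping.keys b \<union> Poly_Mapping.keys c"
  have "Poly_Mapping.keys (b + c) \<subseteq> ?S" by (rule Poly_Mapping.keys_add)
  then show ?thesis
    using path_mult_superset[of "Poly_Mapping.keys a" a ?S "b + c"]
      path_mult_superset[of "Poly_Mapping.keys a" a ?S b]
      path_mult_superset[of "Poly_Mapping.keys a" a ?S c]
    by (auto simp: sum.distrib[symmetric] lookup_add single_add[symmetric] distrib_left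
        intro!: sum.cong)
qed

lemma path_mult_zero [simp]: "path_mult 0 a = 0" "path_mult a 0 = 0"
  by (simp_all add: path_mult_def)

lemma path_mult_uminus_left: "path_mult (- a) b = - path_mult a b"
  using path_mult_add_left[of "- a" a b] by (simp add: eq_neg_iff_add_eq_0)

lemma path_mult_uminus_right: "path_mult a (- b) = - path_mult a b"
  using path_mult_add_right[of a "- b" b] by (simp add: eq_neg_iff_add_eq_0)

lemma path_mult_single:
  "path_mult (Poly_Mapping.single p c) (Poly_Mapping.single q d) =
     (if path_target p = fst q then Poly_Mapping.single (fst p, snd p @ snd q) (c * d) else 0)"
  by (subst path_mult_superset[where S = "{p}" and T = "{q}"]) auto

lemma path_target_append:
  "path_target (x, as @ bs) = path_target (path_target (x, as), bs)"
  by (simp add: path_target_def add.assoc)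

lemma path_mult_sum_left: "path_mult (sum g S) b = (\<Sum>s\<in>S. path_mult (g s) b)"
  by (induction S rule: infinite_finite_induct) (simp_all add: path_mult_add_left)

lemma path_mult_sum_right: "path_mult a (sum g S) = (\<Sum>s\<in>S. path_mult a (g s))"
  by (induction S rule: infinite_finite_induct) (simp_all add: path_mult_add_right)

lemma pm_sum_single:
  "(a :: 'b \<Rightarrow>\<^sub>0 'k::field) =
     (\<Sum>p\<in>Poly_Mapping.keys a. Poly_Mapping.single p (Poly_Mapping.lookup a p))"
proof (rule poly_mapping_eqI)
  fix p
  show "Poly_Mapping.lookup a p = Poly_Mapping.lookup
      (\<Sum>p\<in>Poly_Mapping.keys a. Poly_Mapping.single p (Poly_Mapping.lookup a p)) p"
    by (auto simp: lookup_sum lookup_single when_def in_keys_iff sum.delta' cong: if_cong)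
qed

lemma path_mult_assoc: "path_mult (path_mult a b) c = path_mult a (path_mult b c)"
proof -
  have single: "path_mult (path_mult (Poly_Mapping.single p u) (Poly_Mapping.single q v))
        (Poly_Mapping.single s w)
      = path_mult (Poly_Mapping.single p u)
        (path_mult (Poly_Mapping.single q v) (Poly_Mapping.single s w))" for p q s u v w
  proof -
    obtain x as where p: "p = (x, as)" by (cases p)
    obtain y bs where q: "q = (y, bs)" by (cases q)
    show ?thesis
      by (simp add: path_mult_single p q path_target_append mult.assoc)
  qed
  define e where "e = (\<lambda>(a :: 'a path \<Rightarrow>\<^sub>0 'b) p. Poly_Mapping.single p (Poly_Mapping.lookup a p))"
  have e: "a = (\<Sum>p\<in>Poly_Mapping.keys a. e a p)" for a :: "'a path \<Rightarrow>\<^sub>0 'b"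
    unfolding e_def by (rule pm_sum_single)
  define A where "A = Poly_Mapping.keys a"
  define B where "B = Poly_Mapping.keys b"
  define C where "C = Poly_Mapping.keys c"
  have "path_mult (path_mult (sum (e a) A) (sum (e b) B)) (sum (e c) C) =
      path_mult (sum (e a) A) (path_mult (sum (e b) B) (sum (e c) C))"
    by (simp only: path_mult_sum_left path_mult_sum_right) (simp only: e_def single)
  then show ?thesis
    unfolding A_def B_def C_def e[symmetric] .
qed

lemma path_mult_scale_left: "path_mult (pm_scale c a) b = pm_scale c (path_mult a b)"
proof -
  have "Poly_Mapping.keys (pm_scale c a) \<subseteq> Poly_Mapping.keys a"
    by (auto simp: in_keys_iff)
  then have "path_mult (pm_scale c a) b =
    (\<Sum>p\<in>Poly_Mapping.keys a. \<Sum>q\<in>Poly_Mapping.keys b.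
        if path_target p = fst q
        then Poly_Mapping.single (fst p, snd p @ snd q)
               (c * Poly_Mapping.lookup a p * Poly_Mapping.lookup b q)
        else 0)"
    by (subst path_mult_superset[where S = "Poly_Mapping.keys a" and T = "Poly_Mapping.keys b"])
      (auto cong: if_cong)
  also have "\<dots> = pm_scale c (path_mult a b)"
    unfolding path_mult_def PM.scale_sum_right
    by (intro sum.cong refl)
      (auto intro!: poly_mapping_eqI simp: lookup_single when_def mult.assoc)
  finally show ?thesis .
qed

lemma path_mult_scale_right: "path_mult a (pm_scale c b) = pm_scale c (path_mult a b)"
proof -
  have "Poly_Mapping.keys (pm_scale c b) \<subseteq> Poly_Mapping.keys b"
    by (auto simp: in_keys_iff)
  then have "path_mult a (pm_scale c b) =
    (\<Sum>p\<in>Poly_Mapping.keys a. \<Sum>q\<in>Poly_Mapping.keys b.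
        if path_target p = fst q
        then Poly_Mapping.single (fst p, snd p @ snd q)
               (Poly_Mapping.lookup a p * (c * Poly_Mapping.lookup b q))
        else 0)"
    by (subst path_mult_superset[where S = "Poly_Mapping.keys a" and T = "Poly_Mapping.keys b"])
      (auto cong: if_cong)
  also have "\<dots> = pm_scale c (path_mult a b)"
    unfolding path_mult_def PM.scale_sum_right
    by (intro sum.cong refl)
      (auto intro!: poly_mapping_eqI simp: lookup_single when_def)
  finally show ?thesis .
qed


section \<open>The algebra V\<close>

definition path_elem :: "'r path \<Rightarrow> ('r path \<Rightarrow>\<^sub>0 'k::field)" where
  "path_elem p = Poly_Mapping.single p 1"

definition V_relations :: "('r::finite path \<Rightarrow>\<^sub>0 'k::field) set" where
  "V_relations =
     {path_elem (x, [Alpha i, Alpha j]) - path_elem (x, [Alpha j, Alpha i]) | x i j. i \<noteq> j} \<union>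
     {path_elem (x, [Beta i, Beta j]) - path_elem (x, [Beta j, Beta i]) | x i j. i \<noteq> j} \<union>
     {path_elem (x, [Alpha i, Beta j]) - path_elem (x, [Beta j, Alpha i]) | x i j. True} \<union>
     {\<Sum>i\<in>UNIV. path_elem (x, [Beta i, Alpha i]) | x. True}"

inductive_set V_ideal :: "('r::finite path \<Rightarrow>\<^sub>0 'k::field) set" where
  gen: "a \<in> V_relations \<Longrightarrow> a \<in> V_ideal"
| zero: "0 \<in> V_ideal"
| add: "a \<in> V_ideal \<Longrightarrow> b \<in> V_ideal \<Longrightarrow> a + b \<in> V_ideal"
| scale: "a \<in> V_ideal \<Longrightarrow> pm_scale c a \<in> V_ideal"
| mult_left: "a \<in> V_ideal \<Longrightarrow> path_mult b a \<in> V_ideal"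
| mult_right: "a \<in> V_ideal \<Longrightarrow> path_mult a b \<in> V_ideal"

lemma V_ideal_uminus:
  assumes "a \<in> V_ideal"
  shows "- a \<in> V_ideal"
proof -
  have "pm_scale (-1) a = - a"
    by (rule poly_mapping_eqI) simp
  then show ?thesis using V_ideal.scale[OF assms, of "-1"] by simp
qed

lemma V_ideal_diff: "a \<in> V_ideal \<Longrightarrow> b \<in> V_ideal \<Longrightarrow> a - b \<in> V_ideal"
  using V_ideal.add[of a "- b"] V_ideal_uminus[of b] by simp

definition V_rel :: "('r::finite path \<Rightarrow>\<^sub>0 'k::field) \<Rightarrow> ('r path \<Rightarrow>\<^sub>0 'k) \<Rightarrow> bool" where
  "V_rel a b \<longleftrightarrow> a - b \<in> V_ideal"

lemma V_rel_equivp: "equivp (V_rel :: ('b::finite path \<Rightarrow>\<^sub>0 'a::field) \<Rightarrow> _)"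
proof (rule equivpI)
  show "reflp (V_rel :: ('b path \<Rightarrow>\<^sub>0 'a) \<Rightarrow> _)" by (rule reflpI) (simp add: V_rel_def V_ideal.zero)
  show "symp (V_rel :: ('b path \<Rightarrow>\<^sub>0 'a) \<Rightarrow> _)"
  proof (rule sympI)
    fix a b :: "'b path \<Rightarrow>\<^sub>0 'a"
    assume "V_rel a b"
    then have "- (a - b) \<in> V_ideal" unfolding V_rel_def by (rule V_ideal_uminus)
    then show "V_rel b a" by (simp only: V_rel_def minus_diff_eq)
  qed
  show "transp (V_rel :: ('b path \<Rightarrow>\<^sub>0 'a) \<Rightarrow> _)"
  proof (rule transpI)
    fix a b c :: "'b path \<Rightarrow>\<^sub>0 'a"
    assume "V_rel a b" "V_rel b c"
    then have "(a - b) + (b - c) \<in> V_ideal" unfolding V_rel_def by (rule V_ideal.add)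
    then show "V_rel a c" by (simp add: V_rel_def)
  qed
qed

quotient_type (overloaded) ('k, 'r) valg = "'r::finite path \<Rightarrow>\<^sub>0 'k::field" / V_rel
  by (rule V_rel_equivp)

instantiation valg :: (field, finite) ring
begin

lift_definition zero_valg :: "('a, 'b) valg" is 0 .

lift_definition plus_valg :: "('a, 'b) valg \<Rightarrow> ('a, 'b) valg \<Rightarrow> ('a, 'b) valg" is "(+)"
  unfolding V_rel_def
proof -
  fix a b c d :: "'b path \<Rightarrow>\<^sub>0 'a"
  assume "a - b \<in> V_ideal" "c - d \<in> V_ideal"
  then have "(a - b) + (c - d) \<in> V_ideal" by (rule V_ideal.add)
  then show "a + c - (b + d) \<in> V_ideal" by (simp add: algebra_simps)
qed

lift_definition uminus_valg :: "('a, 'b) valg \<Rightarrow> ('a, 'b) valg" is uminus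
  unfolding V_rel_def
proof -
  fix a b :: "'b path \<Rightarrow>\<^sub>0 'a"
  assume "a - b \<in> V_ideal"
  then have "- (a - b) \<in> V_ideal" by (rule V_ideal_uminus)
  then show "- a - - b \<in> V_ideal" by (simp add: algebra_simps)
qed

lift_definition minus_valg :: "('a, 'b) valg \<Rightarrow> ('a, 'b) valg \<Rightarrow> ('a, 'b) valg" is "(-)"
  unfolding V_rel_def
proof -
  fix a b c d :: "'b path \<Rightarrow>\<^sub>0 'a"
  assume "a - b \<in> V_ideal" "c - d \<in> V_ideal"
  then have "(a - b) - (c - d) \<in> V_ideal" by (rule V_ideal_diff)
  then show "a - c - (b - d) \<in> V_ideal" by (simp add: algebra_simps)
qed

lift_definition times_valg :: "('a, 'b) valg \<Rightarrow> ('a, 'b) valg \<Rightarrow> ('a, 'b) valg" is path_mult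
  unfolding V_rel_def
proof -
  fix a b c d :: "'b path \<Rightarrow>\<^sub>0 'a"
  assume "a - b \<in> V_ideal" "c - d \<in> V_ideal"
  then have "path_mult (a - b) c + path_mult b (c - d) \<in> V_ideal"
    by (intro V_ideal.add V_ideal.mult_left V_ideal.mult_right)
  moreover have "path_mult (a - b) c + path_mult b (c - d) = path_mult a c - path_mult b d"
    by (simp only: diff_conv_add_uminus path_mult_add_left path_mult_add_right
        path_mult_uminus_left path_mult_uminus_right) simp
  ultimately show "path_mult a c - path_mult b d \<in> V_ideal" by simp
qed

instance
  by standard (transfer; simp add: V_rel_def V_ideal.zero path_mult_assoc path_mult_add_left
      path_mult_add_right algebra_simps)+

end

lift_definition vscale :: "'k::field \<Rightarrow> ('k, 'r::finite) valg \<Rightarrow> ('k, 'r) valg" is pm_scale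
  unfolding V_rel_def
proof -
  fix c :: 'k and a b :: "'r path \<Rightarrow>\<^sub>0 'k"
  assume "a - b \<in> V_ideal"
  then have "pm_scale c (a - b) \<in> V_ideal" by (rule V_ideal.scale)
  then show "pm_scale c a - pm_scale c b \<in> V_ideal"
    by (simp only: PM.scale_right_diff_distrib)
qed

interpretation V: vector_space "vscale :: 'k::field \<Rightarrow> ('k, 'r::finite) valg \<Rightarrow> ('k, 'r) valg"
  by unfold_locales
    (transfer; simp add: V_rel_def V_ideal.zero PM.scale_right_distrib PM.scale_left_distrib)+

lemma vscale_mult_left: "vscale c a * b = vscale c (a * b)"
  by transfer (simp add: V_rel_def V_ideal.zero path_mult_scale_left)

lemma vscale_mult_right: "a * vscale c b = vscale c (a * b)"
  by transfer (simp add: V_rel_def V_ideal.zero path_mult_scale_right)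

lift_definition vpath :: "'r::finite path \<Rightarrow> ('k::field, 'r) valg" is path_elem .

abbreviation videm :: "'r::finite pt \<Rightarrow> ('k::field, 'r) valg" where
  "videm x \<equiv> vpath (x, [])"

abbreviation valpha :: "'r::finite pt \<Rightarrow> 'r \<Rightarrow> ('k::field, 'r) valg" where
  "valpha x i \<equiv> vpath (x, [Alpha i])"

abbreviation vbeta :: "'r::finite pt \<Rightarrow> 'r \<Rightarrow> ('k::field, 'r) valg" where
  "vbeta x i \<equiv> vpath (x, [Beta i])"

definition vdeg :: "int \<Rightarrow> ('k::field, 'r::finite) valg set" where
  "vdeg n = V.span {vpath p | p. int (length (snd p)) = n}"

text \<open>
  The coefficient of the idempotent at \<open>x\<close>; it is well defined on the quotient because all
  relations are homogeneous of degree 2.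
\<close>

lemma lookup_path_mult_Nil:
  fixes a b :: "'r path \<Rightarrow>\<^sub>0 'k::field"
  shows "Poly_Mapping.lookup (path_mult a b) (x, []) =
     Poly_Mapping.lookup a (x, []) * Poly_Mapping.lookup b (x, [])"
proof -
  have single: "Poly_Mapping.lookup (path_mult (Poly_Mapping.single p u)
        (Poly_Mapping.single q v)) (x, []) =
      Poly_Mapping.lookup (Poly_Mapping.single p u) (x, []) *
      Poly_Mapping.lookup (Poly_Mapping.single q v) (x, [])" for p q and u v :: 'k
    by (cases p; cases q)
      (auto simp: path_mult_single lookup_single when_def path_target_def)
  define e where "e = (\<lambda>(a :: 'r path \<Rightarrow>\<^sub>0 'k) p. Poly_Mapping.single p (Poly_Mapping.lookup a p))"
  have e: "a = (\<Sum>p\<in>Poly_Mapping.keys a. e a p)" for a :: "'r path \<Rightarrow>\<^sub>0 'k"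
    unfolding e_def by (rule pm_sum_single)
  define A where "A = Poly_Mapping.keys a"
  define B where "B = Poly_Mapping.keys b"
  have "Poly_Mapping.lookup (path_mult (sum (e a) A) (sum (e b) B)) (x, []) =
      Poly_Mapping.lookup (sum (e a) A) (x, []) * Poly_Mapping.lookup (sum (e b) B) (x, [])"
    by (simp only: path_mult_sum_left path_mult_sum_right lookup_sum sum_product)
      (simp only: e_def single, rule sum.swap)
  then show ?thesis
    unfolding A_def B_def e[symmetric] .
qed

lemma V_ideal_lookup_Nil: "a \<in> V_ideal \<Longrightarrow> Poly_Mapping.lookup a (x, []) = 0"
  by (induction rule: V_ideal.induct)
    (auto simp: V_relations_def path_elem_def lookup_minus lookup_add lookup_sum lookup_single
      lookup_path_mult_Nil)

lift_definition idem_coeff :: "'r::finite pt \<Rightarrow> ('k::field, 'r) valg \<Rightarrow> 'k"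
  is "\<lambda>x a. Poly_Mapping.lookup a (x, [])"
  unfolding V_rel_def
proof -
  fix x and a b :: "'r path \<Rightarrow>\<^sub>0 'k"
  assume "a - b \<in> V_ideal"
  then have "Poly_Mapping.lookup (a - b) (x, []) = 0" by (rule V_ideal_lookup_Nil)
  then show "Poly_Mapping.lookup a (x, []) = Poly_Mapping.lookup b (x, [])"
    by (simp add: lookup_minus)
qed

lemma idem_coeff_mult: "idem_coeff x (a * b) = idem_coeff x a * idem_coeff x b"
  by transfer (rule lookup_path_mult_Nil)

definition V_sub :: "'r::finite pt set \<Rightarrow> ('k::field, 'r) valg set" where
  "V_sub X = V.span {videm x * a * videm y | x a y. x \<in> X \<and> y \<in> X}"

inductive_set P_alg :: "'r::{finite, linorder} \<Rightarrow> ('k::field, 'r) valg set" for i where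
  idem: "videm x \<in> P_alg i"
| beta: "j < i \<Longrightarrow> vbeta x j \<in> P_alg i"
| alpha: "i < j \<Longrightarrow> valpha x j \<in> P_alg i"
| add: "a \<in> P_alg i \<Longrightarrow> b \<in> P_alg i \<Longrightarrow> a + b \<in> P_alg i"
| scale: "a \<in> P_alg i \<Longrightarrow> vscale c a \<in> P_alg i"
| mult: "a \<in> P_alg i \<Longrightarrow> b \<in> P_alg i \<Longrightarrow> a * b \<in> P_alg i"


section \<open>Graded modules\<close>

text \<open>
  A graded left module is a vector space in the sense of the record \<^typ>\<open>('k, 'm) module\<close> together
  with the action of an algebra and the homogeneous components.  As usual for this record, the
  inherited fields \<open>mult\<close> and \<open>one\<close> carry no meaning.
\<close>

record ('k, 'a, 'm) gmodule = "('k, 'm) module" +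
  act :: "'a \<Rightarrow> 'm \<Rightarrow> 'm"
  deg :: "int \<Rightarrow> 'm set"

type_synonym ('k, 'r, 'm) vmodule = "('k, ('k, 'r) valg, 'm) gmodule"

definition internal_direct_sum ::
  "('k::field, 'a, 'm) gmodule \<Rightarrow> 'i set \<Rightarrow> ('i \<Rightarrow> 'm set) \<Rightarrow> bool" where
  "internal_direct_sum M I S \<longleftrightarrow>
     (\<forall>i\<in>I. VectorSpace.subspace class_ring (S i) M) \<and>
     (\<forall>m\<in>carrier M. \<exists>!c. (\<forall>i\<in>I. c i \<in> S i) \<and> (\<forall>i. i \<notin> I \<longrightarrow> c i = \<zero>\<^bsub>M\<^esub>) \<and>
        finite {i. c i \<noteq> \<zero>\<^bsub>M\<^esub>} \<and> m = (\<Oplus>\<^bsub>M\<^esub>i\<in>{i. c i \<noteq> \<zero>\<^bsub>M\<^esub>}. c i))"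

text \<open>
  Graded left modules over a subalgebra \<open>A\<close> of \<open>V\<close> with idempotents indexed by \<open>X\<close>; since \<open>A\<close> need
  not have a unit, unitality is the decomposition of \<open>M\<close> into the spaces \<open>f\<^sub>x M\<close>.
\<close>

locale graded_module = vectorspace class_ring M
  for A :: "('k::field, 'r::finite) valg set" and X :: "'r pt set"
    and M :: "('k, 'r, 'm) vmodule" +
  assumes act_closed: "a \<in> A \<Longrightarrow> m \<in> carrier M \<Longrightarrow> act M a m \<in> carrier M"
    and act_add_left: "a \<in> A \<Longrightarrow> b \<in> A \<Longrightarrow> m \<in> carrier M \<Longrightarrow>
          act M (a + b) m = act M a m \<oplus>\<^bsub>M\<^esub> act M b m"
    and act_add_right: "a \<in> A \<Longrightarrow> m \<in> carrier M \<Longrightarrow> n \<in> carrier M \<Longrightarrow>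
          act M a (m \<oplus>\<^bsub>M\<^esub> n) = act M a m \<oplus>\<^bsub>M\<^esub> act M a n"
    and act_scale_left: "a \<in> A \<Longrightarrow> m \<in> carrier M \<Longrightarrow>
          act M (vscale c a) m = c \<odot>\<^bsub>M\<^esub> act M a m"
    and act_scale_right: "a \<in> A \<Longrightarrow> m \<in> carrier M \<Longrightarrow>
          act M a (c \<odot>\<^bsub>M\<^esub> m) = c \<odot>\<^bsub>M\<^esub> act M a m"
    and act_mult: "a \<in> A \<Longrightarrow> b \<in> A \<Longrightarrow> m \<in> carrier M \<Longrightarrow>
          act M (a * b) m = act M a (act M b m)"
    and idem_decomposition: "internal_direct_sum M X (\<lambda>x. act M (videm x) ` carrier M)"
    and deg_decomposition: "internal_direct_sum M UNIV (deg M)"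
    and act_deg: "a \<in> A \<Longrightarrow> a \<in> vdeg i \<Longrightarrow> m \<in> deg M j \<Longrightarrow> act M a m \<in> deg M (i + j)"

definition gshift :: "int \<Rightarrow> ('k, 'a, 'm) gmodule \<Rightarrow> ('k, 'a, 'm) gmodule" where
  "gshift n M = M\<lparr>deg := \<lambda>i. deg M (i - n)\<rparr>"

definition gsum :: "'i set \<Rightarrow> ('i \<Rightarrow> ('k, 'a, 'm) gmodule) \<Rightarrow> ('k, 'a, 'i \<Rightarrow> 'm) gmodule" where
  "gsum I M =
     (let C = {g \<in> \<Pi>\<^sub>E i\<in>I. carrier (M i). finite {i\<in>I. g i \<noteq> \<zero>\<^bsub>M i\<^esub>}} in
      \<lparr>carrier = C,
       mult = undefined, one = undefined,
       zero = (\<lambda>i\<in>I. \<zero>\<^bsub>M i\<^esub>),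
       add = (\<lambda>g h. \<lambda>i\<in>I. g i \<oplus>\<^bsub>M i\<^esub> h i),
       smult = (\<lambda>c g. \<lambda>i\<in>I. c \<odot>\<^bsub>M i\<^esub> g i),
       act = (\<lambda>a g. \<lambda>i\<in>I. act (M i) a (g i)),
       deg = (\<lambda>n. {g \<in> C. \<forall>i\<in>I. g i \<in> deg (M i) n})\<rparr>)"

text \<open>
  The unions only collect the coset of \<open>c \<odot> u\<close>, respectively of \<open>a u\<close>, over the representatives
  \<open>u\<close> of a given coset, as in the library's \<open>rcoset_mult\<close>.
\<close>

definition gquot :: "('k, 'a, 'm) gmodule \<Rightarrow> 'm set \<Rightarrow> ('k, 'a, 'm set) gmodule" where
  "gquot M N =
     \<lparr>carrier = a_rcosets\<^bsub>M\<^esub> N,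
      mult = undefined, one = undefined,
      zero = N,
      add = set_add M,
      smult = (\<lambda>c U. \<Union>u\<in>U. N +>\<^bsub>M\<^esub> (c \<odot>\<^bsub>M\<^esub> u)),
      act = (\<lambda>a U. \<Union>u\<in>U. N +>\<^bsub>M\<^esub> act M a u),
      deg = (\<lambda>n. (\<lambda>u. N +>\<^bsub>M\<^esub> u) ` deg M n)\<rparr>"

definition ghom ::
  "'a set \<Rightarrow> ('k::field, 'a, 'm) gmodule \<Rightarrow> ('k, 'a, 'n) gmodule \<Rightarrow> ('m \<Rightarrow> 'n) set" where
  "ghom A M N =
     {f \<in> LinearCombinations.module_hom class_ring M N.
        (\<forall>a\<in>A. \<forall>m\<in>carrier M. f (act M a m) = act N a (f m)) \<and>
        (\<forall>i. f ` deg M i \<subseteq> deg N i)}"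

definition gmod_iso ::
  "('k::field, 'r::finite) valg set \<Rightarrow> 'r pt set \<Rightarrow>
   ('k, 'r, 'm) vmodule \<Rightarrow> ('k, 'r, 'n) vmodule \<Rightarrow> bool" where
  "gmod_iso A X M N \<longleftrightarrow>
     graded_module A X M \<and> graded_module A X N \<and>
     (\<exists>f\<in>ghom A M N. bij_betw f (carrier M) (carrier N))"

definition generated_in_degree ::
  "('k::field, 'r::finite) valg set \<Rightarrow> ('k, 'r, 'm) vmodule \<Rightarrow> int \<Rightarrow> bool" where
  "generated_in_degree A M n \<longleftrightarrow>
     carrier M = LinearCombinations.module.span class_ring M
                   {act M a m | a m. a \<in> A \<and> m \<in> deg M n}"

text \<open>
  Projectivity in the category of graded modules and homogeneous maps of degree 0.  The type
  arguments are the carrier types of the test modules; leaving them as free type variables in a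
  theorem amounts to testing against all modules.
\<close>

definition graded_projective ::
  "'n itself \<Rightarrow> 'l itself \<Rightarrow> ('k::field, 'r::finite) valg set \<Rightarrow> 'r pt set \<Rightarrow>
   ('k, 'r, 'm) vmodule \<Rightarrow> bool" where
  "graded_projective _ _ A X P \<longleftrightarrow>
     graded_module A X P \<and>
     (\<forall>(N :: ('k, 'r, 'n) vmodule) (L :: ('k, 'r, 'l) vmodule) g h.
        graded_module A X N \<and> graded_module A X L \<and>
        g \<in> ghom A N L \<and> g ` carrier N = carrier L \<and> h \<in> ghom A P L \<longrightarrow>
        (\<exists>h'\<in>ghom A P N. \<forall>p\<in>carrier P. g (h' p) = h p))"

definition linear_projective_resolution ::
  "'n itself \<Rightarrow> 'l itself \<Rightarrow> ('k::field, 'r::finite) valg set \<Rightarrow> 'r pt set \<Rightarrow>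
   (nat \<Rightarrow> ('k, 'r, 'p) vmodule) \<Rightarrow> (nat \<Rightarrow> 'p \<Rightarrow> 'p) \<Rightarrow> ('p \<Rightarrow> 'm) \<Rightarrow>
   ('k, 'r, 'm) vmodule \<Rightarrow> bool" where
  "linear_projective_resolution TN TL A X P d e M \<longleftrightarrow>
     graded_module A X M \<and>
     (\<forall>n. graded_projective TN TL A X (P n) \<and> generated_in_degree A (P n) (int n)) \<and>
     (\<forall>n. d n \<in> ghom A (P (Suc n)) (P n)) \<and>
     e \<in> ghom A (P 0) M \<and>
     (\<forall>n. d (Suc n) ` carrier (P (Suc (Suc n))) = a_kernel (P (Suc n)) (P n) (d n)) \<and>
     d 0 ` carrier (P (Suc 0)) = a_kernel (P 0) M e \<and>
     e ` carrier (P 0) = carrier M"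

definition gcomp :: "('k, 'r::finite, 'm) vmodule \<Rightarrow> 'r pt \<Rightarrow> int \<Rightarrow> ('k::field, 'r, 'm) vmodule" where
  "gcomp M y i = M\<lparr>carrier := act M (videm y) ` deg M i\<rparr>"

definition has_gdim :: "('k::field, 'r::finite, 'm) vmodule \<Rightarrow> 'r pt \<Rightarrow> bool" where
  "has_gdim M y \<longleftrightarrow>
     (\<forall>i. vectorspace.fin_dim class_ring (gcomp M y i)) \<and>
     finite {i. i < 0 \<and> carrier (gcomp M y i) \<noteq> {\<zero>\<^bsub>M\<^esub>}}"

text \<open>The Hilbert series of \<open>f\<^sub>y M\<close>; meaningful only under \<open>has_gdim\<close>.\<close>

definition gdim :: "('k::field, 'r::finite, 'm) vmodule \<Rightarrow> 'r pt \<Rightarrow> int fls" where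
  "gdim M y = Abs_fls (\<lambda>i. int (vectorspace.dim class_ring (gcomp M y i)))"


section \<open>The modules over V and its truncation\<close>

definition left_module :: "('k::field, 'r::finite) valg set \<Rightarrow> ('k, 'r, ('k, 'r) valg) vmodule" where
  "left_module S =
     \<lparr>carrier = S, mult = undefined, one = undefined, zero = 0, add = (+),
      smult = vscale, act = (*), deg = (\<lambda>n. S \<inter> vdeg n)\<rparr>"

definition proj_module :: "'r::finite pt set \<Rightarrow> 'r pt \<Rightarrow> ('k::field, 'r, ('k, 'r) valg) vmodule" where
  "proj_module X y = left_module ((\<lambda>a. a * videm y) ` V_sub X)"

text \<open>The vertices \<open>t\<close> with \<open>t \<prec> x\<close> are those strictly larger than \<open>x\<close> for the opposite order.\<close>

definition std_relations ::
  "'r::{finite, linorder} pt set \<Rightarrow> 'r pt \<Rightarrow> ('k::field, 'r) valg set" where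
  "std_relations X x =
     V.span {a * videm t * b * videm x | a b t.
               a \<in> V_sub X \<and> b \<in> V_sub X \<and> t \<in> X \<and> succeq X x t \<and> t \<noteq> x}"

definition std_module ::
  "'r::{finite, linorder} pt set \<Rightarrow> 'r pt \<Rightarrow> ('k::field, 'r, ('k, 'r) valg set) vmodule" where
  "std_module X x = gquot (proj_module X x) (std_relations X x)"

definition std_matrix ::
  "'k::field itself \<Rightarrow> 'r::{finite, linorder} pt set \<Rightarrow> 'r pt \<Rightarrow> 'r pt \<Rightarrow> int fls" where
  "std_matrix _ X x y =
     gdim (std_module X x :: ('k, 'r, ('k, 'r) valg set) vmodule) y"

definition tilde_matrix :: "'r::{finite, linorder} pt set \<Rightarrow> 'r pt \<Rightarrow> 'r pt \<Rightarrow> int fls" where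
  "tilde_matrix X x y = (if y \<in> mu_set X x then fls_X ^ dist_pt x y else 0)"

text \<open>
  The tensor product of \<open>V\<close>, as a right module over a subalgebra \<open>P\<close>, with a left \<open>P\<close>-module \<open>L\<close>:
  the free vector space on the pairs \<open>(v, l)\<close> modulo bilinearity and \<open>P\<close>-balancedness.
\<close>

definition tensor_free ::
  "('k::field, 'r::finite, 'l) vmodule \<Rightarrow> ('k, 'r, (('k, 'r) valg \<times> 'l) \<Rightarrow>\<^sub>0 'k) vmodule" where
  "tensor_free L =
     \<lparr>carrier = {z. Poly_Mapping.keys z \<subseteq> UNIV \<times> carrier L},
      mult = undefined, one = undefined, zero = 0, add = (+), smult = pm_scale,
      act = (\<lambda>a z. \<Sum>p\<in>Poly_Mapping.keys z.
               Poly_Mapping.single (a * fst p, snd p) (Poly_Mapping.lookup z p)),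
      deg = (\<lambda>n. {z. Poly_Mapping.keys z \<subseteq> (\<Union>i. vdeg i \<times> deg L (n - i))})\<rparr>"

definition tensor_relations ::
  "('k::field, 'r::finite) valg set \<Rightarrow> ('k, 'r, 'l) vmodule \<Rightarrow> ((('k, 'r) valg \<times> 'l) \<Rightarrow>\<^sub>0 'k) set" where
  "tensor_relations P L =
     (let e = (\<lambda>v l. Poly_Mapping.single (v, l) 1) in
      PM.span (
        {e (u + v) l - e u l - e v l | u v l. l \<in> carrier L} \<union>
        {e v (l \<oplus>\<^bsub>L\<^esub> l') - e v l - e v l' | v l l'. l \<in> carrier L \<and> l' \<in> carrier L} \<union>
        {e (vscale c v) l - pm_scale c (e v l) | c v l. l \<in> carrier L} \<union>
        {e v (c \<odot>\<^bsub>L\<^esub> l) - pm_scale c (e v l) | c v l. l \<in> carrier L} \<union>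
        {e (v * p) l - e v (act L p l) | v p l. p \<in> P \<and> l \<in> carrier L}))"

definition V_tensor ::
  "('k::field, 'r::finite) valg set \<Rightarrow> ('k, 'r, 'l) vmodule \<Rightarrow>
   ('k, 'r, ((('k, 'r) valg \<times> 'l) \<Rightarrow>\<^sub>0 'k) set) vmodule" where
  "V_tensor P L = gquot (tensor_free L) (tensor_relations P L)"

text \<open>
  On the one-dimensional simple module at \<open>x\<close> an element acts by its coefficient at \<open>f\<^sub>x\<close>: \<open>f\<^sub>x\<close> acts
  as the identity, all other idempotents and all arrows act as zero.
\<close>

definition simple_module :: "'r::finite pt \<Rightarrow> ('k::field, 'r, 'k) vmodule" where
  "simple_module x =
     \<lparr>carrier = UNIV, mult = undefined, one = undefined, zero = 0, add = (+), smult = (*),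
      act = (\<lambda>p c. idem_coeff x p * c), deg = (\<lambda>n. if n = 0 then UNIV else {0})\<rparr>"

definition V_std_module ::
  "'r::{finite, linorder} \<Rightarrow> 'r pt \<Rightarrow>
   ('k::field, 'r, ((('k, 'r) valg \<times> 'k) \<Rightarrow>\<^sub>0 'k) set) vmodule" where
  "V_std_module i x = V_tensor (P_alg i) (simple_module x)"

definition restrict_module ::
  "'r::finite pt set \<Rightarrow> ('k::field, 'r, 'm) vmodule \<Rightarrow> ('k, 'r, 'm) vmodule" where
  "restrict_module X M =
     (let C = LinearCombinations.module.span class_ring M (\<Union>y\<in>X. act M (videm y) ` carrier M) in
      M\<lparr>carrier := C, deg := \<lambda>n. deg M n \<inter> C\<rparr>)"

end

theory Submission
  imports Defs
begin

text \<open>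
  Every arrow type starts at every vertex, so \<open>V f\<^sub>y\<close> is the commutative algebra
  \<open>S = k[a\<^sub>j, b\<^sub>j] / (\<Sum> a\<^sub>j b\<^sub>j)\<close>, the source of a monomial being determined by its weight.
  For each index \<open>i\<close> the monomials not divisible by \<open>a\<^sub>i b\<^sub>i\<close> form a basis of \<open>S\<close>, stable under
  multiplication by the variables \<open>c\<^sub>j = b\<^sub>j\<close> (\<open>j < i\<close>), \<open>c\<^sub>j = a\<^sub>j\<close> (\<open>j > i\<close>).  So the Koszul complex
  on the \<open>c\<^sub>j\<close> splits into simplex complexes, one for each monomial, and has an explicit
  contraction.  Its terms are the \<open>V f\<^sub>y\<close> with \<open>y \<in> x + F\<^sub>i\<close>, and its cokernel, with basis the monomials
  without any \<open>c\<^sub>j\<close>, lives on \<open>x + C\<^sub>i\<close>, with one dimension at each vertex; it is \<open>V \<otimes>\<^sub>P L(x)\<close>.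
  Truncating to \<open>X\<close> gives everything, once one knows that no \<open>t \<prec> x\<close> lies in \<open>\<mu> x\<close>, which is the
  only place where the Cubist combinatorics enters.
\<close>

text \<open>The index \<open>cub_index X x\<close> singles out the one product a_i b_i that the
  quadratic relation has to rewrite: the c_j avoid both of its factors, so multiplying a normal
  monomial by c_j is a mere shift of coordinates. The Koszul differential and its contraction both
  keep the source of a path, so selecting the sources in \<open>X\<close> preserves exactness.
  Spanning by normal monomials is a rewriting argument, but independence concerns a quotient by an
  ideal of noncommutative paths; it is obtained by sending the paths between two fixed vertices to a
  polynomial ring, where the ideal lands in the multiples of one quadric. The order is a transitive
  closure, so keeping every t \<prec> x out of \<mu> x needs a quantity that is monotone along each
  generating step: a dictionary order on the coordinates up to the index of the vertex. Modules are
  compared through one concrete model of \<Delta>(x) in coordinates, which is matched both with the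
  quotient of V_X f_x and with the truncated tensor product.\<close>

abbreviation "keys \<equiv> Poly_Mapping.keys"
abbreviation "lookup \<equiv> Poly_Mapping.lookup"
abbreviation "single \<equiv> Poly_Mapping.single"

section \<open>Linear maps prescribed on a basis\<close>

section \<open>Linear extension\<close>

lemma pm_induct:
  fixes a :: "'b \<Rightarrow>\<^sub>0 'k::field"
  assumes "P 0" "\<And>p c. P (single p c)" "\<And>a b. P a \<Longrightarrow> P b \<Longrightarrow> P (a + b)"
  shows "P a"
proof -
  have "P (\<Sum>p\<in>S. single p (lookup a p))" for S
    by (induction S rule: infinite_finite_induct) (use assms in simp_all)
  then show ?thesis using pm_sum_single[of a] by metis
qed

lemma keys_pm_scale: "keys (pm_scale c p) \<subseteq> keys p"
  by (auto simp: in_keys_iff)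

lemma pm_scale_single: "pm_scale c (single p d) = single p (c * d)"
  by (rule poly_mapping_eqI) (simp add: lookup_single when_def)

lemma pm_scale_eq_times: "pm_scale c a = single 0 c * a"
  for a :: "'b::comm_monoid_add \<Rightarrow>\<^sub>0 'k::field"
  by (induction a rule: pm_induct) (simp_all add: pm_scale_single mult_single PM.scale_right_distrib distrib_left)

text \<open>Stated for an arbitrary target space so that \<open>Psi\<close>,
  \<open>comm_part\<close> and \<open>tensor_dproj\<close> get their linearity rules from the single
  set \<open>lin_ext_simps\<close>.\<close>

definition (in vector_space) lin_ext :: "('c \<Rightarrow> 'b) \<Rightarrow> ('c \<Rightarrow>\<^sub>0 'a) \<Rightarrow> 'b" where
  "lin_ext f p = (\<Sum>m\<in>keys p. scale (lookup p m) (f m))"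

context vector_space
begin

lemma lin_ext_superset:
  assumes "finite S" "keys p \<subseteq> S"
  shows "lin_ext f p = (\<Sum>m\<in>S. scale (lookup p m) (f m))"
  unfolding lin_ext_def by (rule sum.mono_neutral_left) (use assms in \<open>auto simp: in_keys_iff\<close>)

lemma lin_ext_zero: "lin_ext f 0 = 0"
  by (simp add: lin_ext_def)

lemma lin_ext_single: "lin_ext f (single m c) = scale c (f m)"
  by (subst lin_ext_superset[of "{m}"]) auto

lemma lin_ext_add: "lin_ext f (p + q) = lin_ext f p + lin_ext f q"
proof -
  let ?S = "keys p \<union> keys q"
  have "keys (p + q) \<subseteq> ?S" by (rule Poly_Mapping.keys_add)
  then show ?thesis
    using lin_ext_superset[of ?S "p + q" f] lin_ext_superset[of ?S p f] lin_ext_superset[of ?S q f]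
    by (simp add: sum.distrib lookup_add scale_left_distrib)
qed

lemma lin_ext_scale: "lin_ext f (pm_scale c p) = scale c (lin_ext f p)"
  by (subst lin_ext_superset[OF finite_keys keys_pm_scale]) (simp add: lin_ext_def scale_sum_right)

lemma lin_ext_sum: "lin_ext f (sum g S) = (\<Sum>s\<in>S. lin_ext f (g s))"
  by (induction S rule: infinite_finite_induct) (simp_all add: lin_ext_zero lin_ext_add)

lemma lin_ext_diff: "lin_ext f (p - q) = lin_ext f p - lin_ext f q"
  using lin_ext_add[of f "p - q" q] by simp

lemma lin_ext_uminus: "lin_ext f (- p) = - lin_ext f p"
  using lin_ext_diff[of f 0 p] by (simp add: lin_ext_zero)

lemmas lin_ext_simps =
  lin_ext_zero lin_ext_single lin_ext_add lin_ext_scale lin_ext_sum lin_ext_diff lin_ext_uminus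

end

section \<open>Down-closed sets, the index of a Cubist vertex, and acyclicity of the order\<close>

section \<open>Cubist combinatorics\<close>

text \<open>For x inside the ideal with x[1] outside it, the chain x, x + e_1, x + e_1 + e_2, ...,
  x[1] leaves \<open>I\<close> at the step \<open>i\<close>. This replaces the condition on a whole
  cube in \<open>cub_index\<close> by two membership tests.\<close>

definition rank_vertex :: "'r pt set \<Rightarrow> 'r::{finite, linorder} pt \<Rightarrow> 'r \<Rightarrow> bool" where
  "rank_vertex I x i \<longleftrightarrow>
     (\<lambda>j. if j < i then x j + 1 else x j) \<in> I \<and> (\<lambda>j. if j \<le> i then x j + 1 else x j) \<notin> I"

definition down_closed :: "'r pt set \<Rightarrow> bool" where
  "down_closed I \<longleftrightarrow> (\<forall>x\<in>I. \<forall>y. y \<le> x \<longrightarrow> y \<in> I)"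

lemma down_closedD: "down_closed I \<Longrightarrow> x \<in> I \<Longrightarrow> (\<And>j. y j \<le> x j) \<Longrightarrow> y \<in> I"
  by (auto simp: down_closed_def le_fun_def)

lemma mem_boundary_iff: "x \<in> I - (\<lambda>x. shift_pt x (-1)) ` I \<longleftrightarrow> x \<in> I \<and> shift_pt x 1 \<notin> I"
proof -
  have "x = shift_pt y (-1) \<longleftrightarrow> y = shift_pt x 1" for y
    by (auto simp: shift_pt_def fun_eq_iff)
  then show ?thesis by (simp add: image_iff)
qed

text \<open>If \<open>j\<close> came before \<open>i\<close>, the point with coordinates up to
  \<open>j\<close> raised would lie below a point of the ideal. Used in both directions, this gives
  uniqueness of the index.\<close>

lemma rank_vertex_le:
  assumes "down_closed I" "rank_vertex I x i" "rank_vertex I x j"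
  shows "i \<le> j"
proof (rule ccontr)
  assume lt: "\<not> i \<le> j"
  have "(\<lambda>k. if k \<le> j then x k + 1 else x k) \<in> I"
    by (rule down_closedD[OF assms(1), of "\<lambda>k. if k < i then x k + 1 else x k"])
      (use assms(2) lt in \<open>auto simp: rank_vertex_def\<close>)
  then show False using assms(3) by (simp add: rank_vertex_def)
qed

lemma rank_vertex_exists:
  fixes x :: "'r::{finite, linorder} pt"
  assumes "x \<in> I" "shift_pt x 1 \<notin> I"
  shows "\<exists>i. rank_vertex I x i"
proof -
  \<comment> \<open>\<open>S\<close> collects the positions at which the chain is already outside;
    its minimum is the exit step.\<close>
  define S where "S = {i. (\<lambda>j. if j \<le> i then x j + 1 else x j) \<notin> I}"
  have "Max UNIV \<in> S" using assms(2) by (simp add: S_def shift_pt_def)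
  then have S: "Min S \<in> S" by (intro Min_in) auto
  define i where "i = Min S"
  have "(\<lambda>j. if j < i then x j + 1 else x j) \<in> I"
  proof (cases "{j. j < i} = {}")
    case True
    then have "(\<lambda>j. if j < i then x j + 1 else x j) = x" by auto
    then show ?thesis using assms(1) by simp
  next
    case False
    define k where "k = Max {j. j < i}"
    have k: "k < i" using Max_in[of "{j. j < i}"] False by (auto simp: k_def)
    have *: "j < i \<longleftrightarrow> j \<le> k" for j
      using k Max_ge[of "{j. j < i}" j] by (auto simp: k_def)
    have "k \<notin> S" using k Min_le[OF finite, of k S] unfolding i_def by (meson leD)
    then show ?thesis unfolding * by (simp add: S_def)
  qed
  then show ?thesis using S by (auto simp: rank_vertex_def S_def i_def)
qed

lemma mem_F_set: "v \<in> F_set i \<longleftrightarrow>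
   (\<forall>j. (j < i \<longrightarrow> v j = 0 \<or> v j = 1) \<and> (j > i \<longrightarrow> v j = 0 \<or> v j = -1)) \<and> v i = 0"
proof
  assume R: "(\<forall>j. (j < i \<longrightarrow> v j = 0 \<or> v j = 1) \<and> (j > i \<longrightarrow> v j = 0 \<or> v j = -1)) \<and> v i = 0"
  then have "v = (\<lambda>j. if j < i then \<bar>v j\<bar> else if j > i then - \<bar>v j\<bar> else 0)"
  proof (intro ext)
    fix j
    show "v j = (if j < i then \<bar>v j\<bar> else if j > i then - \<bar>v j\<bar> else 0)"
      using R[THEN conjunct1, rule_format, of j] R by (cases j i rule: linorder_cases) auto
  qed
  moreover have "\<bar>if j = i then 0 else v j\<bar> \<in> {0, 1}" for j
    using R[THEN conjunct1, rule_format, of j] R by (cases j i rule: linorder_cases) auto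
  then have "\<forall>j. \<bar>v j\<bar> \<in> {0, 1}" using R
    by (metis abs_zero insertCI)
  ultimately show "v \<in> F_set i" unfolding F_set_def mem_Collect_eq
    by (intro exI[of _ "\<lambda>j. \<bar>v j\<bar>"]) simp
next
  assume "v \<in> F_set i"
  then obtain a where "\<And>j. a j = 0 \<or> a j = 1"
    "v = (\<lambda>j. if j < i then a j else if j > i then - a j else 0)"
    by (auto simp: F_set_def)
  then show "(\<forall>j. (j < i \<longrightarrow> v j = 0 \<or> v j = 1) \<and> (j > i \<longrightarrow> v j = 0 \<or> v j = -1)) \<and> v i = 0"
    by (metis neg_equal_0_iff_equal not_less_iff_gr_or_eq)
qed

lemma add_mem_image_F_set: "y \<in> (\<lambda>v. x + v) ` F_set i \<longleftrightarrow>
   (\<forall>j. (j < i \<longrightarrow> y j = x j \<or> y j = x j + 1) \<and> (j > i \<longrightarrow> y j = x j \<or> y j = x j - 1)) \<and> y i = x i"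
proof -
  have "y \<in> (\<lambda>v. x + v) ` F_set i \<longleftrightarrow> y - x \<in> F_set i"
    by (auto simp: image_iff intro!: bexI[of _ "y - x"])
  then show ?thesis by (simp add: mem_F_set algebra_simps)
qed

text \<open>Two corners decide about the whole cube: the top corner x + sum_{j<i} e_j controls
  membership in \<open>I\<close>, and the bottom corner x - sum_{j>i} e_j, shifted by (1,...,1), is
  the point that has to lie outside.\<close>

lemma rank_vertex_iff:
  fixes x :: "'r::{finite, linorder} pt"
  assumes I: "down_closed I" and X: "X = I - (\<lambda>x. shift_pt x (-1)) ` I"
  shows "(\<lambda>v. x + v) ` F_set i \<subseteq> X \<longleftrightarrow> rank_vertex I x i"
proof
  assume L: "(\<lambda>v. x + v) ` F_set i \<subseteq> X"
  have "(\<lambda>j. if j < i then x j + 1 else x j) \<in> (\<lambda>v. x + v) ` F_set i"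
    unfolding add_mem_image_F_set by auto
  then have 1: "(\<lambda>j. if j < i then x j + 1 else x j) \<in> I" using L X by blast
  have "(\<lambda>j. if j > i then x j - 1 else x j) \<in> (\<lambda>v. x + v) ` F_set i"
    unfolding add_mem_image_F_set by auto
  then have "(\<lambda>j. if j > i then x j - 1 else x j) \<in> X" using L by blast
  then have "shift_pt (\<lambda>j. if j > i then x j - 1 else x j) 1 \<notin> I"
    unfolding X mem_boundary_iff by simp
  moreover have "shift_pt (\<lambda>j. if j > i then x j - 1 else x j) 1 =
      (\<lambda>j. if j \<le> i then x j + 1 else x j)"
    by (auto simp: shift_pt_def fun_eq_iff)
  ultimately show "rank_vertex I x i" using 1 by (simp add: rank_vertex_def)
next
  assume R: "rank_vertex I x i"
  show "(\<lambda>v. x + v) ` F_set i \<subseteq> X"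
  proof
    fix y assume y: "y \<in> (\<lambda>v. x + v) ` F_set i"
    note y' = y[unfolded add_mem_image_F_set]
    have le: "y j \<le> (if j < i then x j + 1 else x j)" for j
      using y'[THEN conjunct1, rule_format, of j] y' by (cases j i rule: linorder_cases) auto
    have "y \<in> I"
      by (rule down_closedD[OF I, of "\<lambda>j. if j < i then x j + 1 else x j"])
        (use R le in \<open>auto simp: rank_vertex_def\<close>)
    moreover have "(if j \<le> i then x j + 1 else x j) \<le> shift_pt y 1 j" for j
      using y'[THEN conjunct1, rule_format, of j] y'
      by (cases j i rule: linorder_cases) (auto simp: shift_pt_def)
    then have "shift_pt y 1 \<notin> I"
      using R down_closedD[OF I, of "shift_pt y 1" "\<lambda>j. if j \<le> i then x j + 1 else x j"]
      by (auto simp: rank_vertex_def)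
    ultimately show "y \<in> X" unfolding X mem_boundary_iff by simp
  qed
qed

lemma cub_index_rank_vertex:
  fixes x :: "'r::{finite, linorder} pt"
  assumes I: "down_closed I" and X: "X = I - (\<lambda>x. shift_pt x (-1)) ` I" and x: "x \<in> X"
  shows "rank_vertex I x (cub_index X x)"
proof -
  have "\<exists>!i. rank_vertex I x i"
    using rank_vertex_exists[of x I] rank_vertex_le[OF I] x unfolding X mem_boundary_iff
    by (blast intro: antisym)
  then show ?thesis
    unfolding cub_index_def rank_vertex_iff[OF I X] by (rule theI')
qed

lemma cubistE:
  assumes "cubist X"
  obtains I where "down_closed I" "X = I - (\<lambda>x. shift_pt x (-1)) ` I"
  using assms unfolding cubist_def down_closed_def by blast

lemma mem_lambda_set: "y \<in> lambda_set X x \<longleftrightarrow>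
   (\<forall>j. (j < cub_index X x \<longrightarrow> y j = x j \<or> y j = x j + 1) \<and>
        (j > cub_index X x \<longrightarrow> y j = x j \<or> y j = x j - 1)) \<and> y (cub_index X x) = x (cub_index X x)"
  unfolding lambda_set_def by (rule add_mem_image_F_set)

lemma mem_mu_set: "y \<in> mu_set X x \<longleftrightarrow>
   (\<forall>j. (j < cub_index X x \<longrightarrow> y j \<le> x j) \<and> (j > cub_index X x \<longrightarrow> x j \<le> y j))"
proof -
  have "y \<in> (\<lambda>v. x + v) ` C_set i \<longleftrightarrow> y - x \<in> C_set i" for i
    by (auto simp: image_iff intro!: bexI[of _ "y - x"])
  then show ?thesis by (auto simp: mu_set_def C_set_def)
qed

lemma lambda_set_subset:
  fixes X :: "'r::{finite, linorder} pt set"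
  assumes "cubist X" "x \<in> X"
  shows "lambda_set X x \<subseteq> X"
proof -
  obtain I where I: "down_closed I" and X: "X = I - (\<lambda>x. shift_pt x (-1)) ` I"
    using cubistE[OF assms(1)] .
  show ?thesis
    unfolding lambda_set_def rank_vertex_iff[OF I X] by (rule cub_index_rank_vertex[OF I X assms(2)])
qed

text \<open>
  A strict order on \<open>X\<close> that relates \<open>x\<close> to \<open>y\<close> if \<open>x \<succ> y\<close>, and \<open>t\<close> to \<open>x\<close> if \<open>t \<in> \<mu> x\<close> and
  \<open>t \<noteq> x\<close>; hence no \<open>t \<prec> x\<close> lies in \<open>\<mu> x\<close>.
\<close>

definition lex_less :: "('r::{finite, linorder} pt \<Rightarrow> 'r) \<Rightarrow> 'r pt \<Rightarrow> 'r pt \<Rightarrow> bool" where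
  "lex_less h x y \<longleftrightarrow> (\<exists>p. (\<forall>j<p. x j = y j) \<and> p \<le> h x \<and> p \<le> h y \<and>
     (x p < y p \<or> x p = y p \<and> h x = p \<and> (p < h y \<or> sum y UNIV < sum x UNIV)))"

lemma lex_less_irrefl: "\<not> lex_less h x x"
  by (auto simp: lex_less_def)

text \<open>\<open>lex_less h\<close> is the dictionary order on the words x_1 ... x_(h x): a proper
  prefix comes first, and of two points with equal words the one with the larger coordinate sum
  comes first. The smaller of the two deciding positions decides for the composite.\<close>

lemma lex_less_trans:
  assumes "lex_less h x y" "lex_less h y z"
  shows "lex_less h x z"
proof -
  obtain p where p: "\<forall>j<p. x j = y j" "p \<le> h x" "p \<le> h y"
    "x p < y p \<or> x p = y p \<and> h x = p \<and> (p < h y \<or> sum y UNIV < sum x UNIV)"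
    using assms(1) by (auto simp: lex_less_def)
  obtain q where q: "\<forall>j<q. y j = z j" "q \<le> h y" "q \<le> h z"
    "y q < z q \<or> y q = z q \<and> h y = q \<and> (q < h z \<or> sum z UNIV < sum y UNIV)"
    using assms(2) by (auto simp: lex_less_def)
  consider "p < q" | "q < p" | "p = q" by fastforce
  then show ?thesis
  proof cases
    case 1
    then show ?thesis unfolding lex_less_def
      using p q by (intro exI[of _ p]) auto
  next
    case 2
    then show ?thesis unfolding lex_less_def
      using p q by (intro exI[of _ q]) auto
  next
    case 3
    then show ?thesis unfolding lex_less_def
      using p q by (intro exI[of _ p]) auto
  qed
qed

text \<open>A step within \<lambda> x either raises a coordinate before the index, which enlarges
  the word at the first such place, or only lowers coordinates after it; then the word of x is a
  prefix of the word of y, and in case of equality the sum has dropped.\<close>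

lemma lambda_set_lex_less:
  fixes X :: "'r::{finite, linorder} pt set"
  assumes "cubist X" "x \<in> X" "y \<in> lambda_set X x" "y \<noteq> x"
  shows "lex_less (cub_index X) x y"
proof -
  obtain I where I: "down_closed I" and X: "X = I - (\<lambda>x. shift_pt x (-1)) ` I"
    using cubistE[OF assms(1)] .
  define i where "i = cub_index X x"
  define i' where "i' = cub_index X y"
  have yX: "y \<in> X" using lambda_set_subset assms by blast
  have x: "rank_vertex I x i" and y: "rank_vertex I y i'"
    using cub_index_rank_vertex[OF I X] assms(2) yX by (auto simp: i_def i'_def)
  have lam: "(j < i \<longrightarrow> y j = x j \<or> y j = x j + 1) \<and> (j > i \<longrightarrow> y j = x j \<or> y j = x j - 1)"
    "y i = x i" for j
    using assms(3) by (auto simp: mem_lambda_set i_def)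
  \<comment> \<open>The word of y reaches any position p \<le> i before which nothing has changed:
    otherwise y raised up to \<open>i'\<close> would lie below x raised before \<open>i\<close>,
    which is in \<open>I\<close>.\<close>
  have below: "p \<le> i'" if "p \<le> i" "\<And>j. j < p \<Longrightarrow> y j = x j" for p
  proof (rule ccontr)
    assume "\<not> p \<le> i'"
    then have le: "(if j \<le> i' then y j + 1 else y j) \<le> (if j < i then x j + 1 else x j)" for j
      using that(1) that(2)[of j] lam(1)[of j] lam(2) by (cases j i rule: linorder_cases) auto
    have "(\<lambda>j. if j \<le> i' then y j + 1 else y j) \<in> I"
      by (rule down_closedD[OF I, of "\<lambda>j. if j < i then x j + 1 else x j"])
        (use x le in \<open>auto simp: rank_vertex_def\<close>)
    then show False using y by (simp add: rank_vertex_def)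
  qed
  show ?thesis
  proof (cases "\<exists>j<i. y j \<noteq> x j")
    case True
    define p where "p = Min {j. j < i \<and> y j \<noteq> x j}"
    have p: "p < i" "y p \<noteq> x p" using Min_in[of "{j. j < i \<and> y j \<noteq> x j}"] True by (auto simp: p_def)
    have pl: "y j = x j" if "j < p" for j
      using Min_le[of "{j. j < i \<and> y j \<noteq> x j}" j] that p by (fastforce simp: p_def)
    have "x p < y p" using lam(1)[of p] p by auto
    then show ?thesis using p pl below[of p] unfolding lex_less_def
      by (intro exI[of _ p]) (auto simp: i_def i'_def)
  next
    case False
    have le: "y j \<le> x j" for j using False lam(1)[of j] lam(2) by (cases j i rule: linorder_cases) auto
    obtain j where "y j \<noteq> x j" using assms(4) by blast
    then have "sum y UNIV < sum x UNIV" using le by (intro sum_strict_mono_ex1) (auto intro!: exI[of _ j] simp: order.strict_iff_order)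
    then show ?thesis using False below[of i] lam(2) unfolding lex_less_def
      by (intro exI[of _ i]) (auto simp: i_def i'_def)
  qed
qed

text \<open>The direction is opposite to that of \<lambda>: before the index, coordinates in \<mu> x
  can only drop, so at the first change the word of t is smaller or has already ended. Without such
  a change, equal words are separated by the sum, since coordinates after the index only
  grow.\<close>

lemma mu_set_lex_less:
  fixes X :: "'r::{finite, linorder} pt set"
  assumes "cubist X" "x \<in> X" "t \<in> X" "t \<in> mu_set X x" "t \<noteq> x"
  shows "lex_less (cub_index X) t x"
proof -
  obtain I where I: "down_closed I" and X: "X = I - (\<lambda>x. shift_pt x (-1)) ` I"
    using cubistE[OF assms(1)] .
  define i where "i = cub_index X x"
  define i' where "i' = cub_index X t"
  have x: "rank_vertex I x i" and t: "rank_vertex I t i'"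
    using cub_index_rank_vertex[OF I X] assms(2,3) by (auto simp: i_def i'_def)
  have mu: "j < i \<Longrightarrow> t j \<le> x j" "j > i \<Longrightarrow> x j \<le> t j" for j
    using assms(4) by (auto simp: mem_mu_set i_def)
  define S where "S = {j. j < i \<and> t j \<noteq> x j}"
  show ?thesis
  proof (cases "S = {}")
    case False
    define q where "q = Min S"
    have q: "q < i" "t q \<noteq> x q" using Min_in[of S] False by (auto simp: q_def S_def)
    have ql: "t j = x j" if "j < q" for j
      using Min_le[of S j] that q by (fastforce simp: q_def S_def)
    show ?thesis
    proof (cases "q \<le> i'")
      case True
      then show ?thesis unfolding lex_less_def
        using q ql mu(1)[of q] by (intro exI[of _ q]) (auto simp: i_def i'_def)
    next
      case False
      then show ?thesis unfolding lex_less_def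
        using q ql by (intro exI[of _ i']) (auto simp: i_def i'_def)
    qed
  next
    case True
    then have eq: "t j = x j" if "j < i" for j using that by (auto simp: S_def)
    consider "i' < i" | "i \<le> i'" "t i < x i" | "i' = i" "t i = x i"
      | "i \<le> i'" "t i > x i \<or> t i = x i \<and> i < i'" by fastforce
    then show ?thesis
    proof cases
      case 1
      then show ?thesis unfolding lex_less_def
        using eq by (intro exI[of _ i']) (auto simp: i_def i'_def)
    next
      case 2
      then show ?thesis unfolding lex_less_def
        using eq by (intro exI[of _ i]) (auto simp: i_def i'_def)
    next
      case 3
      have le: "x j \<le> t j" for j using mu[of j] eq[of j] 3 by (cases j i rule: linorder_cases) auto
      obtain j where "t j \<noteq> x j" using assms(5) by blast
      then have "sum x UNIV < sum t UNIV"
        using le by (intro sum_strict_mono_ex1) (auto intro!: exI[of _ j] simp: order.strict_iff_order)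
      then show ?thesis using 3 eq unfolding lex_less_def
        by (intro exI[of _ i]) (auto simp: i_def i'_def)
    next
      \<comment> \<open>Here the word of t would be the larger one. But then x raised up to
        \<open>i\<close> lies below t raised before \<open>i'\<close>, a point of \<open>I\<close>,
        against the exit of x at \<open>i\<close>.\<close>
      case 4
      have le: "(if j \<le> i then x j + 1 else x j) \<le> (if j < i' then t j + 1 else t j)" for j
        using 4 mu[of j] eq[of j] by (cases j i rule: linorder_cases) auto
      have "(\<lambda>j. if j \<le> i then x j + 1 else x j) \<in> I"
        by (rule down_closedD[OF I, of "\<lambda>j. if j < i' then t j + 1 else t j"])
          (use t le in \<open>auto simp: rank_vertex_def\<close>)
      then show ?thesis using x by (simp add: rank_vertex_def)
    qed
  qed
qed

text \<open>A chain of steps from x to t \<noteq> x ascends in \<open>lex_less\<close>, while every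
  point of \<open>X\<close> in \<mu> x other than x is below x.\<close>

lemma succeq_not_mem_mu_set:
  fixes X :: "'r::{finite, linorder} pt set"
  assumes "cubist X" "x \<in> X" "succeq X x t" "t \<noteq> x"
  shows "t \<notin> mu_set X x"
proof
  assume t: "t \<in> mu_set X x"
  have "t \<in> X \<and> (t \<noteq> x \<longrightarrow> lex_less (cub_index X) x t)"
    using assms(3) unfolding succeq_def
  proof (induction rule: rtrancl_induct)
    case (step y z)
    have yz: "y \<in> X" "z \<in> lambda_set X y" using step.hyps(2) by auto
    then have "z \<in> X" using lambda_set_subset[OF assms(1)] by blast
    then show ?case
      using step.IH lambda_set_lex_less[OF assms(1) yz] by (metis lex_less_trans)
  qed (use assms(2) in auto)
  moreover have "lex_less (cub_index X) t x"
    using mu_set_lex_less[OF assms(1,2) _ t assms(4)] calculation by blast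
  ultimately show False using lex_less_trans lex_less_irrefl assms(4) by blast
qed

section \<open>Commuting arrows and reduction to normal monomials\<close>

section \<open>Monomial bases of V\<close>

definition wt :: "'r arrow multiset \<Rightarrow> 'r pt" where
  "wt m = (\<Sum>a\<in>#m. arrow_step a)"

lemma wt_simps [simp]:
  "wt {#} = 0" "wt (add_mset a m) = arrow_step a + wt m" "wt (m + n) = wt m + wt n"
  by (simp_all add: wt_def)

lemma path_target_eq: "path_target p = fst p + wt (mset (snd p))"
  by (simp add: path_target_def wt_def flip: mset_map sum_mset_sum_list)

lemma vpath_mult:
  "vpath (x, u) * vpath (y, v) = (if path_target (x, u) = y then vpath (x, u @ v) else 0)"
  by transfer (auto simp: path_elem_def path_mult_single V_rel_def V_ideal.zero)

lemma vpath_append: "vpath (x, u @ v) = vpath (x, u) * vpath (path_target (x, u), v)"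
  by (simp add: vpath_mult)

lemma V_rel_of_relation: "a - b \<in> V_relations \<Longrightarrow> V_rel a b"
  by (simp add: V_rel_def V_ideal.gen)

lemma alpha_beta_relation:
  fixes x :: "'r::finite pt"
  shows "path_elem (x, [Alpha i, Beta j]) - path_elem (x, [Beta j, Alpha i]) \<in> V_relations"
  unfolding V_relations_def
  by (rule UnI1, rule UnI2, rule CollectI, rule exI[of _ x], rule exI[of _ i], rule exI[of _ j]) simp

text \<open>The three families of commutation relations cover all pairs of distinct arrow types,
  including \<open>Alpha i\<close> with \<open>Beta i\<close>.\<close>

lemma vpath_swap: "vpath (x, [a, b]) = (vpath (x, [b, a]) :: ('k::field, 'r::finite) valg)"
proof -
  have AB: "vpath (x, [Alpha i, Beta j]) = (vpath (x, [Beta j, Alpha i]) :: ('k, 'r) valg)" for i j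
    by transfer (rule V_rel_of_relation, rule alpha_beta_relation)
  have AA: "vpath (x, [Alpha i, Alpha j]) = (vpath (x, [Alpha j, Alpha i]) :: ('k, 'r) valg)"
    if "i \<noteq> j" for i j
    using that by transfer (rule V_rel_of_relation, auto simp: V_relations_def)
  have BB: "vpath (x, [Beta i, Beta j]) = (vpath (x, [Beta j, Beta i]) :: ('k, 'r) valg)"
    if "i \<noteq> j" for i j
    using that by transfer (rule V_rel_of_relation, auto simp: V_relations_def)
  show ?thesis
  proof (cases "a = b")
    case False
    then show ?thesis by (cases a; cases b) (auto intro: AA BB AB AB[symmetric])
  qed simp
qed

lemma vpath_cons: "vpath (x, a # u) = vpath (x, [a]) * vpath (x + arrow_step a, u)"
  using vpath_append[of x "[a]" u] by (simp add: path_target_def)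

text \<open>Each arrow type is available at every vertex, so a letter can be exchanged with its
  neighbours one at a time. Iterating this makes a path depend only on its source and its multiset
  of arrows.\<close>

lemma vpath_move: "vpath (x, u @ a # v) = (vpath (x, a # u @ v) :: ('k::field, 'r::finite) valg)"
proof (induction u arbitrary: x)
  case (Cons b u)
  have "vpath (x, (b # u) @ a # v) = vpath (x, [b]) * (vpath (x + arrow_step b, a # u @ v) :: ('k, 'r) valg)"
    unfolding append_Cons vpath_cons[of x b "u @ a # v"] Cons.IH ..
  also have "\<dots> = vpath (x, [b, a] @ u @ v)"
    unfolding append_Cons append_Nil by (rule vpath_cons[symmetric])
  also have "\<dots> = vpath (x, [b, a]) * vpath (path_target (x, [b, a]), u @ v)"
    by (rule vpath_append)
  also have "\<dots> = vpath (x, [a, b]) * vpath (path_target (x, [a, b]), u @ v)"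
    by (simp add: vpath_swap path_target_def add_ac)
  also have "\<dots> = vpath (x, [a, b] @ u @ v)" by (rule vpath_append[symmetric])
  finally show ?case by simp
qed simp

lemma vpath_mset_cong:
  assumes "mset u = mset v"
  shows "vpath (x, u) = (vpath (x, v) :: ('k::field, 'r::finite) valg)"
  using assms
proof (induction u arbitrary: v x)
  case (Cons a u)
  then obtain v1 v2 where v: "v = v1 @ a # v2"
    by (metis in_set_conv_decomp list.set_intros(1) mset_eq_setD)
  have "vpath (x, a # u) = vpath (x, [a]) * (vpath (x + arrow_step a, u) :: ('k, 'r) valg)"
    by (rule vpath_cons)
  also have "\<dots> = vpath (x, [a]) * vpath (x + arrow_step a, v1 @ v2)"
    using Cons.IH[of "v1 @ v2"] Cons.prems v by simp
  also have "\<dots> = vpath (x, a # v1 @ v2)" by (rule vpath_cons[symmetric])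
  also have "\<dots> = vpath (x, v)" unfolding v by (rule vpath_move[symmetric])
  finally show ?case .
qed simp

text \<open>Any arrangement of the letters serves, by \<open>vpath_mset_cong\<close>.\<close>

definition word :: "'a multiset \<Rightarrow> 'a list" where
  "word m = (SOME w. mset w = m)"

lemma mset_word [simp]: "mset (word m) = m"
  unfolding word_def using someI_ex[OF ex_mset] .

text \<open>Indexed by the target \<open>y\<close> of the paths, not by their source.\<close>

definition bas :: "'r::finite pt \<Rightarrow> 'r arrow multiset \<Rightarrow> ('k::field, 'r) valg" where
  "bas y m = vpath (y - wt m, word m)"

lemma vpath_eq_bas: "vpath (x, w) = bas (x + wt (mset w)) (mset w)"
  unfolding bas_def using vpath_mset_cong[of w "word (mset w)" x] by simp

lemma bas_mult:
  "bas y m * bas z n = (if y = z - wt n then bas z (m + n) else (0 :: ('k::field, 'r::finite) valg))"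
proof -
  have "bas z (m + n) = (vpath (z - wt (m + n), word m @ word n) :: ('k, 'r) valg)"
    unfolding bas_def by (rule vpath_mset_cong) simp
  then show ?thesis
    unfolding bas_def by (auto simp: vpath_mult path_target_eq diff_diff_eq add.commute)
qed

lemma videm_eq_bas: "videm y = bas y {#}"
  by (simp add: vpath_eq_bas)

lemma videm_mult_bas: "videm z * bas y m = (if z = y - wt m then bas y m else 0)"
  by (simp add: videm_eq_bas bas_mult)

lemma bas_mult_videm: "bas y m * videm z = (if y = z then bas y m else 0)"
  by (simp add: videm_eq_bas bas_mult)

lemma abs_valg_sum: "abs_valg (sum f S) = (\<Sum>s\<in>S. abs_valg (f s))"
  by (induction S rule: infinite_finite_induct) (simp_all add: zero_valg.abs_eq plus_valg.abs_eq[symmetric])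

lemma abs_valg_scale: "abs_valg (pm_scale c a) = vscale c (abs_valg a)"
  by (simp add: vscale.abs_eq)

lemma vpath_abs: "vpath p = abs_valg (path_elem p)"
  by (simp add: vpath.abs_eq)

lemma abs_valg_eq_sum:
  fixes a :: "'r::finite path \<Rightarrow>\<^sub>0 'k::field"
  shows "abs_valg a = (\<Sum>p\<in>keys a. vscale (lookup a p) (vpath p))"
proof -
  have *: "single p c = pm_scale c (path_elem p)" for p :: "'r path" and c :: 'k
    by (rule poly_mapping_eqI) (simp add: path_elem_def lookup_single when_def)
  show ?thesis
    by (subst pm_sum_single) (simp add: abs_valg_sum * abs_valg_scale vpath_abs)
qed

lemma valg_span_bas: "(v :: ('k::field, 'r::finite) valg) \<in> V.span {bas y m | y m. True}"
proof -
  obtain a where v: "v = abs_valg a"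
    using Quotient3_abs_rep[OF Quotient3_valg, of v] by metis
  show ?thesis unfolding v abs_valg_eq_sum
    by (intro V.span_sum V.span_scale V.span_base) (auto simp: vpath_eq_bas, blast)
qed

lemma sum_vpath_relation: "(\<Sum>j\<in>UNIV. vpath (x, [Beta j, Alpha j])) = (0 :: ('k::field, 'r::finite) valg)"
proof -
  have "V_rel (\<Sum>j\<in>UNIV. path_elem (x, [Beta j, Alpha j])) (0 :: 'r path \<Rightarrow>\<^sub>0 'k)"
    by (rule V_rel_of_relation) (auto simp: V_relations_def)
  then have "abs_valg (\<Sum>j\<in>UNIV. path_elem (x, [Beta j, Alpha j])) = (0 :: ('k, 'r) valg)"
    by (simp add: zero_valg.abs_eq valg.abs_eq_iff)
  then show ?thesis by (simp add: abs_valg_sum vpath_abs)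
qed

text \<open>This is the defining relation at y multiplied on the left by a path ending there; the
  loops have weight zero, so all terms share source and target.\<close>

lemma sum_bas_relation:
  "(\<Sum>j\<in>UNIV. bas y (m + {#Alpha j, Beta j#})) = (0 :: ('k::field, 'r::finite) valg)"
proof -
  have "bas y (m + {#Alpha j, Beta j#}) = bas (y) m * (vpath (y, [Beta j, Alpha j]) :: ('k, 'r) valg)" for j
    by (simp add: vpath_eq_bas bas_mult add_mset_commute)
  then show ?thesis by (simp add: sum_vpath_relation flip: sum_distrib_left)
qed

text \<open>Polynomials in the arrow types are mapped onto V f_y; for each \<open>i\<close> the
  polynomials in monomials satisfying \<open>nf i\<close> form a complement of the kernel.\<close>

definition Psi :: "'r::finite pt \<Rightarrow> ('r arrow multiset \<Rightarrow>\<^sub>0 'k::field) \<Rightarrow> ('k, 'r) valg" where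
  "Psi y p = (\<Sum>m\<in>keys p. vscale (lookup p m) (bas y m))"

lemma Psi_eq_lin_ext: "Psi y = V.lin_ext (bas y)"
  by (simp add: fun_eq_iff Psi_def V.lin_ext_def)

lemma Psi_zero [simp]: "Psi y 0 = 0"
  and Psi_single [simp]: "Psi y (single m c) = vscale c (bas y m)"
  and Psi_add: "Psi y (p + q) = Psi y p + Psi y q"
  and Psi_scale: "Psi y (pm_scale c p) = vscale c (Psi y p)"
  and Psi_sum: "Psi y (sum f S) = (\<Sum>s\<in>S. Psi y (f s))"
  and Psi_uminus: "Psi y (- p) = - Psi y p"
  and Psi_diff: "Psi y (p - q) = Psi y p - Psi y q"
  by (simp_all add: Psi_eq_lin_ext V.lin_ext_simps)

definition nf :: "'r \<Rightarrow> 'r arrow multiset \<Rightarrow> bool" where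
  "nf i m \<longleftrightarrow> Alpha i \<notin># m \<or> Beta i \<notin># m"

text \<open>Solving the relation for a_i b_i replaces a monomial divisible by it by monomials with
  one a_i less, so the rewriting ends. All products a_j b_j have the same size and weight, so these
  are preserved.\<close>

lemma bas_reduce:
  "\<exists>p. keys p \<subseteq> {n. nf i n \<and> size n = size m \<and> wt n = wt m} \<and>
     Psi y p = (bas y m :: ('k::field, 'r::finite) valg)"
proof (induction "count m (Alpha i)" arbitrary: m)
  case 0
  then show ?case
    by (intro exI[of _ "single m 1"]) (auto simp: nf_def not_in_iff)
next
  case (Suc k)
  show ?case
  proof (cases "Beta i \<in># m")
    case False
    then show ?thesis
      by (intro exI[of _ "single m 1"]) (auto simp: nf_def)
  next
    case True
    define n where "n = m - {#Alpha i, Beta i#}"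
    have m: "m = n + {#Alpha i, Beta i#}"
    proof -
      have "Alpha i \<in># m" using Suc.hyps(2) by (metis Zero_not_Suc not_in_iff)
      then have "{#Alpha i, Beta i#} \<subseteq># m" using True
        by (auto simp: subseteq_mset_def not_in_iff Suc_le_eq)
      then show ?thesis unfolding n_def by (rule subset_mset.diff_add[symmetric])
    qed
    have "\<forall>j\<in>UNIV - {i}. \<exists>p. keys p \<subseteq> {n. nf i n \<and> size n = size m \<and> wt n = wt m} \<and>
        Psi y p = (bas y (n + {#Alpha j, Beta j#}) :: ('k, 'r) valg)"
    proof
      fix j assume j: "j \<in> UNIV - {i}"
      have "k = count (n + {#Alpha j, Beta j#}) (Alpha i)" using Suc.hyps(2) j by (simp add: m)
      from Suc.hyps(1)[OF this] show "\<exists>p. keys p \<subseteq> {n. nf i n \<and> size n = size m \<and> wt n = wt m} \<and>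
        Psi y p = (bas y (n + {#Alpha j, Beta j#}) :: ('k, 'r) valg)"
        by (simp add: m)
    qed
    from bchoice[OF this] obtain P where P: "\<forall>j\<in>UNIV - {i}.
        keys (P j) \<subseteq> {n. nf i n \<and> size n = size m \<and> wt n = wt m} \<and>
        Psi y (P j) = (bas y (n + {#Alpha j, Beta j#}) :: ('k, 'r) valg)" ..
    define p where "p = - (\<Sum>j\<in>UNIV - {i}. P j)"
    have "keys p \<subseteq> (\<Union>j\<in>UNIV - {i}. keys (P j))"
      unfolding p_def keys_minus by (rule Poly_Mapping.keys_sum)
    also have "\<dots> \<subseteq> {n. nf i n \<and> size n = size m \<and> wt n = wt m}"
      by (rule UN_least) (use P in simp)
    finally have keys: "keys p \<subseteq> {n. nf i n \<and> size n = size m \<and> wt n = wt m}" .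
    have "bas y m + (\<Sum>j\<in>UNIV - {i}. bas y (n + {#Alpha j, Beta j#})) = (0 :: ('k, 'r) valg)"
      using sum_bas_relation[of y n] by (simp add: m sum.remove[of UNIV i])
    then have "Psi y p = (bas y m :: ('k, 'r) valg)"
      using P by (simp add: p_def Psi_uminus Psi_sum add_eq_0_iff2)
    with keys show ?thesis by (intro exI[of _ p] conjI)
  qed
qed

section \<open>Independence of normal monomials by comparison with a polynomial ring\<close>

subsection \<open>Linear independence\<close>

lemma lookup_single_times:
  "lookup (single n 1 * (g :: 'a multiset \<Rightarrow>\<^sub>0 'k::field)) m =
     (if n \<subseteq># m then lookup g (m - n) else 0)"
proof (induction g rule: pm_induct)
  case (2 l c)
  show ?case
    by (auto simp: mult_single lookup_single when_def subset_mset.add_diff_inverse)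
      (metis mset_subset_eq_add_left)
qed (simp_all add: distrib_left lookup_add)

definition qrel :: "'r::finite arrow multiset \<Rightarrow>\<^sub>0 'k::field" where
  "qrel = (\<Sum>j\<in>UNIV. single {#Alpha j, Beta j#} 1)"

lemma lookup_qrel_times:
  "lookup (qrel * g) m =
     (\<Sum>j\<in>UNIV. if {#Alpha j, Beta j#} \<subseteq># m then lookup g (m - {#Alpha j, Beta j#}) else 0)"
  unfolding qrel_def sum_distrib_right lookup_sum lookup_single_times ..

text \<open>A monomial of \<open>g\<close> of maximal degree in \<open>a\<^sub>i\<close>, times \<open>a\<^sub>i b\<^sub>i\<close>, cannot cancel in \<open>qrel * g\<close>.\<close>

lemma nf_not_multiple:
  fixes g :: "'r::finite arrow multiset \<Rightarrow>\<^sub>0 'k::field"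
  assumes nf: "keys p \<subseteq> {m. nf i m}" and p: "p = qrel * g"
  shows "p = 0"
proof (rule ccontr)
  assume "p \<noteq> 0"
  then have g: "keys g \<noteq> {}" using p by auto
  define w where "w = (\<lambda>m :: 'r arrow multiset. count m (Alpha i))"
  define k where "k = Max (w ` keys g)"
  have "k \<in> w ` keys g" unfolding k_def using g by (intro Max_in) auto
  then obtain m where m: "m \<in> keys g" "w m = k" by auto
  have mx: "w n \<le> k" if "n \<in> keys g" for n
    unfolding k_def using that by (intro Max_ge) auto
  define M where "M = m + {#Alpha i, Beta i#}"
  have "lookup p M =
    (\<Sum>j\<in>UNIV. if {#Alpha j, Beta j#} \<subseteq># M then lookup g (M - {#Alpha j, Beta j#}) else 0)"
    unfolding p lookup_qrel_times ..
  also have "\<dots> = (\<Sum>j\<in>UNIV. if j = i then lookup g m else 0)"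
  proof (intro sum.cong refl)
    fix j
    show "(if {#Alpha j, Beta j#} \<subseteq># M then lookup g (M - {#Alpha j, Beta j#}) else 0) =
      (if j = i then lookup g m else 0)"
    proof (cases "j = i")
      case False
      then have "w (M - {#Alpha j, Beta j#}) = Suc k" by (simp add: w_def M_def flip: m(2))
      then have "M - {#Alpha j, Beta j#} \<notin> keys g" using mx by fastforce
      then show ?thesis using False by (simp add: in_keys_iff)
    qed (simp add: M_def)
  qed
  also have "\<dots> \<noteq> 0" using m(1) by (simp add: in_keys_iff)
  finally have "M \<in> keys p" by (simp add: in_keys_iff)
  then show False using nf by (auto simp: nf_def M_def)
qed

text \<open>The order of the arrows is forgotten on paths from \<open>x\<close> to \<open>y\<close>.
  With both ends fixed, multiplication by a single path becomes multiplication of polynomials, so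
  membership in the two-sided ideal can be followed.\<close>

definition comm_part ::
  "'r pt \<Rightarrow> 'r pt \<Rightarrow> ('r path \<Rightarrow>\<^sub>0 'k::field) \<Rightarrow> ('r arrow multiset \<Rightarrow>\<^sub>0 'k)" where
  "comm_part x y a = (\<Sum>p\<in>keys a.
     if fst p = x \<and> path_target p = y then single (mset (snd p)) (lookup a p) else 0)"

lemma comm_part_eq_lin_ext: "comm_part x y =
   PM.lin_ext (\<lambda>p. if fst p = x \<and> path_target p = y then single (mset (snd p)) 1 else 0)"
  by (auto simp: fun_eq_iff comm_part_def PM.lin_ext_def pm_scale_single intro!: sum.cong)

lemma comm_part_zero [simp]: "comm_part x y 0 = 0"
  and comm_part_single: "comm_part x y (single p c) =
     (if fst p = x \<and> path_target p = y then single (mset (snd p)) c else 0)"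
  and comm_part_add: "comm_part x y (a + b) = comm_part x y a + comm_part x y b"
  and comm_part_scale: "comm_part x y (pm_scale c a) = pm_scale c (comm_part x y a)"
  and comm_part_sum: "comm_part x y (sum f S) = (\<Sum>s\<in>S. comm_part x y (f s))"
  and comm_part_diff: "comm_part x y (a - b) = comm_part x y a - comm_part x y b"
  by (simp_all add: comm_part_eq_lin_ext PM.lin_ext_simps pm_scale_single)

lemma comm_part_single_mult:
  "comm_part x y (path_mult (single p c) a) =
     (if fst p = x then single (mset (snd p)) c * comm_part (path_target p) y a else 0)"
proof -
  have *: "comm_part x y (path_mult (single p c) (single q d)) = (if fst p = x
     then single (mset (snd p)) c * comm_part (path_target p) y (single q d) else 0)" for q d
    by (auto simp: path_mult_single comm_part_single mult_single path_target_eq add_ac)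
  show ?thesis
    by (induction a rule: pm_induct) (simp_all add: * path_mult_add_right comm_part_add distrib_left)
qed

lemma comm_part_mult_single:
  "comm_part x y (path_mult a (single p c)) =
     (if path_target p = y then comm_part x (fst p) a * single (mset (snd p)) c else 0)"
proof -
  have *: "comm_part x y (path_mult (single q d) (single p c)) = (if path_target p = y
     then comm_part x (fst p) (single q d) * single (mset (snd p)) c else 0)" for q d
    by (auto simp: path_mult_single comm_part_single mult_single path_target_eq add_ac)
  show ?thesis
    by (induction a rule: pm_induct) (simp_all add: * path_mult_add_left comm_part_add distrib_right)
qed

text \<open>Commutation relations vanish once the order is forgotten, and the remaining relation at
  z becomes the quadric \<open>qrel\<close> if x = y = z and zero otherwise.\<close>

lemma comm_part_relation:
  assumes "a \<in> V_relations"
  shows "qrel dvd comm_part x y a"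
  using assms unfolding V_relations_def
proof (elim UnE CollectE exE conjE)
  fix z assume a: "a = (\<Sum>i\<in>UNIV. path_elem (z, [Beta i, Alpha i]))"
  have "comm_part x y a = (if z = x \<and> z = y then qrel else 0)"
    by (cases "z = x \<and> z = y")
      (auto simp: a comm_part_sum path_elem_def comm_part_single path_target_eq qrel_def
        add_mset_commute intro!: sum.neutral)
  then show ?thesis by auto
qed (auto simp: comm_part_diff path_elem_def comm_part_single path_target_eq add_ac add_mset_commute)

text \<open>Multiplication by a path moves one of the two endpoints, which is why the induction
  needs \<open>x\<close> and \<open>y\<close> arbitrary; general factors are expanded into single
  paths.\<close>

lemma comm_part_ideal:
  assumes "a \<in> V_ideal"
  shows "qrel dvd comm_part x y a"
  using assms
proof (induction arbitrary: x y rule: V_ideal.induct)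
  case (mult_left a b)
  show ?case
    by (induction b rule: pm_induct)
      (simp_all add: path_mult_add_left comm_part_add comm_part_single_mult mult_left)
next
  case (mult_right a b)
  show ?case
    by (induction b rule: pm_induct)
      (simp_all add: path_mult_add_right comm_part_add comm_part_mult_single mult_right)
qed (simp_all add: comm_part_relation comm_part_add comm_part_scale pm_scale_eq_times)

text \<open>Lift the combination to the path algebra. The part with a given source is normal and,
  lying in the ideal, also a multiple of \<open>qrel\<close>, hence zero by
  \<open>nf_not_multiple\<close>.\<close>

lemma Psi_eq_0D:
  fixes p :: "'r::finite arrow multiset \<Rightarrow>\<^sub>0 'k::field"
  assumes nf: "keys p \<subseteq> {m. nf i m}" and 0: "Psi y p = 0"
  shows "p = 0"
proof -
  define a where "a = (\<Sum>m\<in>keys p.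
     single (y - wt m, word m) (lookup p m))"
  have single: "single q c = pm_scale c (path_elem q)" for q :: "'r path" and c :: 'k
    by (rule poly_mapping_eqI) (simp add: path_elem_def lookup_single when_def)
  have "abs_valg a = Psi y p"
    by (simp add: a_def Psi_def abs_valg_sum single abs_valg_scale bas_def vpath_abs)
  then have "V_rel a 0" using 0 by (simp add: zero_valg.abs_eq valg.abs_eq_iff)
  then have "a \<in> V_ideal" by (simp add: V_rel_def)
  then have dvd: "qrel dvd comm_part x y a" for x by (rule comm_part_ideal)
  have lk: "lookup (comm_part x y a) m =
    (if y - wt m = x then lookup p m else 0)" for x m
  proof -
    have "comm_part x y a = (\<Sum>m\<in>keys p.
       if y - wt m = x then single m (lookup p m) else 0)"
      by (simp add: a_def comm_part_sum comm_part_single path_target_eq cong: if_cong)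
    also have "lookup \<dots> m = (\<Sum>n\<in>keys p.
       if n = m then (if y - wt m = x then lookup p m else 0) else 0)"
      unfolding lookup_sum by (intro sum.cong refl) (auto simp: lookup_single when_def)
    also have "\<dots> = (if y - wt m = x then lookup p m else 0)"
      by (auto simp: in_keys_iff)
    finally show ?thesis .
  qed
  show ?thesis
  proof (rule poly_mapping_eqI)
    fix m
    obtain g where g: "comm_part (y - wt m) y a = qrel * g" using dvd by (auto simp: dvd_def)
    have "keys (comm_part (y - wt m) y a) \<subseteq> {m. nf i m}"
      using nf by (auto simp: in_keys_iff lk split: if_splits)
    then have "comm_part (y - wt m) y a = 0" using g by (rule nf_not_multiple)
    then have "lookup (comm_part (y - wt m) y a) m = 0" by simp
    then show "lookup p m = lookup 0 m" unfolding lk by simp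
  qed
qed

lemma Psi_inj:
  assumes "keys p \<subseteq> {m. nf i m}" "keys q \<subseteq> {m. nf i m}" "Psi y p = Psi y q"
  shows "p = q"
proof -
  have "keys (p - q) \<subseteq> {m. nf i m}"
    using keys_diff[of p q] assms(1,2) by blast
  then show ?thesis using Psi_eq_0D[of "p - q" i y] assms(3) by (simp add: Psi_diff)
qed

section \<open>Coordinates of V f_y in the normal basis\<close>

subsection \<open>Coordinates\<close>

definition restr :: "'a set \<Rightarrow> ('a \<Rightarrow>\<^sub>0 'k::zero) \<Rightarrow> ('a \<Rightarrow>\<^sub>0 'k)" where
  "restr S p = Poly_Mapping.mapp (\<lambda>m c. c when m \<in> S) p"

lemma lookup_restr [simp]:
  "lookup (restr S p) m = (if m \<in> S then lookup p m else 0)"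
  by (auto simp: restr_def lookup_mapp when_def in_keys_iff)

lemma keys_restr [simp]: "keys (restr S p) = keys p \<inter> S"
  by (auto simp: in_keys_iff split: if_splits)

lemma restr_add: "restr S (p + q) = restr S p + restr S q"
  for p q :: "'a \<Rightarrow>\<^sub>0 'k::comm_monoid_add"
  by (rule poly_mapping_eqI) (simp add: lookup_add)

lemma restr_scale: "restr S (pm_scale c p) = pm_scale c (restr S p)"
  by (rule poly_mapping_eqI) simp

lemma restr_id: "keys p \<subseteq> S \<Longrightarrow> restr S p = p"
  by (rule poly_mapping_eqI) (auto simp: in_keys_iff)

lemma restr_eq_0: "keys p \<inter> S = {} \<Longrightarrow> restr S p = 0"
  by (rule poly_mapping_eqI) (auto simp: in_keys_iff)

lemma keys_sum_subset:
  "(\<And>s. s \<in> S \<Longrightarrow> keys (f s) \<subseteq> B) \<Longrightarrow> keys (sum f S) \<subseteq> B"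
  for f :: "'b \<Rightarrow> 'a \<Rightarrow>\<^sub>0 'k::field"
  using Poly_Mapping.keys_sum[of f S] by blast

lemma keys_add_subset:
  "keys p \<subseteq> B \<Longrightarrow> keys q \<subseteq> B \<Longrightarrow> keys (p + q) \<subseteq> B"
  for p :: "'a \<Rightarrow>\<^sub>0 'k::field"
  using Poly_Mapping.keys_add[of p q] by blast

lemma Psi_mult_videm: "Psi y p * videm z = (if y = z then Psi y p else 0)"
  by (auto simp: Psi_def sum_distrib_right vscale_mult_left bas_mult_videm cong: if_cong)

lemma videm_mult_Psi: "videm z * Psi y p = Psi y (restr {m. y - wt m = z} p)"
proof -
  have "videm z * Psi y p = (\<Sum>m\<in>keys p. vscale (lookup p m)
      (if z = y - wt m then bas y m else 0))"
    by (simp add: Psi_def sum_distrib_left vscale_mult_right videm_mult_bas)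
  also have "\<dots> = Psi y (restr {m. y - wt m = z} p)"
    unfolding Psi_eq_lin_ext
    by (subst V.lin_ext_superset[of "keys p"]) (auto intro!: sum.cong)
  finally show ?thesis .
qed

lemma co_ex:
  fixes v :: "('k::field, 'r::finite) valg"
  shows "\<exists>p. keys p \<subseteq> {m. nf i m} \<and> Psi y p = v * videm y"
  using valg_span_bas[of v]
proof (induction rule: V.span_induct)
  case base
  show ?case
  proof (rule V.subspaceI)
    show "0 \<in> {v. \<exists>p. keys p \<subseteq> {m. nf i m} \<and> Psi y p = v * videm y}"
      by (auto intro: exI[of _ 0])
  next
    fix u v :: "('k, 'r) valg"
    assume "u \<in> {v. \<exists>p. keys p \<subseteq> {m. nf i m} \<and> Psi y p = v * videm y}"
      "v \<in> {v. \<exists>p. keys p \<subseteq> {m. nf i m} \<and> Psi y p = v * videm y}"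
    then obtain p q where "keys p \<subseteq> {m. nf i m}" "Psi y p = u * videm y"
      "keys q \<subseteq> {m. nf i m}" "Psi y q = v * videm y" by auto
    then show "u + v \<in> {v. \<exists>p. keys p \<subseteq> {m. nf i m} \<and> Psi y p = v * videm y}"
      by (intro CollectI exI[of _ "p + q"]) (simp add: keys_add_subset Psi_add distrib_right)
  next
    fix c and v :: "('k, 'r) valg"
    assume "v \<in> {v. \<exists>p. keys p \<subseteq> {m. nf i m} \<and> Psi y p = v * videm y}"
    then obtain p where "keys p \<subseteq> {m. nf i m}" "Psi y p = v * videm y" by auto
    then show "vscale c v \<in> {v. \<exists>p. keys p \<subseteq> {m. nf i m} \<and> Psi y p = v * videm y}"
      using keys_pm_scale[of c p]
      by (intro CollectI exI[of _ "pm_scale c p"]) (auto simp: Psi_scale vscale_mult_left)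
  qed
next
  case (step v)
  then obtain z m where v: "v = bas z m" by auto
  show ?case
  proof (cases "z = y")
    case True
    then show ?thesis using bas_reduce[of i m y, where 'k = 'k] v by (auto simp: bas_mult_videm)
  next
    case False
    then show ?thesis using v by (auto simp: bas_mult_videm intro: exI[of _ 0])
  qed
qed

text \<open>Defined on all of V by reading only the component \<open>v * videm y\<close>; this keeps
  the linearity rules free of side conditions.\<close>

definition co :: "'r::finite \<Rightarrow> 'r pt \<Rightarrow> ('k::field, 'r) valg \<Rightarrow> ('r arrow multiset \<Rightarrow>\<^sub>0 'k)" where
  "co i y v = (THE p. keys p \<subseteq> {m. nf i m} \<and> Psi y p = v * videm y)"

lemma co_eqI:
  assumes "keys p \<subseteq> {m. nf i m}" "Psi y p = v * videm y"
  shows "co i y v = p"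
  unfolding co_def by (rule the_equality) (use assms Psi_inj in metis)+

lemma co_nf: "keys (co i y v) \<subseteq> {m. nf i m}"
  and Psi_co: "Psi y (co i y v) = v * videm y"
  using co_ex[of i y v] co_eqI[of _ i y v] by auto

lemma co_Psi: "keys p \<subseteq> {m. nf i m} \<Longrightarrow> co i y (Psi y p) = p"
  by (rule co_eqI) (simp_all add: Psi_mult_videm)

lemma co_zero [simp]: "co i y 0 = 0"
  by (rule co_eqI) auto

lemma co_add: "co i y (u + v) = co i y u + co i y v"
  by (rule co_eqI) (simp_all add: keys_add_subset co_nf Psi_add Psi_co distrib_right)

lemma co_scale: "co i y (vscale c v) = pm_scale c (co i y v)"
  by (rule co_eqI[OF subset_trans[OF keys_pm_scale co_nf]]) (simp add: Psi_scale Psi_co vscale_mult_left)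

lemma co_sum: "co i y (sum f S) = (\<Sum>s\<in>S. co i y (f s))"
  by (induction S rule: infinite_finite_induct) (simp_all add: co_add)

lemma videm_idem [simp]: "videm y * videm y = videm y"
  by (simp add: videm_eq_bas bas_mult)

lemma co_mult_videm: "co i y (v * videm y) = co i y v"
  by (rule co_eqI) (simp_all add: co_nf Psi_co mult.assoc)

lemma co_mult_videm_neq: "z \<noteq> y \<Longrightarrow> co i y (v * videm z) = 0"
  by (rule co_eqI) (simp_all add: mult.assoc videm_eq_bas bas_mult)

lemma co_videm_mult: "co i y (videm z * v) = restr {m. y - wt m = z} (co i y v)"
proof (rule co_eqI)
  show "Psi y (restr {m. y - wt m = z} (co i y v)) = videm z * v * videm y"
    unfolding videm_mult_Psi[symmetric] Psi_co mult.assoc ..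
qed (use co_nf[of i y v] in auto)

lemma Psi_single_times:
  "Psi y (single {#c#} 1 * p) = Psi (y - arrow_step c) p * vpath (y - arrow_step c, [c])"
proof -
  have *: "Psi y (single {#c#} 1 * single m d) =
      Psi (y - arrow_step c) (single m d) * vpath (y - arrow_step c, [c])" for m d
    by (simp add: mult_single vpath_eq_bas vscale_mult_left bas_mult)
  show ?thesis
  proof (induction p rule: pm_induct)
    case (2 m d)
    show ?case by (rule *)
  qed (simp_all only: mult_zero_right mult_zero_left distrib_left distrib_right Psi_add Psi_zero)
qed

lemma varrow_mult_videm:
  "vpath (y - arrow_step c, [c]) * videm y = (vpath (y - arrow_step c, [c]) :: ('k::field, 'r::finite) valg)"
  by (simp add: vpath_eq_bas bas_mult)

lemma videm_mult_varrow: "videm y * vpath (y, [c]) = (vpath (y, [c]) :: ('k::field, 'r::finite) valg)"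
  by (simp add: vpath_eq_bas bas_mult)

text \<open>An arrow type other than a_i, b_i keeps monomials normal, so right multiplication by it
  shifts coordinates without any rewriting. This reduces the Koszul complex to combinatorics of
  monomials.\<close>

lemma lookup_co_mult_arrow:
  assumes "c \<noteq> Alpha i" "c \<noteq> Beta i"
  shows "lookup (co i y (v * vpath (y - arrow_step c, [c]))) m =
     (if c \<in># m then lookup (co i (y - arrow_step c) v) (m - {#c#}) else 0)"
proof -
  let ?p = "co i (y - arrow_step c) v"
  have lk: "lookup (single {#c#} 1 * ?p) m =
     (if c \<in># m then lookup ?p (m - {#c#}) else 0)" for m
    by (simp add: lookup_single_times)
  have "co i y (v * vpath (y - arrow_step c, [c])) = single {#c#} 1 * ?p"
  proof (rule co_eqI)
    show "keys (single {#c#} 1 * ?p) \<subseteq> {m. nf i m}"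
    proof
      fix m assume "m \<in> keys (single {#c#} 1 * ?p)"
      then have "c \<in># m" "m - {#c#} \<in> keys ?p"
        by (auto simp: in_keys_iff lk split: if_splits)
      then have "nf i (m - {#c#})" using co_nf by blast
      then show "m \<in> {m. nf i m}" using assms \<open>c \<in># m\<close>
        by (auto simp: nf_def in_diff_count)
    qed
    show "Psi y (single {#c#} 1 * ?p) = v * vpath (y - arrow_step c, [c]) * videm y"
      by (simp add: Psi_single_times Psi_co mult.assoc varrow_mult_videm videm_mult_varrow)
  qed
  then show ?thesis by (simp add: lk)
qed

section \<open>Degree and source conditions read off from coordinates\<close>

subsection \<open>Degrees and truncations\<close>

lemma bas_vdeg: "bas y m \<in> vdeg (int (size m))"
proof -
  have "length (word m) = size m" by (metis mset_word size_mset)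
  then show ?thesis unfolding vdeg_def bas_def
    by (intro V.span_base CollectI exI[of _ "(y - wt m, word m)"]) simp
qed

lemma vdeg_subspace: "V.subspace (vdeg n)"
  by (simp add: vdeg_def)

lemma vdeg_zero [simp]: "0 \<in> vdeg n"
  and vdeg_add: "a \<in> vdeg n \<Longrightarrow> b \<in> vdeg n \<Longrightarrow> a + b \<in> vdeg n"
  and vdeg_scale: "a \<in> vdeg n \<Longrightarrow> vscale c a \<in> vdeg n"
  and vdeg_sum: "(\<And>s. s \<in> S \<Longrightarrow> f s \<in> vdeg n) \<Longrightarrow> sum f S \<in> vdeg n"
  using vdeg_subspace[of n]
  by (auto intro: V.subspace_0 V.subspace_add V.subspace_scale V.subspace_sum)

lemma vdeg_eq_span_bas: "vdeg n = V.span {bas y m | y m. int (size m) = n}"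
proof
  show "vdeg n \<subseteq> V.span {bas y m | y m. int (size m) = n}"
    unfolding vdeg_def
  proof (intro V.span_minimal subsetI)
    fix v assume "v \<in> {vpath p | p. int (length (snd p)) = n}"
    then obtain x w where v: "v = vpath (x, w)" "int (length w) = n" by auto
    show "v \<in> V.span {bas y m | y m. int (size m) = n}"
      unfolding v(1) vpath_eq_bas
      by (intro V.span_base CollectI exI[of _ "x + wt (mset w)"] exI[of _ "mset w"]) (use v in simp)
  qed simp
  show "V.span {bas y m | y m. int (size m) = n} \<subseteq> vdeg n"
    by (intro V.span_minimal vdeg_subspace) (auto simp: bas_vdeg)
qed

text \<open>This holds because the rewriting in \<open>bas_reduce\<close> is homogeneous.\<close>

lemma co_vdeg:
  fixes v :: "('k::field, 'r::finite) valg"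
  assumes "v \<in> vdeg n"
  shows "keys (co i y v) \<subseteq> {m. int (size m) = n}"
  using assms unfolding vdeg_eq_span_bas
proof (induction rule: V.span_induct_alt)
  case (step c v w)
  then obtain z m where v: "v = bas z m" "int (size m) = n" by auto
  have "keys (co i y v) \<subseteq> {m. int (size m) = n}"
  proof (cases "z = y")
    case True
    obtain p where p: "keys p \<subseteq> {n. nf i n \<and> size n = size m \<and> wt n = wt m}"
      "Psi y p = (bas y m :: ('k, 'r) valg)" using bas_reduce by blast
    then have "co i y v = p" using True v by (intro co_eqI) (auto simp: bas_mult_videm)
    then show ?thesis using p(1) v(2) by auto
  next
    case False
    then have "co i y v = 0" using v by (intro co_eqI) (auto simp: bas_mult_videm)
    then show ?thesis by simp
  qed
  then show ?case using step keys_pm_scale[of c "co i y v"]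
    by (simp add: co_add co_scale keys_add_subset)
qed simp

lemma Psi_vdeg: "keys p \<subseteq> {m. int (size m) = n} \<Longrightarrow> Psi y p \<in> vdeg n"
  unfolding Psi_def by (intro vdeg_sum vdeg_scale) (use bas_vdeg in blast)

lemma vdeg_mult:
  assumes "a \<in> vdeg m" "b \<in> vdeg n"
  shows "a * b \<in> vdeg (m + n)"
proof -
  have 1: "bas y k * b \<in> vdeg (int (size k) + n)" for y k
    using assms(2) unfolding vdeg_eq_span_bas[of n]
  proof (induction rule: V.span_induct_alt)
    case (step c v w)
    then obtain z l where v: "v = bas z l" "int (size l) = n" by auto
    have "bas y k * v \<in> vdeg (int (size k) + n)"
      using bas_vdeg[of z "k + l"] v by (auto simp: bas_mult)
    then show ?case using step by (simp add: distrib_left vscale_mult_right vdeg_add vdeg_scale)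
  qed simp
  show ?thesis
    using assms(1) unfolding vdeg_eq_span_bas[of m]
  proof (induction rule: V.span_induct_alt)
    case (step c v w)
    then obtain z l where v: "v = bas z l" "int (size l) = m" by auto
    then have "v * b \<in> vdeg (m + n)" using 1[of z l] by simp
    then show ?case using step by (simp add: distrib_right vscale_mult_left vdeg_add vdeg_scale)
  qed simp
qed

lemma V_sub_subspace: "V.subspace (V_sub X)"
  by (simp add: V_sub_def)

lemma V_sub_zero [simp]: "0 \<in> V_sub X"
  and V_sub_add: "a \<in> V_sub X \<Longrightarrow> b \<in> V_sub X \<Longrightarrow> a + b \<in> V_sub X"
  and V_sub_scale: "a \<in> V_sub X \<Longrightarrow> vscale c a \<in> V_sub X"
  and V_sub_sum: "(\<And>s. s \<in> S \<Longrightarrow> f s \<in> V_sub X) \<Longrightarrow> sum f S \<in> V_sub X"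
  using V_sub_subspace[of X]
  by (auto intro: V.subspace_0 V.subspace_add V.subspace_scale V.subspace_sum)

lemma V_sub_base: "x \<in> X \<Longrightarrow> y \<in> X \<Longrightarrow> videm x * a * videm y \<in> V_sub X"
  unfolding V_sub_def by (intro V.span_base) auto

lemma bas_V_sub: "y \<in> X \<Longrightarrow> y - wt m \<in> X \<Longrightarrow> bas y m \<in> V_sub X"
  using V_sub_base[of "y - wt m" X y "bas y m"] by (simp add: videm_mult_bas bas_mult_videm)

lemma videm_V_sub: "x \<in> X \<Longrightarrow> videm x \<in> V_sub X"
  using bas_V_sub[of x X "{#}"] by (simp add: videm_eq_bas)

lemma varrow_V_sub: "x \<in> X \<Longrightarrow> x + arrow_step c \<in> X \<Longrightarrow> vpath (x, [c]) \<in> V_sub X"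
  using bas_V_sub[of "x + arrow_step c" X "{#c#}"] by (simp add: vpath_eq_bas)

lemma V_sub_mult:
  assumes "a \<in> V_sub X" "b \<in> V_sub X"
  shows "a * b \<in> V_sub X"
proof -
  have 1: "videm x * c * videm y * b \<in> V_sub X" if "x \<in> X" for x y c
    using assms(2) unfolding V_sub_def[of X]
  proof (induction rule: V.span_induct_alt)
    case (step d v w)
    then obtain z l u where v: "v = videm z * l * videm u" "z \<in> X" "u \<in> X" by auto
    then have "videm x * c * videm y * v \<in> V_sub X"
      using V_sub_base[OF that v(3), of "c * videm y * videm z * l"] by (simp add: mult.assoc)
    then show ?case using step unfolding V_sub_def[symmetric]
      by (simp add: distrib_left vscale_mult_right V_sub_add V_sub_scale)
  qed (simp add: V.span_zero)
  show ?thesis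
    using assms(1) unfolding V_sub_def[of X]
  proof (induction rule: V.span_induct_alt)
    case (step d v w)
    then have "v * b \<in> V_sub X" using 1 by auto
    then show ?case using step unfolding V_sub_def[symmetric]
      by (simp add: distrib_right vscale_mult_left V_sub_add V_sub_scale)
  qed (simp add: V.span_zero)
qed

text \<open>Left multiplication by an idempotent selects the monomials with that source, and the
  truncation is spanned by elements f_x a f_y with x in \<open>X\<close>.\<close>

lemma V_sub_source:
  assumes "v \<in> V_sub X"
  shows "keys (co i y v) \<subseteq> {m. y - wt m \<in> X}"
  using assms unfolding V_sub_def
proof (induction rule: V.span_induct_alt)
  case (step c v w)
  then obtain x a z where v: "v = videm x * (a * videm z)" "x \<in> X" by (auto simp: mult.assoc)
  have "keys (co i y v) \<subseteq> {m. y - wt m \<in> X}"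
    unfolding v(1) co_videm_mult using v(2) by auto
  then show ?case using step(2) keys_pm_scale[of c "co i y v"]
    unfolding co_add co_scale by (intro keys_add_subset) blast+
qed simp

lemma Psi_V_sub: "y \<in> X \<Longrightarrow> keys p \<subseteq> {m. y - wt m \<in> X} \<Longrightarrow> Psi y p \<in> V_sub X"
  unfolding Psi_def by (intro V_sub_sum V_sub_scale bas_V_sub) auto

text \<open>The fixed-point form can be checked element by element, which the image form does not
  allow.\<close>

lemma proj_carrier:
  assumes "y \<in> X"
  shows "(\<lambda>a. a * videm y) ` V_sub X = {v \<in> V_sub X. v * videm y = v}"
proof (intro equalityI subsetI)
  fix v :: "('b, 'a) valg" assume "v \<in> {v \<in> V_sub X. v * videm y = v}"
  then show "v \<in> (\<lambda>a. a * videm y) ` V_sub X" by (auto intro!: image_eqI[of _ _ v])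
qed (auto simp: V_sub_mult videm_V_sub assms mult.assoc)

section \<open>A contraction of the Koszul complex on monomials\<close>

section \<open>Exactness of the Koszul complex on monomials\<close>

definition ksgn :: "'r::linorder \<Rightarrow> 'r set \<Rightarrow> 'k::comm_ring_1" where
  "ksgn j T = (-1) ^ card {l \<in> T. l < j}"

text \<open>\<open>G T m\<close> is the coefficient of the monomial \<open>m\<close> at the corner
  \<open>T\<close>. The differential is written from the receiving side: what arrives at
  \<open>T\<close> comes from \<open>insert j T\<close> by multiplication with c_j.\<close>

definition kdiff :: "('r::linorder \<Rightarrow> 'a) \<Rightarrow> 'r set \<Rightarrow> ('r set \<Rightarrow> 'a multiset \<Rightarrow> 'k::comm_ring_1) \<Rightarrow>
    'r set \<Rightarrow> 'a multiset \<Rightarrow> 'k" where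
  "kdiff c J G T m = (\<Sum>j\<in>J - T. if c j \<in># m then ksgn j T * G (insert j T) (m - {#c j#}) else 0)"

text \<open>The invariant that splits the complex: the differential moves c_j from the face to the
  monomial and leaves this set unchanged. It is the vertex set of the simplex whose faces are the
  sets \<open>T\<close>.\<close>

definition ksupp :: "('r::linorder \<Rightarrow> 'a) \<Rightarrow> 'r set \<Rightarrow> 'r set \<Rightarrow> 'a multiset \<Rightarrow> 'r set" where
  "ksupp c J T m = T \<union> {j \<in> J. c j \<in># m}"

text \<open>The contraction moves the smallest index of the support from the face to the monomial.\<close>

definition khom :: "('r::linorder \<Rightarrow> 'a) \<Rightarrow> 'r set \<Rightarrow> ('r set \<Rightarrow> 'a multiset \<Rightarrow> 'k::comm_ring_1) \<Rightarrow>
    'r set \<Rightarrow> 'a multiset \<Rightarrow> 'k" where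
  "khom c J G T m = (let j = Min (ksupp c J T m) in
     if j \<in> T then G (T - {j}) (add_mset (c j) m) else 0)"

lemma ksgn_insert:
  assumes "finite T" "j \<notin> T"
  shows "ksgn l (insert j T) = (if j < l then - ksgn l T else ksgn l T :: 'k::comm_ring_1)"
proof -
  have "{k \<in> insert j T. k < l} = (if j < l then insert j {k \<in> T. k < l} else {k \<in> T. k < l})"
    by auto
  then show ?thesis using assms by (simp add: ksgn_def)
qed

text \<open>The diagonal has its own assumption because in characteristic 2 antisymmetry does not
  make it vanish.\<close>

lemma sum_antisym:
  fixes f :: "'b \<Rightarrow> 'b \<Rightarrow> 'k::comm_ring_1"
  assumes "\<And>j. f j j = 0" "\<And>j l. j \<noteq> l \<Longrightarrow> f j l = - f l j"
  shows "(\<Sum>j\<in>A. \<Sum>l\<in>A. f j l) = 0"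
proof (induction A rule: infinite_finite_induct)
  case (insert a A)
  have "(\<Sum>l\<in>A. f a l) = - (\<Sum>j\<in>A. f j a)"
    unfolding sum_negf[symmetric] by (intro sum.cong refl assms(2)) (use insert(2) in auto)
  then show ?case using insert assms(1) by (simp add: sum.distrib)
qed auto

text \<open>Adding j and l to the face in the two possible orders yields the same coefficient with
  opposite signs.\<close>

lemma kdiff_kdiff:
  assumes J: "finite J" "T \<subseteq> J" and c: "inj_on c J"
  shows "kdiff c J (kdiff c J G) T m = 0"
proof -
  define f where "f = (\<lambda>j l. if j \<noteq> l \<and> c j \<in># m \<and> c l \<in># m
    then ksgn j T * (ksgn l (insert j T) * G (insert l (insert j T)) (m - {#c j#} - {#c l#})) else 0)"
  have T: "finite T" using J finite_subset by blast
  \<comment> \<open>The membership guard makes the summand antisymmetric for all pairs of indices,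
    the form in which \<open>sum_antisym\<close> applies.\<close>
  have "kdiff c J (kdiff c J G) T m = (\<Sum>j\<in>J - T. \<Sum>l\<in>J - T. if j \<in> J - T \<and> l \<in> J - T then f j l else 0)"
    unfolding kdiff_def
  proof (intro sum.cong refl)
    fix j assume j: "j \<in> J - T"
    have "(\<Sum>l\<in>J - insert j T. if c l \<in># m - {#c j#}
         then ksgn l (insert j T) * G (insert l (insert j T)) (m - {#c j#} - {#c l#}) else 0) =
      (\<Sum>l\<in>J - T. if l \<noteq> j \<and> c l \<in># m
         then ksgn l (insert j T) * G (insert l (insert j T)) (m - {#c j#} - {#c l#}) else 0)"
    proof (rule sum.mono_neutral_cong_left)
      fix l assume l: "l \<in> J - insert j T"
      then have "c l \<noteq> c j" using c j by (auto dest: inj_onD)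
      then show "(if c l \<in># m - {#c j#}
         then ksgn l (insert j T) * G (insert l (insert j T)) (m - {#c j#} - {#c l#}) else 0) =
        (if l \<noteq> j \<and> c l \<in># m
         then ksgn l (insert j T) * G (insert l (insert j T)) (m - {#c j#} - {#c l#}) else 0)"
        using l by (auto simp: in_diff_count not_in_iff)
    qed (use J in auto)
    then show "(if c j \<in># m then ksgn j T * (\<Sum>l\<in>J - insert j T. if c l \<in># m - {#c j#}
         then ksgn l (insert j T) * G (insert l (insert j T)) (m - {#c j#} - {#c l#}) else 0) else 0) =
       (\<Sum>l\<in>J - T. if j \<in> J - T \<and> l \<in> J - T then f j l else 0)"
      using j by (auto simp: f_def sum_distrib_left intro!: sum.cong sum.neutral)
  qed
  also have "\<dots> = 0"
  proof (rule sum_antisym)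
    fix j l :: 'a assume jl: "j \<noteq> l"
    have "f j l = - f l j" if "j \<in> J - T" "l \<in> J - T"
      using jl that T
      by (cases j l rule: linorder_cases)
        (auto simp: f_def ksgn_insert insert_commute diff_right_commute algebra_simps)
    then show "(if j \<in> J - T \<and> l \<in> J - T then f j l else 0) =
       - (if l \<in> J - T \<and> j \<in> J - T then f l j else 0)" by auto
  qed (simp add: f_def)
  finally show ?thesis .
qed

text \<open>This is the contraction of a simplex as a cone over its least vertex; a nonempty support
  provides the apex. Since no element of the face lies below it, the surviving term has sign
  1.\<close>

lemma kdiff_khom:
  fixes G :: "'r::linorder set \<Rightarrow> 'a multiset \<Rightarrow> 'k::comm_ring_1"
  assumes J: "finite J" "T \<subseteq> J" and c: "inj_on c J" and ne: "ksupp c J T m \<noteq> {}"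
  shows "kdiff c J (khom c J G) T m + khom c J (kdiff c J G) T m = G T m"
proof -
  define K where "K = ksupp c J T m"
  define i where "i = Min K"
  have T: "finite T" using J finite_subset by blast
  have K: "finite K" "K \<subseteq> J" "K \<noteq> {}" using T J ne by (auto simp: K_def ksupp_def)
  have i: "i \<in> K" "\<And>j. j \<in> K \<Longrightarrow> i \<le> j" using K by (auto simp: i_def)
  have cc: "c l = c j \<longleftrightarrow> l = j" if "l \<in> J" "j \<in> J" for l j
    using c that by (auto dest: inj_onD)
  \<comment> \<open>Moving c_j between monomial and face does not alter the support, so the apex is
    the same in all terms.\<close>
  have K': "ksupp c J (insert j T) (m - {#c j#}) = K" if "j \<in> J - T" "c j \<in># m" for j
  proof -
    have "c l \<in># m - {#c j#} \<longleftrightarrow> c l \<in># m" if "l \<in> J" "l \<noteq> j" for l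
    proof -
      have "c l \<noteq> c j" using that cc[of l j] \<open>j \<in> J - T\<close> by auto
      then show ?thesis by (auto simp: in_diff_count not_in_iff)
    qed
    then show ?thesis using that by (auto simp: ksupp_def K_def)
  qed
  have kh: "khom c J G (insert j T) (m - {#c j#}) =
      (if i \<in> insert j T then G (insert j T - {i}) (add_mset (c i) (m - {#c j#})) else 0)"
    if "j \<in> J - T" "c j \<in># m" for j
    unfolding khom_def K'[OF that] Let_def i_def[symmetric] ..
  have kd: "kdiff c J (khom c J G) T m = (\<Sum>j\<in>J - T. if c j \<in># m then ksgn j T *
      (if i \<in> insert j T then G (insert j T - {i}) (add_mset (c i) (m - {#c j#})) else 0) else 0)"
    unfolding kdiff_def by (intro sum.cong refl) (simp add: kh)
  show ?thesis
  proof (cases "i \<in> T")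
    case True
    have iJ: "i \<in> J" using i K by auto
    have "{l \<in> T - {i}. l < i} = {}"
      using i(2) by (force simp: K_def ksupp_def)
    then have sgn: "ksgn i (T - {i}) = (1 :: 'k)" by (simp only: ksgn_def card.empty power_0)
    have "khom c J (kdiff c J G) T m = kdiff c J G (T - {i}) (add_mset (c i) m)"
      using True unfolding khom_def K_def[symmetric] i_def[symmetric] by simp
    also have "\<dots> = (\<Sum>j\<in>insert i (J - T). if c j \<in># add_mset (c i) m
        then ksgn j (T - {i}) * G (insert j (T - {i})) (add_mset (c i) m - {#c j#}) else 0)"
      unfolding kdiff_def using True iJ by (intro sum.cong) auto
    also have "\<dots> = ksgn i (T - {i}) * G T m + (\<Sum>j\<in>J - T. if c j \<in># add_mset (c i) m
        then ksgn j (T - {i}) * G (insert j (T - {i})) (add_mset (c i) m - {#c j#}) else 0)"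
      using True J by (subst sum.insert) (auto simp: insert_absorb)
    also have "(\<Sum>j\<in>J - T. if c j \<in># add_mset (c i) m
        then ksgn j (T - {i}) * G (insert j (T - {i})) (add_mset (c i) m - {#c j#}) else 0) =
        - kdiff c J (khom c J G) T m"
      unfolding kd sum_negf[symmetric]
    proof (intro sum.cong refl)
      fix j assume j: "j \<in> J - T"
      then have ij: "c j \<noteq> c i" "j \<noteq> i" using True cc iJ by auto
      show "(if c j \<in># add_mset (c i) m
        then ksgn j (T - {i}) * G (insert j (T - {i})) (add_mset (c i) m - {#c j#}) else 0) =
        - (if c j \<in># m then ksgn j T *
      (if i \<in> insert j T then G (insert j T - {i}) (add_mset (c i) (m - {#c j#})) else 0) else 0)"
      proof (cases "c j \<in># m")
        case cj: True
        then have "j \<in> K" using j by (auto simp: K_def ksupp_def)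
        then have "i < j" using i(2) ij(2) by (simp add: order.strict_iff_order)
        \<comment> \<open>Removing the apex, which lies below j, from the face flips the sign of j;
          hence these terms cancel against those of the other composite.\<close>
        then have "ksgn j T = (- ksgn j (T - {i}) :: 'k)"
          using ksgn_insert[of "T - {i}" i j] T True by (simp add: insert_absorb)
        moreover have "insert j T - {i} = insert j (T - {i})" using ij by auto
        moreover have "add_mset (c i) m - {#c j#} = add_mset (c i) (m - {#c j#})"
          using cj ij by (simp add: add_mset_diff_bothsides diff_single_eq_union)
        ultimately show ?thesis using cj True by simp
      qed (use ij in simp)
    qed
    finally show ?thesis by (simp add: sgn)
  next
    case False
    then have ci: "i \<in> J" "c i \<in># m" using i(1) by (auto simp: K_def ksupp_def)
    have "khom c J (kdiff c J G) T m = 0"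
      using False unfolding khom_def K_def[symmetric] i_def[symmetric] by simp
    \<comment> \<open>The apex is outside \<open>T\<close>, so it belongs to the enlarged face only
      when j = i, and a single term survives.\<close>
    moreover have "kdiff c J (khom c J G) T m = (\<Sum>j\<in>J - T. if j = i then G T m else 0)"
      unfolding kd
    proof (intro sum.cong refl)
      fix j assume j: "j \<in> J - T"
      have "{l \<in> T. l < i} = {}" using i(2) by (force simp: K_def ksupp_def)
      then have "ksgn i T = (1 :: 'k)" by (simp only: ksgn_def card.empty power_0)
      then show "(if c j \<in># m then ksgn j T *
      (if i \<in> insert j T then G (insert j T - {i}) (add_mset (c i) (m - {#c j#})) else 0) else 0) =
         (if j = i then G T m else 0)"
        using False ci by auto
    qed
    then have "kdiff c J (khom c J G) T m = G T m" using False ci J by simp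
    ultimately show ?thesis by simp
  qed
qed

section \<open>Graded modules described by a labelled basis\<close>

section \<open>Graded modules given by a basis\<close>

text \<open>The target is a bare record: its vector space axioms are inherited from finitely
  supported functions through the bijection.\<close>

locale basis_map =
  fixes \<psi> :: "('b \<Rightarrow>\<^sub>0 'k::field) \<Rightarrow> 'm" and B :: "'b set" and M :: "('k, 'a, 'm) gmodule"
  assumes bij: "bij_betw \<psi> {p. keys p \<subseteq> B} (carrier M)"
    and map_add: "keys p \<subseteq> B \<Longrightarrow> keys q \<subseteq> B \<Longrightarrow> \<psi> (p + q) = \<psi> p \<oplus>\<^bsub>M\<^esub> \<psi> q"
    and map_scale: "keys p \<subseteq> B \<Longrightarrow> \<psi> (pm_scale c p) = c \<odot>\<^bsub>M\<^esub> \<psi> p"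
    and map_zero: "\<psi> 0 = \<zero>\<^bsub>M\<^esub>"
begin

lemma carrier_eq: "carrier M = \<psi> ` {p. keys p \<subseteq> B}"
  using bij by (simp add: bij_betw_def)

lemma carrierE:
  assumes "m \<in> carrier M"
  obtains p where "keys p \<subseteq> B" "m = \<psi> p"
  using assms unfolding carrier_eq by auto

lemma map_closed: "keys p \<subseteq> B \<Longrightarrow> \<psi> p \<in> carrier M"
  unfolding carrier_eq by auto

lemma map_inject:
  "keys p \<subseteq> B \<Longrightarrow> keys q \<subseteq> B \<Longrightarrow> \<psi> p = \<psi> q \<longleftrightarrow> p = q"
  using bij by (auto simp: bij_betw_def inj_on_def)

lemma scale_keys: "keys p \<subseteq> C \<Longrightarrow> keys (pm_scale c p) \<subseteq> C"
  for p :: "'b \<Rightarrow>\<^sub>0 'k"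
  by (rule subset_trans[OF keys_pm_scale])

lemma vectorspace: "vectorspace class_ring M"
proof -
  have "Module.module class_ring M"
  proof (rule module_criteria)
    show "\<zero>\<^bsub>M\<^esub> \<in> carrier M" using map_closed[of 0] by (simp add: map_zero)
    show "\<forall>v\<in>carrier M. \<exists>w\<in>carrier M. v \<oplus>\<^bsub>M\<^esub> w = \<zero>\<^bsub>M\<^esub>"
    proof
      fix v assume "v \<in> carrier M"
      then obtain p where p: "keys p \<subseteq> B" "v = \<psi> p" by (rule carrierE)
      then have "v \<oplus>\<^bsub>M\<^esub> \<psi> (- p) = \<zero>\<^bsub>M\<^esub>"
        using map_add[of p "- p"] by (simp add: map_zero keys_minus)
      then show "\<exists>w\<in>carrier M. v \<oplus>\<^bsub>M\<^esub> w = \<zero>\<^bsub>M\<^esub>"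
        using map_closed[of "- p"] p by (auto simp: keys_minus)
    qed
    show "\<forall>v w. v \<in> carrier M \<and> w \<in> carrier M \<longrightarrow> v \<oplus>\<^bsub>M\<^esub> w \<in> carrier M"
      by (auto elim!: carrierE simp flip: map_add simp: map_closed keys_add_subset)
    show "\<forall>c v. c \<in> carrier class_ring \<and> v \<in> carrier M \<longrightarrow> c \<odot>\<^bsub>M\<^esub> v \<in> carrier M"
      by (auto elim!: carrierE simp flip: map_scale simp: map_closed scale_keys)
    show "\<forall>v w. v \<in> carrier M \<and> w \<in> carrier M \<longrightarrow> v \<oplus>\<^bsub>M\<^esub> w = w \<oplus>\<^bsub>M\<^esub> v"
      by (auto elim!: carrierE simp flip: map_add simp: add.commute)
    show "\<forall>u v w. u \<in> carrier M \<and> v \<in> carrier M \<and> w \<in> carrier M \<longrightarrow>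
        (u \<oplus>\<^bsub>M\<^esub> v) \<oplus>\<^bsub>M\<^esub> w = u \<oplus>\<^bsub>M\<^esub> (v \<oplus>\<^bsub>M\<^esub> w)"
      by (auto elim!: carrierE simp flip: map_add simp: add.assoc keys_add_subset)
    show "\<forall>v\<in>carrier M. v \<oplus>\<^bsub>M\<^esub> \<zero>\<^bsub>M\<^esub> = v"
      by (auto elim!: carrierE simp flip: map_add map_zero)
    show "\<forall>a b v. a \<in> carrier class_ring \<and> b \<in> carrier class_ring \<and> v \<in> carrier M \<longrightarrow>
        (a \<otimes>\<^bsub>class_ring\<^esub> b) \<odot>\<^bsub>M\<^esub> v = a \<odot>\<^bsub>M\<^esub> (b \<odot>\<^bsub>M\<^esub> v)"
      by (auto elim!: carrierE simp flip: map_scale simp: scale_keys)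
    show "\<forall>v\<in>carrier M. \<one>\<^bsub>class_ring\<^esub> \<odot>\<^bsub>M\<^esub> v = v"
      by (auto elim!: carrierE simp flip: map_scale)
    show "\<forall>a b v. a \<in> carrier class_ring \<and> b \<in> carrier class_ring \<and> v \<in> carrier M \<longrightarrow>
        (a \<oplus>\<^bsub>class_ring\<^esub> b) \<odot>\<^bsub>M\<^esub> v = a \<odot>\<^bsub>M\<^esub> v \<oplus>\<^bsub>M\<^esub> b \<odot>\<^bsub>M\<^esub> v"
      by (auto elim!: carrierE simp flip: map_scale map_add
          simp: PM.scale_left_distrib scale_keys)
    show "\<forall>a v w. a \<in> carrier class_ring \<and> v \<in> carrier M \<and> w \<in> carrier M \<longrightarrow>
        a \<odot>\<^bsub>M\<^esub> (v \<oplus>\<^bsub>M\<^esub> w) = a \<odot>\<^bsub>M\<^esub> v \<oplus>\<^bsub>M\<^esub> a \<odot>\<^bsub>M\<^esub> w"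
      by (auto elim!: carrierE simp flip: map_scale map_add
          simp: PM.scale_right_distrib scale_keys keys_add_subset)
  qed (rule class_cring.is_cring)
  then show ?thesis by (intro vectorspace.intro class_field)
qed

sublocale vectorspace class_ring M by (rule vectorspace)

lemma map_finsum:
  assumes "finite S" "\<And>s. s \<in> S \<Longrightarrow> keys (f s) \<subseteq> B"
  shows "(\<Oplus>\<^bsub>M\<^esub>s\<in>S. \<psi> (f s)) = \<psi> (sum f S)"
  using assms
proof (induction S)
  case (insert s S)
  then have "(\<Oplus>\<^bsub>M\<^esub>s\<in>insert s S. \<psi> (f s)) = \<psi> (f s) \<oplus>\<^bsub>M\<^esub> (\<Oplus>\<^bsub>M\<^esub>s\<in>S. \<psi> (f s))"
    by (intro finsum_insert) (auto intro: map_closed)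
  then show ?case using insert by (simp add: map_add keys_sum_subset)
qed (simp add: map_zero)

lemma map_subspace:
  assumes "C \<subseteq> B"
  shows "VectorSpace.subspace class_ring (\<psi> ` {p. keys p \<subseteq> C}) M"
proof -
  have "submodule class_ring (\<psi> ` {p. keys p \<subseteq> C}) M"
  proof (rule submodule.intro)
    show "Module.module class_ring M" by unfold_locales
    show "\<psi> ` {p. keys p \<subseteq> C} \<subseteq> carrier M"
      using assms by (auto intro!: map_closed)
    show "\<zero>\<^bsub>M\<^esub> \<in> \<psi> ` {p. keys p \<subseteq> C}"
      by (auto intro!: image_eqI[of _ _ 0] simp: map_zero)
  next
    fix v w assume "v \<in> \<psi> ` {p. keys p \<subseteq> C}" "w \<in> \<psi> ` {p. keys p \<subseteq> C}"
    then obtain p q where "keys p \<subseteq> C" "keys q \<subseteq> C" "v = \<psi> p" "w = \<psi> q"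
      by auto
    then show "v \<oplus>\<^bsub>M\<^esub> w \<in> \<psi> ` {p. keys p \<subseteq> C}"
      using map_add[of p q] assms by (intro image_eqI[of _ _ "p + q"]) (simp_all add: keys_add_subset)
  next
    fix c v assume "v \<in> \<psi> ` {p. keys p \<subseteq> C}"
    then obtain p where "keys p \<subseteq> C" "v = \<psi> p"
      by auto
    then show "c \<odot>\<^bsub>M\<^esub> v \<in> \<psi> ` {p. keys p \<subseteq> C}"
      using map_scale[of p c] assms
      by (intro image_eqI[of _ _ "pm_scale c p"]) (simp_all add: scale_keys)
  qed
  then show ?thesis by (simp add: VectorSpace.subspace_def vectorspace)
qed

text \<open>Labels cut the coordinates into disjoint blocks. A component is the restriction of the
  coordinates to one label, and any competing decomposition must have these same blocks.\<close>

lemma internal_direct_sum: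
  assumes lab: "lab ` B \<subseteq> I"
    and S: "\<And>i. i \<in> I \<Longrightarrow> S i = \<psi> ` {p. keys p \<subseteq> {b \<in> B. lab b = i}}"
  shows "internal_direct_sum M I S"
  unfolding internal_direct_sum_def
proof (intro conjI ballI)
  show "VectorSpace.subspace class_ring (S i) M" if "i \<in> I" for i
    unfolding S[OF that] by (rule map_subspace) auto
  fix m assume "m \<in> carrier M"
  then obtain p where p: "keys p \<subseteq> B" "m = \<psi> p" by (rule carrierE)
  define c where "c = (\<lambda>i. \<psi> (restr {b. lab b = i} p))"
  have c0: "c i = \<zero>\<^bsub>M\<^esub> \<longleftrightarrow> i \<notin> lab ` keys p" for i
  proof -
    have "c i = \<zero>\<^bsub>M\<^esub> \<longleftrightarrow> restr {b. lab b = i} p = 0"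
      unfolding c_def map_zero[symmetric] by (rule map_inject) (use p in auto)
    also have "\<dots> \<longleftrightarrow> keys (restr {b. lab b = i} p) = {}"
      by (simp only: keys_eq_empty)
    also have "\<dots> \<longleftrightarrow> i \<notin> lab ` keys p" unfolding keys_restr by auto
    finally show ?thesis .
  qed
  have supp: "{i. c i \<noteq> \<zero>\<^bsub>M\<^esub>} = lab ` keys p" using c0 by auto
  show "\<exists>!c. (\<forall>i\<in>I. c i \<in> S i) \<and> (\<forall>i. i \<notin> I \<longrightarrow> c i = \<zero>\<^bsub>M\<^esub>) \<and>
        finite {i. c i \<noteq> \<zero>\<^bsub>M\<^esub>} \<and> m = (\<Oplus>\<^bsub>M\<^esub>i\<in>{i. c i \<noteq> \<zero>\<^bsub>M\<^esub>}. c i)"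
  proof (rule ex1I[of _ c], intro conjI ballI allI impI)
    show "c i \<in> S i" if "i \<in> I" for i
      unfolding S[OF that] c_def using p(1) by (intro imageI) auto
    show "c i = \<zero>\<^bsub>M\<^esub>" if "i \<notin> I" for i
      using that lab p(1) c0 by blast
    show "finite {i. c i \<noteq> \<zero>\<^bsub>M\<^esub>}" by (simp add: supp)
    have "(\<Oplus>\<^bsub>M\<^esub>i\<in>{i. c i \<noteq> \<zero>\<^bsub>M\<^esub>}. c i) = \<psi> (\<Sum>i\<in>lab ` keys p. restr {b. lab b = i} p)"
      unfolding supp unfolding c_def by (rule map_finsum) (use p in auto)
    also have "(\<Sum>i\<in>lab ` keys p. restr {b. lab b = i} p) = p"
    proof (rule poly_mapping_eqI)
      fix b
      have "(\<Sum>i\<in>lab ` keys p. if lab b = i then lookup p b else 0) =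
          lookup p b"
        by (auto simp: sum.delta' in_keys_iff)
      then show "lookup (\<Sum>i\<in>lab ` keys p. restr {b. lab b = i} p) b =
          lookup p b"
        by (simp add: lookup_sum)
    qed
    finally show "m = (\<Oplus>\<^bsub>M\<^esub>i\<in>{i. c i \<noteq> \<zero>\<^bsub>M\<^esub>}. c i)" using p by simp
  next
    fix d assume d: "(\<forall>i\<in>I. d i \<in> S i) \<and> (\<forall>i. i \<notin> I \<longrightarrow> d i = \<zero>\<^bsub>M\<^esub>) \<and>
        finite {i. d i \<noteq> \<zero>\<^bsub>M\<^esub>} \<and> m = (\<Oplus>\<^bsub>M\<^esub>i\<in>{i. d i \<noteq> \<zero>\<^bsub>M\<^esub>}. d i)"
    have "\<forall>i\<in>I. \<exists>q. keys q \<subseteq> {b \<in> B. lab b = i} \<and> d i = \<psi> q"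
      using d S by blast
    from bchoice[OF this] obtain q' where q': "\<forall>i\<in>I. keys (q' i) \<subseteq> {b \<in> B. lab b = i} \<and> d i = \<psi> (q' i)"
      by blast
    define q where "q = (\<lambda>i. if i \<in> I then q' i else 0)"
    have q: "keys (q i) \<subseteq> {b \<in> B. lab b = i}" "d i = \<psi> (q i)" for i
      using q' d by (auto simp: q_def map_zero)
    have qB: "keys (q i) \<subseteq> B" for i using q(1) by blast
    have "\<psi> p = (\<Oplus>\<^bsub>M\<^esub>i\<in>{i. d i \<noteq> \<zero>\<^bsub>M\<^esub>}. \<psi> (q i))"
      using d p(2) unfolding q(2)[symmetric] by simp
    also have "\<dots> = \<psi> (\<Sum>i\<in>{i. d i \<noteq> \<zero>\<^bsub>M\<^esub>}. q i)"
      using d qB by (intro map_finsum) auto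
    finally have pq: "p = (\<Sum>i\<in>{i. d i \<noteq> \<zero>\<^bsub>M\<^esub>}. q i)"
      using p(1) qB by (subst (asm) map_inject) (simp_all add: keys_sum_subset)
    have q0: "q i = 0" if "d i = \<zero>\<^bsub>M\<^esub>" for i
      using that map_inject[of "q i" 0] qB[of i] by (simp add: q(2) map_zero)
    have "restr {b. lab b = i} p = q i" for i
    proof (rule poly_mapping_eqI)
      fix b
      have *: "lookup (q j) b = 0" if "lab b \<noteq> j" for j
        using q(1)[of j] that by (auto simp: in_keys_iff)
      have "lookup p b = (\<Sum>j\<in>{i. d i \<noteq> \<zero>\<^bsub>M\<^esub>}. if j = lab b then lookup (q j) b else 0)"
        unfolding pq lookup_sum by (intro sum.cong refl) (auto simp: *)
      also have "\<dots> = lookup (q (lab b)) b"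
        using d q0 by (auto simp: sum.delta)
      finally show "lookup (restr {b. lab b = i} p) b = lookup (q i) b"
        using * by auto
    qed
    then show "d = c" by (auto simp: c_def q(2))
  qed
qed

end

text \<open>Nothing is presupposed about \<open>N\<close>, whose module axioms are to be derived
  from those of \<open>M\<close>; hence the separate clause for zero and the equality of the
  homogeneous components.\<close>

definition graded_iso :: "'a set \<Rightarrow> ('m \<Rightarrow> 'n) \<Rightarrow> ('k::field, 'a, 'm) gmodule \<Rightarrow> ('k, 'a, 'n) gmodule \<Rightarrow> bool" where
  "graded_iso A f M N \<longleftrightarrow> bij_betw f (carrier M) (carrier N) \<and>
     (\<forall>m\<in>carrier M. \<forall>n\<in>carrier M. f (m \<oplus>\<^bsub>M\<^esub> n) = f m \<oplus>\<^bsub>N\<^esub> f n) \<and>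
     (\<forall>c. \<forall>m\<in>carrier M. f (c \<odot>\<^bsub>M\<^esub> m) = c \<odot>\<^bsub>N\<^esub> f m) \<and>
     f \<zero>\<^bsub>M\<^esub> = \<zero>\<^bsub>N\<^esub> \<and>
     (\<forall>a\<in>A. \<forall>m\<in>carrier M. f (act M a m) = act N a (f m)) \<and>
     (\<forall>n. deg N n = f ` deg M n)"

definition unital_subalgebra :: "('k::field, 'r::finite) valg set \<Rightarrow> 'r pt set \<Rightarrow> bool" where
  "unital_subalgebra A X \<longleftrightarrow> (\<forall>z\<in>X. videm z \<in> A) \<and> (\<forall>a\<in>A. \<forall>b\<in>A. a + b \<in> A \<and> a * b \<in> A) \<and>
     (\<forall>a\<in>A. \<forall>c. vscale c a \<in> A)"

lemma unital_subalgebra_V_sub: "unital_subalgebra (V_sub X) X"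
  by (simp add: unital_subalgebra_def videm_V_sub V_sub_add V_sub_mult V_sub_scale)

definition act_axioms :: "('k::field, 'r::finite) valg set \<Rightarrow> ('k, 'r, 'm) vmodule \<Rightarrow> bool" where
  "act_axioms A M \<longleftrightarrow>
     (\<forall>a\<in>A. \<forall>m\<in>carrier M. act M a m \<in> carrier M) \<and>
     (\<forall>a\<in>A. \<forall>b\<in>A. \<forall>m\<in>carrier M. act M (a + b) m = act M a m \<oplus>\<^bsub>M\<^esub> act M b m) \<and>
     (\<forall>a\<in>A. \<forall>m\<in>carrier M. \<forall>n\<in>carrier M. act M a (m \<oplus>\<^bsub>M\<^esub> n) = act M a m \<oplus>\<^bsub>M\<^esub> act M a n) \<and>
     (\<forall>c. \<forall>a\<in>A. \<forall>m\<in>carrier M. act M (vscale c a) m = c \<odot>\<^bsub>M\<^esub> act M a m) \<and>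
     (\<forall>c. \<forall>a\<in>A. \<forall>m\<in>carrier M. act M a (c \<odot>\<^bsub>M\<^esub> m) = c \<odot>\<^bsub>M\<^esub> act M a m) \<and>
     (\<forall>a\<in>A. \<forall>b\<in>A. \<forall>m\<in>carrier M. act M (a * b) m = act M a (act M b m)) \<and>
     (\<forall>i j. \<forall>a\<in>A. \<forall>m\<in>deg M j. a \<in> vdeg i \<longrightarrow> act M a m \<in> deg M (i + j))"

text \<open>With a vertex and a degree attached to each basis vector, both direct sum decompositions
  follow from the labels and graded dimensions become counts of basis vectors.\<close>

locale graded_basis = basis_map \<psi> B M
  for \<psi> :: "('b \<Rightarrow>\<^sub>0 'k::field) \<Rightarrow> 'm" and B :: "'b set" and M :: "('k, 'r::finite, 'm) vmodule" +
  fixes A :: "('k, 'r) valg set" and X :: "'r pt set" and src :: "'b \<Rightarrow> 'r pt" and sz :: "'b \<Rightarrow> int"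
  assumes acts: "act_axioms A M"
    and src: "src ` B \<subseteq> X"
    and idem: "z \<in> X \<Longrightarrow> keys p \<subseteq> B \<Longrightarrow> act M (videm z) (\<psi> p) = \<psi> (restr {b. src b = z} p)"
    and deg: "deg M n = \<psi> ` {p. keys p \<subseteq> {b \<in> B. sz b = n}}"
begin

lemma idem_image:
  assumes "z \<in> X" "C \<subseteq> B"
  shows "act M (videm z) ` \<psi> ` {p. keys p \<subseteq> C} = \<psi> ` {p. keys p \<subseteq> {b \<in> C. src b = z}}"
proof (intro equalityI subsetI)
  fix m assume "m \<in> act M (videm z) ` \<psi> ` {p. keys p \<subseteq> C}"
  then obtain p where p: "keys p \<subseteq> C" "m = act M (videm z) (\<psi> p)" by auto
  have "m = \<psi> (restr {b. src b = z} p)" unfolding p(2) by (rule idem) (use assms p in auto)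
  then show "m \<in> \<psi> ` {p. keys p \<subseteq> {b \<in> C. src b = z}}"
    by (rule image_eqI) (use p(1) in auto)
next
  fix m assume "m \<in> \<psi> ` {p. keys p \<subseteq> {b \<in> C. src b = z}}"
  then obtain p where p: "keys p \<subseteq> {b \<in> C. src b = z}" "m = \<psi> p" by auto
  have "act M (videm z) (\<psi> p) = \<psi> (restr {b. src b = z} p)" by (rule idem) (use assms p in auto)
  also have "restr {b. src b = z} p = p" by (rule restr_id) (use p in auto)
  finally show "m \<in> act M (videm z) ` \<psi> ` {p. keys p \<subseteq> C}"
    using p by (intro image_eqI[of _ _ "\<psi> p"]) auto
qed

lemma graded_module: "graded_module A X M"
proof -
  have "internal_direct_sum M X (\<lambda>x. act M (videm x) ` carrier M)"
    by (rule internal_direct_sum[OF src]) (use idem_image[of _ B] in \<open>simp add: carrier_eq\<close>)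
  moreover have "internal_direct_sum M UNIV (deg M)"
    by (rule internal_direct_sum[of sz]) (auto simp: deg)
  ultimately show ?thesis
    using acts by (simp add: graded_module_def graded_module_axioms_def act_axioms_def vectorspace)
qed

lemma transport_iso:
  assumes iso: "graded_iso A f M N" and A: "unital_subalgebra A X"
  shows "graded_basis (f \<circ> \<psi>) B N A X src sz"
proof -
  have f: "bij_betw f (carrier M) (carrier N)" and fzero: "f \<zero>\<^bsub>M\<^esub> = \<zero>\<^bsub>N\<^esub>"
    and fadd: "m \<in> carrier M \<Longrightarrow> n \<in> carrier M \<Longrightarrow> f (m \<oplus>\<^bsub>M\<^esub> n) = f m \<oplus>\<^bsub>N\<^esub> f n"
    and fscale: "m \<in> carrier M \<Longrightarrow> f (c \<odot>\<^bsub>M\<^esub> m) = c \<odot>\<^bsub>N\<^esub> f m"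
    and fact: "a \<in> A \<Longrightarrow> m \<in> carrier M \<Longrightarrow> f (act M a m) = act N a (f m)"
    and fdeg: "deg N k = f ` deg M k" for a c m n k
    using iso by (auto simp: graded_iso_def)
  have N: "carrier N = f ` carrier M" using f by (simp add: bij_betw_def)
  have degM: "deg M n \<subseteq> carrier M" for n unfolding deg carrier_eq by auto
  interpret N: basis_map "f \<circ> \<psi>" B N
  proof
    show "bij_betw (f \<circ> \<psi>) {p. keys p \<subseteq> B} (carrier N)"
      using bij f by (rule bij_betw_trans)
  qed (simp_all add: map_add map_scale map_zero fadd fscale fzero map_closed)
  have cl: "act M a m \<in> carrier M" if "a \<in> A" "m \<in> carrier M" for a m
    using acts that by (simp add: act_axioms_def)
  note flips = fact[symmetric] fadd[symmetric] fscale[symmetric]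
  have 7: "\<forall>i j. \<forall>a\<in>A. \<forall>m\<in>deg N j. a \<in> vdeg i \<longrightarrow> act N a m \<in> deg N (i + j)"
    unfolding fdeg
  proof (intro allI ballI impI)
    fix i j a m assume *: "a \<in> A" "m \<in> f ` deg M j" "a \<in> vdeg i"
    then obtain n where n: "n \<in> deg M j" "m = f n" by auto
    then have "act N a m = f (act M a n)" using degM[of j] fact[OF *(1), of n] by auto
    moreover have "act M a n \<in> deg M (i + j)" using acts * n by (simp add: act_axioms_def)
    ultimately show "act N a m \<in> f ` deg M (i + j)" by simp
  qed
  show ?thesis
  proof
    show "act_axioms A N"
      unfolding act_axioms_def N using cl acts A 7
      by (auto simp: flips act_axioms_def unital_subalgebra_def)
    show "act N (videm z) ((f \<circ> \<psi>) p) = (f \<circ> \<psi>) (restr {b. src b = z} p)"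
      if "z \<in> X" "keys p \<subseteq> B" for z p
      using that A by (simp add: idem[symmetric] fact map_closed unital_subalgebra_def)
  qed (use src in \<open>auto simp: fdeg deg image_image\<close>)
qed

text \<open>\<open>gcomp\<close> changes only the carrier of the record, so this supplies bases of
  the components whose dimensions enter \<open>gdim\<close>.\<close>

lemma basis_map_subset:
  assumes "C \<subseteq> B"
  shows "basis_map \<psi> C (M\<lparr>carrier := \<psi> ` {p. keys p \<subseteq> C}\<rparr>)"
proof
  have "inj_on \<psi> {p. keys p \<subseteq> C}"
    using bij assms unfolding bij_betw_def by (elim conjE inj_on_subset) auto
  then show "bij_betw \<psi> {p. keys p \<subseteq> C} (carrier (M\<lparr>carrier := \<psi> ` {p. keys p \<subseteq> C}\<rparr>))"
    by (simp add: bij_betw_def)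
qed (use assms in \<open>auto simp: map_add map_scale map_zero\<close>)

lemma gcomp_eq:
  assumes "y \<in> X"
  shows "gcomp M y n = M\<lparr>carrier := \<psi> ` {p. keys p \<subseteq> {b \<in> B. sz b = n \<and> src b = y}}\<rparr>"
proof -
  have "act M (videm y) ` deg M n = \<psi> ` {p. keys p \<subseteq> {b \<in> {b \<in> B. sz b = n}. src b = y}}"
    unfolding deg by (rule idem_image[OF assms]) auto
  also have "{b \<in> {b \<in> B. sz b = n}. src b = y} = {b \<in> B. sz b = n \<and> src b = y}" by auto
  finally show ?thesis by (simp add: gcomp_def)
qed

end

lemma (in basis_map) dim_empty:
  assumes "B = {}"
  shows "fin_dim" "dim = 0" "carrier M = {\<zero>\<^bsub>M\<^esub>}"
proof -
  show c: "carrier M = {\<zero>\<^bsub>M\<^esub>}" unfolding carrier_eq assms by (auto simp: map_zero)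
  have g: "span {} = carrier M" by (simp add: c span_def lincomb_def)
  then show "fin_dim" unfolding fin_dim_def by blast
  have "basis {}" unfolding basis_def using g by (simp add: lin_dep_def)
  then show "dim = 0" using dim_basis[of "{}"] by simp
qed

lemma (in basis_map) dim_singleton:
  assumes "B = {b}"
  shows "fin_dim" "dim = 1"
proof -
  define v where "v = \<psi> (single b 1)"
  have keys: "keys (single b (1 :: 'k)) \<subseteq> B" using assms by simp
  have v: "v \<in> carrier M" unfolding v_def by (rule map_closed[OF keys])
  have lc: "lincomb a {v} = \<psi> (single b (a v))" for a
  proof -
    have "pm_scale (a v) (single b 1) = single b (a v)"
      by (rule poly_mapping_eqI) (simp add: lookup_single when_def)
    then show ?thesis
      using v map_scale[OF keys, of "a v"] by (simp add: lincomb_def v_def)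
  qed
  have "basis {v}"
  proof (subst basis_criterion)
    show "\<forall>w. w \<in> carrier M \<longrightarrow> (\<exists>!a. a \<in> {v} \<rightarrow>\<^sub>E carrier class_ring \<and> lincomb a {v} = w)"
    proof (intro allI impI)
      fix w assume "w \<in> carrier M"
      then obtain p where p: "keys p \<subseteq> B" "w = \<psi> p" by (rule carrierE)
      have ps: "p = single b (lookup p b)"
        by (rule poly_mapping_eqI) (use p(1) assms in \<open>auto simp: lookup_single when_def in_keys_iff\<close>)
      show "\<exists>!a. a \<in> {v} \<rightarrow>\<^sub>E carrier class_ring \<and> lincomb a {v} = w"
      proof (rule ex1I[of _ "\<lambda>u\<in>{v}. lookup p b"])
        show "(\<lambda>u\<in>{v}. lookup p b) \<in> {v} \<rightarrow>\<^sub>E carrier class_ring \<and>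
            lincomb (\<lambda>u\<in>{v}. lookup p b) {v} = w"
          using ps p(2) by (simp add: lc)
      next
        fix a assume a: "a \<in> {v} \<rightarrow>\<^sub>E carrier class_ring \<and> lincomb a {v} = w"
        then have "\<psi> (single b (a v)) = \<psi> p" using p(2) by (simp add: lc)
        then have "single b (a v) = p"
          using map_inject[of "single b (a v)" p] p(1) assms by simp
        then have "a v = lookup p b" by auto
        then show "a = (\<lambda>u\<in>{v}. lookup p b)"
          using a by (auto simp: PiE_def extensional_def fun_eq_iff)
      qed
    qed
  qed (use v in auto)
  then show "fin_dim" "dim = 1" using dim_basis[of "{v}"] v
    by (auto simp: fin_dim_def basis_def)
qed

lemma (in graded_basis) gdim_none:
  assumes "y \<in> X" "\<And>b. b \<in> B \<Longrightarrow> src b \<noteq> y"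
  shows "has_gdim M y" "gdim M y = 0"
proof -
  have *: "{b \<in> B. sz b = n \<and> src b = y} = {}" for n using assms(2) by blast
  have bm: "basis_map \<psi> {} (gcomp M y n)" for n
    unfolding gcomp_eq[OF assms(1)] * by (rule basis_map_subset) simp
  show "has_gdim M y" unfolding has_gdim_def
    using basis_map.dim_empty(1)[OF bm] basis_map.dim_empty(3)[OF bm] by (simp add: gcomp_def)
  show "gdim M y = 0" unfolding gdim_def
    using basis_map.dim_empty(2)[OF bm] by (simp add: zero_fls_def)
qed

lemma (in graded_basis) gdim_one:
  assumes "y \<in> X" "{b \<in> B. src b = y} = {b}" "sz b = int n"
  shows "has_gdim M y" "gdim M y = fls_X ^ n"
proof -
  have *: "{b \<in> B. sz b = k \<and> src b = y} = (if k = int n then {b} else {})" for k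
    using assms(2,3) by auto
  have b: "b \<in> B" using assms(2) by auto
  have bm: "basis_map \<psi> (if k = int n then {b} else {}) (gcomp M y k)" for k
    unfolding gcomp_eq[OF assms(1)] * by (rule basis_map_subset) (use b in auto)
  have d1: "vectorspace.fin_dim class_ring (gcomp M y (int n))" "vectorspace.dim class_ring (gcomp M y (int n)) = 1"
    using basis_map.dim_singleton[of \<psi> "{b}" "gcomp M y (int n)" b] bm[of "int n"] by auto
  have d0: "vectorspace.fin_dim class_ring (gcomp M y k)" "vectorspace.dim class_ring (gcomp M y k) = 0"
    "carrier (gcomp M y k) = {\<zero>\<^bsub>M\<^esub>}" if "k \<noteq> int n" for k
    using basis_map.dim_empty[of \<psi> "{}" "gcomp M y k"] bm[of k] that by (auto simp: gcomp_def)
  have "{i. i < 0 \<and> carrier (gcomp M y i) \<noteq> {\<zero>\<^bsub>M\<^esub>}} = {}" using d0(3) by auto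
  then show "has_gdim M y" unfolding has_gdim_def
    using d1(1) d0(1) by (metis finite.emptyI)
  have "gdim M y = Abs_fls (\<lambda>k. if k = int n then 1 else 0)"
    unfolding gdim_def using d1(2) d0(2) by (intro arg_cong[of _ _ Abs_fls] ext) auto
  also have "\<dots> = fls_X ^ n"
  proof (rule fls_eqI)
    fix k
    \<comment> \<open>Evaluating \<open>Abs_fls\<close> requires the coefficients to vanish far to
      the left; 0 is a valid bound because n is a natural number.\<close>
    show "fls_nth (Abs_fls (\<lambda>k. if k = int n then 1 else 0)) k = fls_nth (fls_X ^ n :: int fls) k"
      by (subst nth_Abs_fls_lower_bound[of 0]) auto
  qed
  finally show "gdim M y = fls_X ^ n" .
qed

section \<open>Quotients, isomorphisms and restrictions through a model\<close>

subsection \<open>Isomorphisms, quotients and restrictions\<close>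

lemma ghomI:
  assumes "\<And>m. m \<in> carrier M \<Longrightarrow> f m \<in> carrier N"
    and "\<And>m n. m \<in> carrier M \<Longrightarrow> n \<in> carrier M \<Longrightarrow> f (m \<oplus>\<^bsub>M\<^esub> n) = f m \<oplus>\<^bsub>N\<^esub> f n"
    and "\<And>c m. m \<in> carrier M \<Longrightarrow> f (c \<odot>\<^bsub>M\<^esub> m) = c \<odot>\<^bsub>N\<^esub> f m"
    and "\<And>a m. a \<in> A \<Longrightarrow> m \<in> carrier M \<Longrightarrow> f (act M a m) = act N a (f m)"
    and "\<And>n m. m \<in> deg M n \<Longrightarrow> f m \<in> deg N n"
  shows "f \<in> ghom A M N"
  unfolding ghom_def LinearCombinations.module_hom_def using assms by auto

context graded_basis
begin

lemma act_closed: "a \<in> A \<Longrightarrow> m \<in> carrier M \<Longrightarrow> act M a m \<in> carrier M"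
  using acts by (simp add: act_axioms_def)

lemma deg_subset: "deg M n \<subseteq> carrier M"
  unfolding deg carrier_eq by auto

lemma gmod_iso:
  assumes f: "graded_iso A f M N" and g: "graded_iso A g M N'" and A: "unital_subalgebra A X"
  shows "gmod_iso A X N N'"
proof -
  interpret N: graded_basis "f \<circ> \<psi>" B N A X src sz by (rule transport_iso[OF f A])
  interpret N': graded_basis "g \<circ> \<psi>" B N' A X src sz by (rule transport_iso[OF g A])
  define h where "h = g \<circ> inv_into (carrier M) f"
  have fb: "bij_betw f (carrier M) (carrier N)" and gb: "bij_betw g (carrier M) (carrier N')"
    using f g by (simp_all add: graded_iso_def)
  have N: "carrier N = f ` carrier M" using fb by (simp add: bij_betw_def)
  have hf: "h (f m) = g m" if "m \<in> carrier M" for m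
    using fb that by (simp add: h_def bij_betw_inv_into_left)
  have "h \<in> ghom A N N'"
  proof (rule ghomI)
    show "h m \<in> carrier N'" if "m \<in> carrier N" for m
      using that hf gb unfolding N by (auto dest: bij_betwE)
    show "h (m \<oplus>\<^bsub>N\<^esub> n) = h m \<oplus>\<^bsub>N'\<^esub> h n" if mn: "m \<in> carrier N" "n \<in> carrier N" for m n
    proof -
      obtain m' n' where *: "m' \<in> carrier M" "n' \<in> carrier M" "m = f m'" "n = f n'"
        using mn unfolding N by auto
      have "h (m \<oplus>\<^bsub>N\<^esub> n) = h (f (m' \<oplus>\<^bsub>M\<^esub> n'))" using f * by (simp add: graded_iso_def)
      also have "\<dots> = g (m' \<oplus>\<^bsub>M\<^esub> n')" using * by (intro hf) simp
      also have "\<dots> = g m' \<oplus>\<^bsub>N'\<^esub> g n'" using g * by (simp add: graded_iso_def)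
      finally show ?thesis using * hf by simp
    qed
    show "h (c \<odot>\<^bsub>N\<^esub> m) = c \<odot>\<^bsub>N'\<^esub> h m" if m: "m \<in> carrier N" for c m
    proof -
      obtain m' where *: "m' \<in> carrier M" "m = f m'" using m unfolding N by auto
      have "h (c \<odot>\<^bsub>N\<^esub> m) = h (f (c \<odot>\<^bsub>M\<^esub> m'))" using f * by (simp add: graded_iso_def)
      also have "\<dots> = g (c \<odot>\<^bsub>M\<^esub> m')" using * by (intro hf) simp
      also have "\<dots> = c \<odot>\<^bsub>N'\<^esub> g m'" using g * by (simp add: graded_iso_def)
      finally show ?thesis using * hf by simp
    qed
    show "h (act N a m) = act N' a (h m)" if a: "a \<in> A" and m: "m \<in> carrier N" for a m
    proof -
      obtain m' where *: "m' \<in> carrier M" "m = f m'" using m unfolding N by auto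
      have "h (act N a m) = h (f (act M a m'))" using f a * by (simp add: graded_iso_def)
      also have "\<dots> = g (act M a m')" using a * by (intro hf act_closed)
      also have "\<dots> = act N' a (g m')" using g a * by (simp add: graded_iso_def)
      finally show ?thesis using * hf by simp
    qed
    show "h m \<in> deg N' n" if "m \<in> deg N n" for m n
      using f g deg_subset[of n] hf that by (auto simp: graded_iso_def)
  qed
  moreover have "bij_betw h (carrier N) (carrier N')"
    unfolding h_def using bij_betw_trans[OF bij_betw_inv_into[OF fb] gb] .
  ultimately show ?thesis
    unfolding gmod_iso_def using N.graded_module N'.graded_module by blast
qed

text \<open>The first isomorphism theorem, directed from the model to the quotient: an element goes
  to its fibre. The cosets of the kernel are these fibres, so the set-valued operations of
  \<open>gquot\<close> are computed without choosing representatives.\<close>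

lemma quotient_iso:
  assumes grp: "abelian_group F"
    and surj: "\<theta> ` carrier F = carrier M"
    and add: "\<And>u v. u \<in> carrier F \<Longrightarrow> v \<in> carrier F \<Longrightarrow> \<theta> (u \<oplus>\<^bsub>F\<^esub> v) = \<theta> u \<oplus>\<^bsub>M\<^esub> \<theta> v"
    and smult_closed: "\<And>c u. u \<in> carrier F \<Longrightarrow> c \<odot>\<^bsub>F\<^esub> u \<in> carrier F"
    and smult: "\<And>c u. u \<in> carrier F \<Longrightarrow> \<theta> (c \<odot>\<^bsub>F\<^esub> u) = c \<odot>\<^bsub>M\<^esub> \<theta> u"
    and act_closed: "\<And>a u. a \<in> A \<Longrightarrow> u \<in> carrier F \<Longrightarrow> act F a u \<in> carrier F"
    and act: "\<And>a u. a \<in> A \<Longrightarrow> u \<in> carrier F \<Longrightarrow> \<theta> (act F a u) = act M a (\<theta> u)"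
    and deg_closed: "\<And>n. deg F n \<subseteq> carrier F"
    and deg: "\<And>n. \<theta> ` deg F n = deg M n"
    and ker: "K = {u \<in> carrier F. \<theta> u = \<zero>\<^bsub>M\<^esub>}"
  shows "graded_iso A (\<lambda>m. {u \<in> carrier F. \<theta> u = m}) M (gquot F K)"
proof -
  interpret F: abelian_group F by (rule grp)
  define \<phi> where "\<phi> = (\<lambda>m. {u \<in> carrier F. \<theta> u = m})"
  have \<theta>c: "\<theta> u \<in> carrier M" if "u \<in> carrier F" for u using that surj by auto
  have \<theta>0: "\<theta> \<zero>\<^bsub>F\<^esub> = \<zero>\<^bsub>M\<^esub>"
    using add[of "\<zero>\<^bsub>F\<^esub>" "\<zero>\<^bsub>F\<^esub>"] \<theta>c[of "\<zero>\<^bsub>F\<^esub>"] using M.add.r_cancel_one'[of "\<theta> \<zero>\<^bsub>F\<^esub>" "\<theta> \<zero>\<^bsub>F\<^esub>"] by simp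
  have \<theta>m: "\<theta> (u \<ominus>\<^bsub>F\<^esub> v) = \<theta> u \<ominus>\<^bsub>M\<^esub> \<theta> v" if "u \<in> carrier F" "v \<in> carrier F" for u v
  proof -
    have "\<theta> (u \<ominus>\<^bsub>F\<^esub> v) \<oplus>\<^bsub>M\<^esub> \<theta> v = \<theta> u"
      using add[of "u \<ominus>\<^bsub>F\<^esub> v" v] that by (simp add: F.minus_eq F.a_assoc F.l_neg)
    then have "\<theta> u \<ominus>\<^bsub>M\<^esub> \<theta> v = (\<theta> (u \<ominus>\<^bsub>F\<^esub> v) \<oplus>\<^bsub>M\<^esub> \<theta> v) \<ominus>\<^bsub>M\<^esub> \<theta> v" by simp
    also have "\<dots> = \<theta> (u \<ominus>\<^bsub>F\<^esub> v)"
      using that \<theta>c by (simp add: M.minus_eq M.a_assoc M.r_neg)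
    finally show ?thesis ..
  qed
  have coset: "K +>\<^bsub>F\<^esub> u = \<phi> (\<theta> u)" if u: "u \<in> carrier F" for u
  proof (intro equalityI subsetI)
    fix v assume "v \<in> K +>\<^bsub>F\<^esub> u"
    then obtain k where "k \<in> K" "v = k \<oplus>\<^bsub>F\<^esub> u" by (auto simp: a_r_coset_def' )
    then show "v \<in> \<phi> (\<theta> u)" using u add \<theta>c by (auto simp: ker \<phi>_def)
  next
    fix v assume v: "v \<in> \<phi> (\<theta> u)"
    then have "v \<ominus>\<^bsub>F\<^esub> u \<in> K" using u \<theta>m \<theta>c by (auto simp: ker \<phi>_def M.minus_eq M.r_neg)
    moreover have "v = (v \<ominus>\<^bsub>F\<^esub> u) \<oplus>\<^bsub>F\<^esub> u"
      using v u by (simp add: \<phi>_def F.minus_eq F.a_assoc F.l_neg)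
    ultimately show "v \<in> K +>\<^bsub>F\<^esub> u" by (auto simp: a_r_coset_def')
  qed
  have ex: "\<exists>u\<in>carrier F. \<theta> u = m" if "m \<in> carrier M" for m
    using that unfolding surj[symmetric] by blast
  \<comment> \<open>The unions in \<open>gquot\<close> run over a nonempty fibre and all their
    members coincide, so they collapse to one coset.\<close>
  have UN: "(\<Union>u\<in>\<phi> m. K +>\<^bsub>F\<^esub> g u) = \<phi> (h m)"
    if m: "m \<in> carrier M" and gc: "\<And>u. u \<in> carrier F \<Longrightarrow> g u \<in> carrier F"
      and gh: "\<And>u. u \<in> carrier F \<Longrightarrow> \<theta> (g u) = h (\<theta> u)" for g h m
  proof -
    have "K +>\<^bsub>F\<^esub> g u = \<phi> (h m)" if u: "u \<in> \<phi> m" for u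
      using u coset[of "g u"] gc[of u] gh[of u] by (simp add: \<phi>_def)
    moreover have "\<phi> m \<noteq> {}" using ex[OF m] by (auto simp: \<phi>_def)
    ultimately show ?thesis by simp
  qed
  have rc: "a_rcosets\<^bsub>F\<^esub> K = \<phi> ` carrier M"
    unfolding A_RCOSETS_def' surj[symmetric] using coset by auto
  show ?thesis
    unfolding graded_iso_def \<phi>_def[symmetric]
  proof (intro conjI ballI allI)
    have "inj_on \<phi> (carrier M)"
    proof (rule inj_onI)
      fix m n assume "m \<in> carrier M" "n \<in> carrier M" "\<phi> m = \<phi> n"
      then show "m = n" using ex[of m] by (auto simp: \<phi>_def)
    qed
    then show "bij_betw \<phi> (carrier M) (carrier (gquot F K))"
      by (simp add: bij_betw_def gquot_def rc)
    show "\<phi> \<zero>\<^bsub>M\<^esub> = \<zero>\<^bsub>gquot F K\<^esub>" by (simp add: gquot_def \<phi>_def ker)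
    show "\<phi> (m \<oplus>\<^bsub>M\<^esub> n) = \<phi> m \<oplus>\<^bsub>gquot F K\<^esub> \<phi> n" if m: "m \<in> carrier M" and n: "n \<in> carrier M" for m n
    proof -
      have "\<phi> m <+>\<^bsub>F\<^esub> \<phi> n = \<phi> (m \<oplus>\<^bsub>M\<^esub> n)"
      proof (intro equalityI subsetI)
        fix w assume "w \<in> \<phi> m <+>\<^bsub>F\<^esub> \<phi> n"
        then show "w \<in> \<phi> (m \<oplus>\<^bsub>M\<^esub> n)" by (auto simp: set_add_def' \<phi>_def add)
      next
        fix w assume w: "w \<in> \<phi> (m \<oplus>\<^bsub>M\<^esub> n)"
        obtain u where u: "u \<in> carrier F" "\<theta> u = m" using ex[OF m] by auto
        have "\<theta> (w \<ominus>\<^bsub>F\<^esub> u) = n"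
          using w u \<theta>m[of w u] m n by (simp add: \<phi>_def M.minus_eq M.a_comm[of m n] M.a_assoc M.r_neg)
        then have "w \<ominus>\<^bsub>F\<^esub> u \<in> \<phi> n" using w u by (simp add: \<phi>_def)
        moreover have "w = u \<oplus>\<^bsub>F\<^esub> (w \<ominus>\<^bsub>F\<^esub> u)"
          using w u by (simp add: \<phi>_def F.minus_eq F.a_comm[of w "\<ominus>\<^bsub>F\<^esub> u"] F.r_neg2)
        ultimately show "w \<in> \<phi> m <+>\<^bsub>F\<^esub> \<phi> n" using u by (auto simp: set_add_def' \<phi>_def)
      qed
      then show ?thesis by (simp add: gquot_def)
    qed
    show "\<phi> (c \<odot>\<^bsub>M\<^esub> m) = c \<odot>\<^bsub>gquot F K\<^esub> \<phi> m" if "m \<in> carrier M" for c m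
      using UN[OF that, of "\<lambda>u. c \<odot>\<^bsub>F\<^esub> u" "\<lambda>m. c \<odot>\<^bsub>M\<^esub> m"] smult_closed smult by (simp add: gquot_def)
    show "\<phi> (act M a m) = act (gquot F K) a (\<phi> m)" if "a \<in> A" "m \<in> carrier M" for a m
      using UN[OF that(2), of "\<lambda>u. act F a u" "\<lambda>m. act M a m"] act_closed act that by (simp add: gquot_def)
    show "deg (gquot F K) n = \<phi> ` deg M n" for n
    proof -
      have "(\<lambda>u. K +>\<^bsub>F\<^esub> u) ` deg F n = (\<lambda>u. \<phi> (\<theta> u)) ` deg F n"
        by (intro image_cong refl coset) (use deg_closed in blast)
      also have "\<dots> = \<phi> ` deg M n" unfolding deg[symmetric] image_image ..
      finally show ?thesis by (simp add: gquot_def)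
    qed
  qed
qed

text \<open>Every multiple of a basis vector is fixed by the idempotent at its own source, so the
  span in \<open>restrict_module\<close> contains all combinations of basis vectors with source in
  \<open>Y\<close>.\<close>

lemma span_idem_images:
  assumes X: "X = UNIV"
  shows "span (\<Union>y\<in>Y. act M (videm y) ` carrier M) = \<psi> ` {p. keys p \<subseteq> {b \<in> B. src b \<in> Y}}"
    (is "span ?S = ?R")
proof
  have S: "?S = (\<Union>y\<in>Y. \<psi> ` {p. keys p \<subseteq> {b \<in> B. src b = y}})"
    using idem_image[of _ B] X by (simp add: carrier_eq)
  have "?S \<subseteq> ?R" unfolding S by fast
  then show "span ?S \<subseteq> ?R"
    using map_subspace[of "{b \<in> B. src b \<in> Y}"]
    by (intro span_is_subset) (auto simp: VectorSpace.subspace_def)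
  have SM: "?S \<subseteq> carrier M" unfolding S unfolding carrier_eq by fast
  interpret sp: submodule class_ring "span ?S" M by (rule span_is_submodule[OF SM])
  show "?R \<subseteq> span ?S"
  proof
    fix m assume "m \<in> ?R"
    then obtain p where p: "keys p \<subseteq> {b \<in> B. src b \<in> Y}" "m = \<psi> p" by auto
    have "\<psi> (\<Sum>b\<in>T. single b (lookup p b)) \<in> span ?S"
      if "finite T" "T \<subseteq> keys p" for T
      using that
    proof (induction T)
      case empty
      show ?case by (simp add: map_zero)
    next
      case (insert b T)
      have b: "b \<in> B" "src b \<in> Y" using insert.prems p by auto
      then have "\<psi> (single b (lookup p b)) \<in> ?S"
        unfolding S by (intro UN_I[of "src b"] imageI) auto
      then have 1: "\<psi> (single b (lookup p b)) \<in> span ?S"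
        using in_own_span[OF SM] by blast
      have 2: "\<psi> (\<Sum>b\<in>T. single b (lookup p b)) \<in> span ?S"
        using insert by simp
      have "keys (\<Sum>b\<in>T. single b (lookup p b)) \<subseteq> B"
        by (rule keys_sum_subset) (use insert.prems p in auto)
      then show ?case using insert.hyps b sp.m_closed[OF 1 2] by (simp add: map_add)
    qed
    from this[of "keys p"] show "m \<in> span ?S"
      using p(2) pm_sum_single[of p] by simp
  qed
qed

end

lemma restrict_iso:
  assumes M: "graded_basis \<psi> B M UNIV UNIV src sz" and f: "graded_iso UNIV f M N"
    and C: "C = \<psi> ` {p. keys p \<subseteq> {b \<in> B. src b \<in> X}}"
  shows "graded_iso A f (M\<lparr>carrier := C, deg := \<lambda>n. deg M n \<inter> C\<rparr>) (restrict_module X N)"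
proof -
  interpret M: graded_basis \<psi> B M UNIV UNIV src sz by (rule M)
  have u: "unital_subalgebra UNIV UNIV" by (simp add: unital_subalgebra_def)
  interpret N: graded_basis "f \<circ> \<psi>" B N UNIV UNIV src sz by (rule M.transport_iso[OF f u])
  have CM: "C \<subseteq> carrier M" unfolding C M.carrier_eq by auto
  have inj: "inj_on f (carrier M)" using f by (simp add: graded_iso_def bij_betw_def)
  have span: "N.span (\<Union>y\<in>X. act N (videm y) ` carrier N) = f ` C"
    unfolding N.span_idem_images[OF refl] C by (simp add: image_image)
  have r: "restrict_module X N = N\<lparr>carrier := f ` C, deg := \<lambda>n. deg N n \<inter> f ` C\<rparr>"
    unfolding restrict_module_def Let_def span ..
  have d: "f ` deg M n \<inter> f ` C = f ` (deg M n \<inter> C)" for n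
    using inj M.deg_subset[of n] CM by (simp add: inj_on_image_Int)
  show ?thesis
    using f CM inj unfolding r graded_iso_def
    by (auto simp: bij_betw_def d subset_iff intro: inj_on_subset)
qed

section \<open>The quotient of V f_x by the variables c_j\<close>

section \<open>Standard and projective modules\<close>

lemma proj_module_simps [simp]:
  "carrier (proj_module X y) = (\<lambda>a. a * videm y) ` V_sub X"
  "zero (proj_module X y) = 0"
  "add (proj_module X y) = (+)"
  "smult (proj_module X y) = vscale"
  "act (proj_module X y) = (*)"
  "deg (proj_module X y) n = (\<lambda>a. a * videm y) ` V_sub X \<inter> vdeg n"
  by (simp_all add: proj_module_def left_module_def)

lemma gshift_simps [simp]:
  "carrier (gshift n M) = carrier M" "zero (gshift n M) = zero M" "add (gshift n M) = add M"
  "smult (gshift n M) = smult M" "act (gshift n M) = act M" "deg (gshift n M) k = deg M (k - n)"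
  by (simp_all add: gshift_def)

text \<open>The variables \<open>c\<^sub>j\<close> of the regular sequence.\<close>

definition karrow :: "'r::linorder \<Rightarrow> 'r \<Rightarrow> 'r arrow" where
  "karrow i j = (if j < i then Beta j else Alpha j)"

lemma karrow_neq: "j \<noteq> i \<Longrightarrow> karrow i j \<noteq> Alpha i" "j \<noteq> i \<Longrightarrow> karrow i j \<noteq> Beta i"
  by (auto simp: karrow_def)

lemma inj_karrow: "inj_on (karrow i) J"
  by (auto simp: inj_on_def karrow_def split: if_splits)

text \<open>What remains are the a_j with j < i, the b_j with j > i, and a power of a_i or of b_i:
  one monomial \<open>m\<close> for each value of \<open>- wt m\<close> in
  \<open>C_set i\<close>.\<close>

definition dmon :: "'r::linorder \<Rightarrow> 'r arrow multiset set" where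
  "dmon i = {m. nf i m \<and> (\<forall>j. j \<noteq> i \<longrightarrow> karrow i j \<notin># m)}"

text \<open>The projection of V f_x along the left ideal generated by the arrows c_j ending at x. In
  normal coordinates it drops the monomials containing some c_j.\<close>

definition dproj :: "'r::{finite, linorder} \<Rightarrow> 'r pt \<Rightarrow> ('k::field, 'r) valg \<Rightarrow> ('r arrow multiset \<Rightarrow>\<^sub>0 'k)" where
  "dproj i x v = restr (dmon i) (co i x v)"

lemma dproj_add: "dproj i x (u + v) = dproj i x u + dproj i x v"
  by (simp add: dproj_def co_add restr_add)

lemma dproj_scale: "dproj i x (vscale c v) = pm_scale c (dproj i x v)"
  by (simp add: dproj_def co_scale restr_scale)

lemma dproj_zero [simp]: "dproj i x 0 = 0"
  by (simp add: dproj_def restr_eq_0)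

lemma dproj_sum: "dproj i x (sum f S) = (\<Sum>s\<in>S. dproj i x (f s))"
  by (induction S rule: infinite_finite_induct) (simp_all add: dproj_add)

lemma dproj_diff: "dproj i x (u - v) = dproj i x u - dproj i x v"
  using dproj_add[of i x "u - v" v] by simp

lemma dproj_mult_videm: "dproj i x (v * videm x) = dproj i x v"
  by (simp add: dproj_def co_mult_videm)

lemma dproj_Psi: "keys p \<subseteq> dmon i \<Longrightarrow> dproj i x (Psi x p) = p"
  by (subst dproj_def, subst co_Psi) (auto simp: dmon_def restr_id)

lemma keys_dproj: "keys (dproj i x v) \<subseteq> dmon i"
  by (simp add: dproj_def)

lemma dproj_mult_karrow:
  assumes "j \<noteq> i"
  shows "dproj i x (v * vpath (x - arrow_step (karrow i j), [karrow i j])) = 0"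
proof (rule poly_mapping_eqI)
  fix m
  show "lookup (dproj i x (v * vpath (x - arrow_step (karrow i j), [karrow i j]))) m =
      lookup 0 m"
    using assms by (simp add: dproj_def lookup_co_mult_arrow karrow_neq dmon_def)
qed

text \<open>Only those multiples of c_j that occur in \<open>v\<close> are taken, not the whole left
  ideal: if \<open>v\<close> is truncated, their sources then lie in \<open>X\<close>, as the
  relations of the standard module require.\<close>

definition kgens :: "'r::{finite, linorder} \<Rightarrow> 'r pt \<Rightarrow> ('k::field, 'r) valg \<Rightarrow> ('k, 'r) valg set" where
  "kgens i x v = {bas (x - arrow_step (karrow i j)) m * vpath (x - arrow_step (karrow i j), [karrow i j]) |
     j m. j \<noteq> i \<and> add_mset (karrow i j) m \<in> keys (co i x v)}"

text \<open>A normal monomial outside \<open>dmon i\<close> contains some c_j; splitting off this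
  factor as the last arrow exhibits it as a generator.\<close>

lemma dproj_eq_0D:
  fixes v :: "('k::field, 'r::{finite, linorder}) valg"
  assumes "dproj i x v = 0"
  shows "v * videm x \<in> V.span (kgens i x v)"
proof -
  have "bas x m \<in> V.span (kgens i x v)" if m: "m \<in> keys (co i x v)" for m
  proof -
    have "lookup (dproj i x v) m = 0" using assms by simp
    then have "m \<notin> dmon i" using m by (auto simp: dproj_def in_keys_iff split: if_splits)
    moreover have "nf i m" using m co_nf by blast
    ultimately obtain j where j: "j \<noteq> i" "karrow i j \<in># m" by (auto simp: dmon_def)
    define n where "n = m - {#karrow i j#}"
    have mn: "m = add_mset (karrow i j) n" using j by (simp add: n_def)
    have "bas x m = (bas (x - arrow_step (karrow i j)) n * vpath (x - arrow_step (karrow i j), [karrow i j]) :: ('k, 'r) valg)"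
      by (simp add: bas_mult vpath_eq_bas mn)
    also have "\<dots> \<in> V.span (kgens i x v)"
      unfolding kgens_def using j(1) m mn by (intro V.span_base) auto
    finally show ?thesis .
  qed
  then show ?thesis unfolding Psi_co[symmetric, of v x i] Psi_def
    by (intro V.span_sum V.span_scale)
qed

text \<open>An element killed by the projection has its f_x component in the span of products ending
  in an arrow c_j, and left multiplication keeps that ending.\<close>

lemma dproj_left_ideal:
  fixes v :: "('k::field, 'r::{finite, linorder}) valg"
  assumes "dproj i x v = 0"
  shows "dproj i x (a * v) = 0"
proof -
  have "dproj i x (a * w) = 0" if "w \<in> V.span (kgens i x v)" for w
    using that
  proof (induction rule: V.span_induct_alt)
    case (step c u w)
    then obtain j l where "j \<noteq> i" "u = l * vpath (x - arrow_step (karrow i j), [karrow i j])"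
      by (auto simp: kgens_def)
    then have "dproj i x (a * u) = 0" using dproj_mult_karrow by (simp flip: mult.assoc)
    then show ?case using step by (simp add: distrib_left vscale_mult_right dproj_add dproj_scale)
  qed simp
  from this[OF dproj_eq_0D[OF assms]] have "dproj i x (a * v * videm x) = 0" by (simp add: mult.assoc)
  then show ?thesis by (simp add: dproj_mult_videm)
qed

text \<open>A representative may be replaced by its projection before acting. This gives
  associativity of the action on the model and its compatibility with the maps from V_X f_x and from
  the tensor product.\<close>

lemma dproj_mult_dproj: "dproj i x (a * Psi x (dproj i x v)) = dproj i x (a * v)"
proof -
  have "dproj i x (v - Psi x (dproj i x v)) = 0"
    by (simp add: dproj_diff dproj_Psi[OF keys_dproj])
  from dproj_left_ideal[OF this, of a] show ?thesis
    by (simp add: right_diff_distrib dproj_diff)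
qed

text \<open>A model of \<open>\<Delta>(x)\<close>: to act, lift to \<open>V f\<^sub>x\<close> by \<open>Psi\<close>, multiply there and project back.\<close>

definition delta_module :: "'r::{finite, linorder} pt set \<Rightarrow> 'r \<Rightarrow> 'r pt \<Rightarrow>
    ('k::field, 'r, 'r arrow multiset \<Rightarrow>\<^sub>0 'k) vmodule" where
  "delta_module X i x =
     \<lparr>carrier = {p. keys p \<subseteq> {m \<in> dmon i. x - wt m \<in> X}}, mult = undefined, one = undefined,
      zero = 0, add = (+), smult = pm_scale,
      act = (\<lambda>a p. dproj i x (a * Psi x p)),
      deg = (\<lambda>n. {p. keys p \<subseteq> {m \<in> {m \<in> dmon i. x - wt m \<in> X}. int (size m) = n}})\<rparr>"

lemma delta_module_simps [simp]:
  "carrier (delta_module X i x) = {p. keys p \<subseteq> {m \<in> dmon i. x - wt m \<in> X}}"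
  "zero (delta_module X i x) = 0" "add (delta_module X i x) = (+)" "smult (delta_module X i x) = pm_scale"
  "act (delta_module X i x) a p = dproj i x (a * Psi x p)"
  "deg (delta_module X i x) n = {p. keys p \<subseteq> {m \<in> {m \<in> dmon i. x - wt m \<in> X}. int (size m) = n}}"
  by (simp_all add: delta_module_def)

lemma dproj_V_sub:
  assumes "v \<in> V_sub X"
  shows "keys (dproj i x v) \<subseteq> {m \<in> dmon i. x - wt m \<in> X}"
  using V_sub_source[OF assms, of i x] by (auto simp: dproj_def)

lemma delta_graded_basis:
  fixes X :: "'r::{finite, linorder} pt set"
  assumes x: "x \<in> X"
  shows "graded_basis (\<lambda>p. p) {m \<in> dmon i. x - wt m \<in> X}
     (delta_module X i x :: ('k::field, 'r, 'r arrow multiset \<Rightarrow>\<^sub>0 'k) vmodule)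
     (V_sub X) X (\<lambda>m. x - wt m) (\<lambda>m. int (size m))"
proof
  let ?B = "{m \<in> dmon i. x - wt m \<in> X}"
  have PV: "Psi x p \<in> V_sub X" if "keys p \<subseteq> ?B" for p :: "'r arrow multiset \<Rightarrow>\<^sub>0 'k"
    by (rule Psi_V_sub[OF x]) (use that in auto)
  show "act_axioms (V_sub X) (delta_module X i x :: ('k, 'r, 'r arrow multiset \<Rightarrow>\<^sub>0 'k) vmodule)"
    unfolding act_axioms_def delta_module_simps
  proof (intro conjI allI ballI impI)
    fix a :: "('k, 'r) valg" and p :: "'r arrow multiset \<Rightarrow>\<^sub>0 'k"
    assume a: "a \<in> V_sub X" and "p \<in> {p. keys p \<subseteq> ?B}"
    then have p: "keys p \<subseteq> ?B" by simp
    show "dproj i x (a * Psi x p) \<in> {p. keys p \<subseteq> ?B}"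
      by (intro CollectI dproj_V_sub V_sub_mult a PV p)
  next
    fix k l and a :: "('k, 'r) valg" and p :: "'r arrow multiset \<Rightarrow>\<^sub>0 'k"
    assume a: "a \<in> V_sub X" "a \<in> vdeg k" and "p \<in> {p. keys p \<subseteq> {m \<in> ?B. int (size m) = l}}"
    then have p: "keys p \<subseteq> {m \<in> ?B. int (size m) = l}" by simp
    then have "keys p \<subseteq> ?B" by blast
    then have "keys (dproj i x (a * Psi x p)) \<subseteq> ?B"
      by (intro dproj_V_sub V_sub_mult a PV)
    moreover have "Psi x p \<in> vdeg l" by (rule Psi_vdeg) (use p in auto)
    then have "keys (co i x (a * Psi x p)) \<subseteq> {m. int (size m) = k + l}"
      by (intro co_vdeg vdeg_mult a)
    ultimately show "dproj i x (a * Psi x p) \<in> {p. keys p \<subseteq> {m \<in> ?B. int (size m) = k + l}}"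
      by (auto simp: dproj_def)
  next
    fix a b :: "('k, 'r) valg" and p :: "'r arrow multiset \<Rightarrow>\<^sub>0 'k"
    show "dproj i x (a * b * Psi x p) = dproj i x (a * Psi x (dproj i x (b * Psi x p)))"
      by (simp add: dproj_mult_dproj mult.assoc)
  qed (simp_all add: distrib_left distrib_right Psi_add Psi_scale dproj_add dproj_scale
      vscale_mult_left vscale_mult_right)
  show "act (delta_module X i x) (videm z) p = restr {b. x - wt b = z} p"
    if "keys p \<subseteq> ?B" for z and p :: "'r arrow multiset \<Rightarrow>\<^sub>0 'k"
    unfolding delta_module_simps videm_mult_Psi by (rule dproj_Psi) (use that in auto)
qed (auto simp: bij_betw_def)

text \<open>Lets the results on the truncated model be specialised to modules over V itself.\<close>

lemma V_sub_UNIV: "V_sub UNIV = (UNIV :: ('k::field, 'r::finite) valg set)"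
proof -
  have "v \<in> V_sub UNIV" for v :: "('k, 'r) valg"
    using valg_span_bas[of v] V.span_minimal[OF _ V_sub_subspace, of "{bas y m | y m. True}" UNIV] bas_V_sub
    by blast
  then show ?thesis by blast
qed

section \<open>Identification of the standard modules and their graded dimensions\<close>

subsection \<open>The standard modules\<close>

lemma wt_apply: "wt m j = int (count m (Alpha j)) - int (count m (Beta j))"
proof (induction m)
  case (add a m)
  then show ?case by (cases a) (auto simp: unit_pt_def)
qed simp

lemma size_eq_sum_count: "size m = (\<Sum>j\<in>UNIV. count m (Alpha j) + count m (Beta j))"
  for m :: "'r::finite arrow multiset"
proof (induction m)
  case (add a m)
  have "(\<Sum>j\<in>UNIV. count (add_mset a m) (Alpha j) + count (add_mset a m) (Beta j)) =
      (\<Sum>j\<in>UNIV. (count m (Alpha j) + count m (Beta j)) + (if a = Alpha j \<or> a = Beta j then 1 else 0))"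
    by (intro sum.cong) auto
  also have "\<dots> = size m + (\<Sum>j\<in>UNIV. if a = Alpha j \<or> a = Beta j then 1 else 0)"
    by (simp add: sum.distrib add)
  also have "(\<Sum>j\<in>UNIV. if a = Alpha j \<or> a = Beta j then 1 else 0) = (1 :: nat)"
    by (cases a) auto
  finally show ?case by simp
qed simp

text \<open>At most one of a_j, b_j occurs for each j, so the weight recovers the monomial, and the
  size of the monomial is the l1 norm of its weight.\<close>

lemma dmon_count:
  assumes "m \<in> dmon i"
  shows "count m (Alpha j) = nat (wt m j)" "count m (Beta j) = nat (- wt m j)"
proof -
  have "count m (Alpha j) = 0 \<or> count m (Beta j) = 0"
  proof (cases "j = i")
    case True
    then show ?thesis using assms by (auto simp: dmon_def nf_def not_in_iff)
  next
    case False
    then have "karrow i j \<notin># m" using assms by (auto simp: dmon_def)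
    then show ?thesis by (auto simp: karrow_def not_in_iff split: if_splits)
  qed
  then show "count m (Alpha j) = nat (wt m j)" "count m (Beta j) = nat (- wt m j)"
    by (auto simp: wt_apply)
qed

lemma dmon_eqI:
  assumes "m \<in> dmon i" "n \<in> dmon i" "wt m = wt n"
  shows "m = n"
proof (rule multiset_eqI)
  fix a show "count m a = count n a"
    using assms by (cases a) (simp_all add: dmon_count[of m i] dmon_count[of n i])
qed

lemma dmon_size:
  fixes m :: "'r::{finite, linorder} arrow multiset"
  assumes "m \<in> dmon i"
  shows "int (size m) = (\<Sum>j\<in>UNIV. \<bar>wt m j\<bar>)"
  unfolding size_eq_sum_count dmon_count[OF assms] of_nat_sum by (intro sum.cong) auto

lemma dmon_dist:
  assumes "m \<in> dmon i" "x - wt m = y"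
  shows "size m = dist_pt x y"
  using dmon_size[OF assms(1)] by (simp add: dist_pt_def assms(2)[symmetric])

lemma dmon_mu_set:
  assumes "m \<in> dmon (cub_index X x)"
  shows "x - wt m \<in> mu_set X x"
proof -
  have "karrow (cub_index X x) j \<notin># m" if "j \<noteq> cub_index X x" for j
    using assms that by (auto simp: dmon_def)
  then have "Beta j \<notin># m" if "j < cub_index X x" for j
    using that by (metis karrow_def less_irrefl)
  moreover have "Alpha j \<notin># m" if "cub_index X x < j" for j
    using that \<open>\<And>j. j \<noteq> cub_index X x \<Longrightarrow> karrow (cub_index X x) j \<notin># m\<close>
    by (metis karrow_def less_asym less_irrefl)
  ultimately show ?thesis by (auto simp: mem_mu_set wt_apply not_in_iff)
qed

lemma mu_set_dmon:
  fixes x :: "'r::{finite, linorder} pt"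
  assumes "y \<in> mu_set X x"
  obtains m where "m \<in> dmon (cub_index X x)" "x - wt m = y"
proof -
  define m where "m = (\<Sum>j\<in>UNIV. replicate_mset (nat (x j - y j)) (Alpha j) + replicate_mset (nat (y j - x j)) (Beta j))"
  have A: "count m (Alpha j) = nat (x j - y j)" and B: "count m (Beta j) = nat (y j - x j)" for j
    by (auto simp: m_def count_sum sum.delta' cong: if_cong)
  have "x - wt m = y"
    by (rule ext) (simp add: wt_apply A B)
  moreover have "m \<in> dmon (cub_index X x)"
    using assms unfolding dmon_def nf_def not_in_iff mem_mu_set by (auto simp: karrow_def A B not_in_iff)
  ultimately show ?thesis using that by blast
qed

lemma karrow_step_lambda_set:
  assumes "j \<noteq> cub_index X x"
  shows "x - arrow_step (karrow (cub_index X x) j) \<in> lambda_set X x"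
  using assms by (auto simp: mem_lambda_set karrow_def unit_pt_def)

text \<open>One inclusion is the Cubist input: the quotient by the c_j lives on
  \<open>mu_set X x\<close>, which contains no t \<prec> x. For the other, each arrow c_j into x
  starts in \<open>lambda_set X x\<close>, hence at some t \<prec> x in \<open>X\<close>.\<close>

lemma std_relations_eq:
  fixes X :: "'r::{finite, linorder} pt set"
  assumes X: "cubist X" and x: "x \<in> X"
  shows "std_relations X x =
     {u \<in> carrier (proj_module X x :: ('k::field, 'r, ('k, 'r) valg) vmodule). dproj (cub_index X x) x u = 0}"
    (is "_ = ?K")
proof
  let ?i = "cub_index X x"
  have "V.subspace ?K"
    by (rule V.subspaceI)
      (auto simp: proj_carrier[OF x] dproj_add dproj_scale V_sub_add V_sub_scale distrib_right vscale_mult_left)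
  moreover have "{a * videm t * b * videm x | a b t.
      a \<in> V_sub X \<and> b \<in> V_sub X \<and> t \<in> X \<and> succeq X x t \<and> t \<noteq> x} \<subseteq> ?K"
  proof (rule subsetI, elim CollectE exE conjE)
    fix v a b :: "('k, 'r) valg" and t
    assume v: "v = a * videm t * b * videm x" and ab: "a \<in> V_sub X" "b \<in> V_sub X"
      and t: "t \<in> X" "succeq X x t" "t \<noteq> x"
    \<comment> \<open>All coordinates of this product have source t, while monomials in
      \<open>dmon\<close> have their sources in \<open>mu_set X x\<close>.\<close>
    have "dproj ?i x (videm t * b) = 0"
      unfolding dproj_def co_videm_mult
      using succeq_not_mem_mu_set[OF X x t(2,3)] dmon_mu_set[of _ X x] by (intro restr_eq_0) auto
    then have "dproj ?i x (a * (videm t * b)) = 0" by (rule dproj_left_ideal)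
    then have "dproj ?i x v = 0" unfolding v dproj_mult_videm by (simp only: mult.assoc)
    moreover have "v \<in> V_sub X" unfolding v by (intro V_sub_mult ab videm_V_sub t x)
    moreover have "v * videm x = v" unfolding v by (simp add: mult.assoc)
    ultimately show "v \<in> ?K" by (simp add: proj_carrier[OF x])
  qed
  ultimately show "std_relations X x \<subseteq> ?K" unfolding std_relations_def by (intro V.span_minimal)
  show "?K \<subseteq> std_relations X x"
  proof
    fix u :: "('k, 'r) valg" assume "u \<in> ?K"
    then have u: "u \<in> V_sub X" "u * videm x = u" "dproj ?i x u = 0" by (auto simp: proj_carrier[OF x])
    have "V.span (kgens ?i x u) \<subseteq> std_relations X x"
      unfolding std_relations_def kgens_def
    proof (intro V.span_mono subsetI, elim CollectE exE conjE)
      fix v :: "('k, 'r) valg" and j m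
      let ?t = "x - arrow_step (karrow ?i j)"
      assume v: "v = bas ?t m * vpath (?t, [karrow ?i j])"
        and j: "j \<noteq> ?i" and m: "add_mset (karrow ?i j) m \<in> keys (co ?i x u)"
      have tl: "?t \<in> lambda_set X x" by (rule karrow_step_lambda_set[OF j])
      then have tX: "?t \<in> X" using lambda_set_subset[OF X x] by blast
      have "x - wt (add_mset (karrow ?i j) m) \<in> X" using V_sub_source[OF u(1), of ?i x] m by blast
      then have "?t - wt m \<in> X" by (simp only: wt_simps diff_diff_eq)
      then have 1: "bas ?t m \<in> V_sub X" by (rule bas_V_sub[OF tX])
      have 2: "vpath (?t, [karrow ?i j]) \<in> V_sub X" by (rule varrow_V_sub) (use tX x in auto)
      have 3: "succeq X x ?t" unfolding succeq_def using tl x by auto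
      have "arrow_step (karrow ?i j) j \<noteq> 0" by (auto simp: karrow_def unit_pt_def)
      then have 4: "?t \<noteq> x" by (metis cancel_comm_monoid_add_class.diff_cancel diff_diff_eq2 add_diff_cancel_left' zero_fun_apply)
      have "v = bas ?t m * videm ?t * vpath (?t, [karrow ?i j]) * videm x"
        unfolding v by (simp add: mult.assoc varrow_mult_videm videm_mult_varrow)
      then show "v \<in> {a * videm t * b * videm x | a b t.
          a \<in> V_sub X \<and> b \<in> V_sub X \<and> t \<in> X \<and> succeq X x t \<and> t \<noteq> x}"
        using 1 2 3 4 tX by blast
    qed
    then show "u \<in> std_relations X x" using dproj_eq_0D[OF u(3)] u(2) by auto
  qed
qed

lemma abelian_group_proj:
  assumes y: "y \<in> X"
  shows "abelian_group (proj_module X y :: ('k::field, 'r::finite, ('k, 'r) valg) vmodule)"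
proof (rule abelian_groupI)
  fix u :: "('k, 'r) valg" assume "u \<in> carrier (proj_module X y)"
  then show "\<exists>v\<in>carrier (proj_module X y). v \<oplus>\<^bsub>proj_module X y\<^esub> u = \<zero>\<^bsub>proj_module X y\<^esub>"
    using V_sub_scale[of u X "-1"] vscale_mult_left[of "-1" u "videm y"]
    by (intro bexI[of _ "vscale (-1) u"]) (auto simp: proj_carrier[OF y])
qed (auto simp: proj_carrier[OF y] V_sub_add distrib_right add_ac)

lemma std_graded_iso:
  fixes X :: "'r::{finite, linorder} pt set"
  assumes X: "cubist X" and x: "x \<in> X"
  shows "graded_iso (V_sub X) (\<lambda>p. {u \<in> carrier (proj_module X x). dproj (cub_index X x) x u = p})
     (delta_module X (cub_index X x) x) (std_module X x :: ('k::field, 'r, ('k, 'r) valg set) vmodule)"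
  unfolding std_module_def
proof (rule graded_basis.quotient_iso[OF delta_graded_basis[OF x]])
  let ?i = "cub_index X x"
  let ?B = "{m \<in> dmon ?i. x - wt m \<in> X}"
  show "abelian_group (proj_module X x :: ('k, 'r, ('k, 'r) valg) vmodule)" by (rule abelian_group_proj[OF x])
  have PV: "Psi x p \<in> V_sub X" if "keys p \<subseteq> ?B" for p :: "'r arrow multiset \<Rightarrow>\<^sub>0 'k"
    by (rule Psi_V_sub[OF x]) (use that in auto)
  have keys: "dproj ?i x (Psi x p) = p" if "keys p \<subseteq> ?B" for p :: "'r arrow multiset \<Rightarrow>\<^sub>0 'k"
    by (rule dproj_Psi) (use that in auto)
  show "dproj ?i x ` carrier (proj_module X x :: ('k, 'r, ('k, 'r) valg) vmodule) = carrier (delta_module X ?i x)"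
  proof (intro equalityI subsetI)
    fix p :: "'r arrow multiset \<Rightarrow>\<^sub>0 'k" assume "p \<in> carrier (delta_module X ?i x)"
    then have p: "keys p \<subseteq> ?B" by simp
    show "p \<in> dproj ?i x ` carrier (proj_module X x :: ('k, 'r, ('k, 'r) valg) vmodule)"
      by (rule image_eqI[of _ _ "Psi x p"]) (use keys[OF p] PV[OF p] in \<open>simp_all add: proj_carrier[OF x] Psi_mult_videm\<close>)
  qed (use dproj_V_sub[of _ X ?i x] in \<open>auto simp: proj_carrier[OF x]\<close>)
  show "dproj ?i x ` deg (proj_module X x :: ('k, 'r, ('k, 'r) valg) vmodule) n = deg (delta_module X ?i x) n" for n
  proof (intro equalityI subsetI)
    fix p :: "'r arrow multiset \<Rightarrow>\<^sub>0 'k" assume "p \<in> deg (delta_module X ?i x) n"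
    then have p: "keys p \<subseteq> {m \<in> ?B. int (size m) = n}" by simp
    then have p': "keys p \<subseteq> ?B" by blast
    have "Psi x p \<in> vdeg n" by (rule Psi_vdeg) (use p in auto)
    then show "p \<in> dproj ?i x ` deg (proj_module X x :: ('k, 'r, ('k, 'r) valg) vmodule) n"
      by (intro image_eqI[of _ _ "Psi x p"])
        (use keys[OF p'] PV[OF p'] in \<open>simp_all add: proj_carrier[OF x] Psi_mult_videm\<close>)
  next
    fix p assume "p \<in> dproj ?i x ` deg (proj_module X x :: ('k, 'r, ('k, 'r) valg) vmodule) n"
    then obtain v :: "('k, 'r) valg" where v: "p = dproj ?i x v" "v \<in> V_sub X" "v \<in> vdeg n"
      by (auto simp: proj_carrier[OF x])
    then show "p \<in> deg (delta_module X ?i x) n"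
      using dproj_V_sub[OF v(2), of ?i x] co_vdeg[OF v(3), of ?i x] by (auto simp: dproj_def)
  qed
  show "std_relations X x = {u \<in> carrier (proj_module X x). dproj ?i x u = \<zero>\<^bsub>delta_module X ?i x\<^esub>}"
    using std_relations_eq[OF X x] by simp
qed (auto simp: dproj_add dproj_scale dproj_mult_dproj proj_carrier[OF x] V_sub_mult V_sub_scale
    vscale_mult_left mult.assoc)

text \<open>A vertex of \<open>mu_set X x\<close> is the source of exactly one monomial of
  \<open>dmon\<close>, whose size is the distance from x; other vertices are sources of
  none.\<close>

lemma std_gdim:
  fixes X :: "'r::{finite, linorder} pt set"
  assumes X: "cubist X" and x: "x \<in> X" and y: "y \<in> X"
  shows "has_gdim (std_module X x :: ('k::field, 'r, ('k, 'r) valg set) vmodule) y"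
    and "gdim (std_module X x :: ('k::field, 'r, ('k, 'r) valg set) vmodule) y = tilde_matrix X x y"
proof -
  let ?i = "cub_index X x"
  let ?M = "std_module X x :: ('k, 'r, ('k, 'r) valg set) vmodule"
  let ?B = "{m \<in> dmon ?i. x - wt m \<in> X}"
  define f where "f = (\<lambda>p :: 'r arrow multiset \<Rightarrow>\<^sub>0 'k. {u \<in> carrier (proj_module X x). dproj (cub_index X x) x u = p}) \<circ> (\<lambda>p. p)"
  interpret graded_basis f ?B ?M "V_sub X" X "\<lambda>m. x - wt m" "\<lambda>m. int (size m)"
    unfolding f_def
    by (rule graded_basis.transport_iso[OF delta_graded_basis[OF x] std_graded_iso[OF X x] unital_subalgebra_V_sub])
  have "has_gdim ?M y \<and> gdim ?M y = tilde_matrix X x y"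
  proof (cases "y \<in> mu_set X x")
    case True
    then obtain m where m: "m \<in> dmon ?i" "x - wt m = y" by (rule mu_set_dmon)
    have "b = m" if "b \<in> dmon ?i" "x - wt b = y" for b
    proof (rule dmon_eqI[OF that(1) m(1)])
      show "wt b = wt m" using that(2) m(2) by (metis diff_diff_eq2 add_diff_cancel_left')
    qed
    then have "{b \<in> ?B. x - wt b = y} = {m}" using m y by blast
    from gdim_one[OF y this, of "dist_pt x y"] show ?thesis
      using dmon_dist[OF m] True by (simp add: tilde_matrix_def)
  next
    case False
    then have "x - wt b \<noteq> y" if "b \<in> ?B" for b using that dmon_mu_set by blast
    from gdim_none[OF y this] show ?thesis using False by (simp add: tilde_matrix_def)
  qed
  then show "has_gdim ?M y" "gdim ?M y = tilde_matrix X x y" by auto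
qed

section \<open>The induced module V \<otimes> L(x) and its truncation\<close>

subsection \<open>The induced modules\<close>

lemma idem_coeff_vpath: "idem_coeff x (vpath p) = (if p = (x, []) then 1 else (0 :: 'k::field))"
  by transfer (auto simp: path_elem_def lookup_single when_def)

lemma idem_coeff_add: "idem_coeff x (a + b) = idem_coeff x a + idem_coeff x b"
  by transfer (simp add: lookup_add)

lemma idem_coeff_scale: "idem_coeff x (vscale c a) = c * idem_coeff x a"
  by transfer simp

lemma dproj_mult_karrow_any:
  fixes v :: "('k::field, 'r::{finite, linorder}) valg"
  assumes "j \<noteq> i"
  shows "dproj i x (v * vpath (z, [karrow i j])) = 0"
proof (cases "z = x - arrow_step (karrow i j)")
  case False
  have "vpath (z, [karrow i j]) = (vpath (z, [karrow i j]) * videm (z + arrow_step (karrow i j)) :: ('k, 'r) valg)"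
    by (simp add: vpath_eq_bas bas_mult)
  moreover have "z + arrow_step (karrow i j) \<noteq> x" using False by auto
  ultimately show ?thesis
    using co_mult_videm_neq[of "z + arrow_step (karrow i j)" x i "v * vpath (z, [karrow i j])"]
    by (metis dproj_def dproj_zero co_zero mult.assoc)
qed (simp add: dproj_mult_karrow assms)

lemma dproj_mult_videm_neq: "z \<noteq> x \<Longrightarrow> dproj i x (v * videm z) = 0"
  by (simp add: dproj_def co_mult_videm_neq restr_eq_0)

text \<open>The arrows generating P_i are the c_j, which the projection kills on the right. So right
  multiplication by P_i acts through the character by which P_i acts on L(x).\<close>

lemma dproj_mult_P_alg:
  assumes "p \<in> P_alg i"
  shows "dproj i x (v * p) = pm_scale (idem_coeff x p) (dproj i x v)"
  using assms
proof (induction arbitrary: v rule: P_alg.induct)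
  case (idem z)
  then show ?case
    using dproj_mult_videm_neq[of z x i v]
    by (cases "z = x") (simp_all add: idem_coeff_vpath dproj_mult_videm)
next
  case (beta j z)
  then show ?case
    using dproj_mult_karrow_any[of j i x v z] by (simp add: idem_coeff_vpath karrow_def)
next
  case (alpha j z)
  then have "karrow i j = Alpha j" "j \<noteq> i" by (auto simp: karrow_def)
  then show ?case
    using dproj_mult_karrow_any[of j i x v z] by (simp add: idem_coeff_vpath)
next
  case (mult a b)
  then show ?case by (simp add: idem_coeff_mult mult.commute flip: mult.assoc)
qed (simp_all add: idem_coeff_add idem_coeff_scale distrib_left vscale_mult_right dproj_add dproj_scale
    PM.scale_left_distrib)

lemma tensor_free_simps [simp]:
  "carrier (tensor_free (simple_module x)) = UNIV"
  "zero (tensor_free L) = 0" "add (tensor_free L) = (+)" "smult (tensor_free L) = pm_scale"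
  "act (tensor_free L) a z = (\<Sum>p\<in>keys z. single (a * fst p, snd p) (lookup z p))"
  "deg (tensor_free L) n = {z. keys z \<subseteq> (\<Union>i. vdeg i \<times> deg L (n - i))}"
  by (simp_all add: tensor_free_def simple_module_def)

lemma simple_module_simps [simp]:
  "carrier (simple_module x) = UNIV" "add (simple_module x) = (+)" "smult (simple_module x) = (*)"
  "act (simple_module x) p c = idem_coeff x p * c" "deg (simple_module x) n = (if n = 0 then UNIV else {0})"
  by (simp_all add: simple_module_def)

text \<open>The map on the free space that is to induce the isomorphism of the tensor product with
  the model.\<close>

definition tensor_dproj :: "'r::{finite, linorder} \<Rightarrow> 'r pt \<Rightarrow> (('k::field, 'r) valg \<times> 'k \<Rightarrow>\<^sub>0 'k) \<Rightarrow>
    ('r arrow multiset \<Rightarrow>\<^sub>0 'k)" where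
  "tensor_dproj i x z = (\<Sum>p\<in>keys z. pm_scale (lookup z p * snd p) (dproj i x (fst p)))"

lemma tensor_dproj_eq_lin_ext: "tensor_dproj i x = PM.lin_ext (\<lambda>p. pm_scale (snd p) (dproj i x (fst p)))"
  by (simp add: fun_eq_iff tensor_dproj_def PM.lin_ext_def)

lemma tensor_dproj_add: "tensor_dproj i x (z + w) = tensor_dproj i x z + tensor_dproj i x w"
  and tensor_dproj_scale: "tensor_dproj i x (pm_scale c z) = pm_scale c (tensor_dproj i x z)"
  and tensor_dproj_sum: "tensor_dproj i x (sum f S) = (\<Sum>s\<in>S. tensor_dproj i x (f s))"
  and tensor_dproj_diff: "tensor_dproj i x (z - w) = tensor_dproj i x z - tensor_dproj i x w"
  and tensor_dproj_single: "tensor_dproj i x (single (v, l) c) = pm_scale (c * l) (dproj i x v)"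
  and tensor_dproj_zero [simp]: "tensor_dproj i x 0 = 0"
  by (simp_all add: tensor_dproj_eq_lin_ext PM.lin_ext_simps)

text \<open>Balancedness is \<open>dproj_mult_P_alg\<close>; the remaining relations express
  bilinearity.\<close>

lemma tensor_relations_simple_le:
  "tensor_relations (P_alg i) (simple_module x) \<subseteq> {z. tensor_dproj i x z = 0}"
  unfolding tensor_relations_def Let_def
proof (rule PM.span_minimal)
  show "PM.subspace {z. tensor_dproj i x z = 0}"
    by (rule PM.subspaceI) (auto simp: tensor_dproj_add tensor_dproj_scale)
qed (auto simp: tensor_dproj_diff tensor_dproj_single tensor_dproj_scale dproj_add dproj_scale
    PM.scale_right_distrib PM.scale_left_distrib dproj_mult_P_alg mult.commute)

text \<open>Every tensor is congruent to one of the form \<open>w \<otimes> 1\<close>.\<close>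

lemma tensor_relations_simple_ge:
  fixes z :: "('k::field, 'r::{finite, linorder}) valg \<times> 'k \<Rightarrow>\<^sub>0 'k"
  assumes z: "tensor_dproj i x z = 0"
  shows "z \<in> tensor_relations (P_alg i) (simple_module x)"
proof -
  define e where "e = (\<lambda>(v :: ('k, 'r) valg) (l :: 'k). single (v, l) (1 :: 'k))"
  define R where "R = (tensor_relations (P_alg i) (simple_module x) :: (('k, 'r) valg \<times> 'k \<Rightarrow>\<^sub>0 'k) set)"
  note R_unfold = R_def tensor_relations_def Let_def e_def
  have R_sub: "PM.subspace R" unfolding R_unfold by simp
  have R0: "0 \<in> R" and Ra: "a \<in> R \<Longrightarrow> b \<in> R \<Longrightarrow> a + b \<in> R" and Rd: "a \<in> R \<Longrightarrow> b \<in> R \<Longrightarrow> a - b \<in> R"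
    and Rs: "a \<in> R \<Longrightarrow> pm_scale c a \<in> R" for a b c
    using R_sub by (auto intro: PM.subspace_0 PM.subspace_add PM.subspace_diff PM.subspace_scale)
  have g1: "e (u + v) l - e u l - e v l \<in> R" for u v l
    unfolding R_unfold
    by (rule PM.span_base, rule UnI1, rule UnI1, rule UnI1, rule UnI1, rule CollectI,
        rule exI[of _ u], rule exI[of _ v], rule exI[of _ l]) simp
  have g2: "e v (l + l') - e v l - e v l' \<in> R" for v l l'
    unfolding R_unfold
    by (rule PM.span_base, rule UnI1, rule UnI1, rule UnI1, rule UnI2, rule CollectI,
        rule exI[of _ v], rule exI[of _ l], rule exI[of _ l']) simp
  have g3: "e (vscale c v) l - pm_scale c (e v l) \<in> R" for c v l
    unfolding R_unfold
    by (rule PM.span_base, rule UnI1, rule UnI1, rule UnI2, rule CollectI,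
        rule exI[of _ c], rule exI[of _ v], rule exI[of _ l]) simp
  have g4: "e v (c * l) - pm_scale c (e v l) \<in> R" for c v l
    unfolding R_unfold
    by (rule PM.span_base, rule UnI1, rule UnI2, rule CollectI,
        rule exI[of _ c], rule exI[of _ v], rule exI[of _ l]) simp
  have g5: "e (v * p) l - e v (idem_coeff x p * l) \<in> R" if "p \<in> P_alg i" for v p l
    unfolding R_unfold
    by (rule PM.span_base, rule UnI2, rule CollectI,
        rule exI[of _ v], rule exI[of _ p], rule exI[of _ l]) (use that in simp)
  have e0: "e 0 l \<in> R" for l
    using Rs[OF g1[of 0 0 l], of "-1"] by (simp add: PM.scale_minus_left)
  have e0': "e v 0 \<in> R" for v
    using Rs[OF g2[of v 0 0], of "-1"] by (simp add: PM.scale_minus_left)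
  have single: "single (v, l) c - e (vscale (c * l) (v * videm x)) 1 \<in> R" for v l c
  proof -
    have sc: "single (v, l) c = pm_scale c (e v l)"
      by (rule poly_mapping_eqI) (simp add: e_def lookup_single when_def)
    \<comment> \<open>Balancing the idempotent at x, which acts as 1 on L(x), replaces v by v
      f_x.\<close>
    have "e v l - e (v * videm x) l \<in> R"
      using Rs[OF g5[of "videm x" v l], of "-1"]
      by (simp add: P_alg.idem idem_coeff_vpath PM.scale_minus_left)
    moreover have "e (v * videm x) l - pm_scale l (e (v * videm x) 1) \<in> R"
      using g4[of "v * videm x" l 1] by simp
    ultimately have "e v l - pm_scale l (e (v * videm x) 1) \<in> R"
      using Ra[of "e v l - e (v * videm x) l" "e (v * videm x) l - pm_scale l (e (v * videm x) 1)"] by simp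
    then have "pm_scale c (e v l) - pm_scale (c * l) (e (v * videm x) 1) \<in> R"
      using Rs[of "e v l - pm_scale l (e (v * videm x) 1)" c] by (simp add: PM.scale_right_diff_distrib)
    from Rd[OF this g3[of "c * l" "v * videm x" 1]] show ?thesis
      unfolding sc by simp
  qed
  have esum: "(\<Sum>s\<in>S. e (f s) 1) - e (sum f S) 1 \<in> R" if "finite S"
    for f and S :: "(('k, 'r) valg \<times> 'k) set"
    using that
  proof (induction S)
    case empty
    then show ?case using Rd[OF R0 e0[of 1]] by simp
  next
    case (insert s S)
    have "((\<Sum>s\<in>S. e (f s) 1) - e (sum f S) 1) - (e (f s + sum f S) 1 - e (f s) 1 - e (sum f S) 1) \<in> R"
      by (rule Rd[OF insert.IH g1])
    then show ?case using insert.hyps by (simp add: algebra_simps)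
  qed
  define w where "w = (\<Sum>p\<in>keys z. vscale (lookup z p * snd p) (fst p * videm x))"
  have "(\<Sum>p\<in>keys z. single (fst p, snd p) (lookup z p) -
      e (vscale (lookup z p * snd p) (fst p * videm x)) 1) \<in> R"
    by (rule PM.subspace_sum[OF R_sub]) (rule single)
  then have "z - (\<Sum>p\<in>keys z. e (vscale (lookup z p * snd p) (fst p * videm x)) 1) \<in> R"
    by (simp add: sum_subtractf pm_sum_single[symmetric])
  from Ra[OF this esum[of "keys z" "\<lambda>p. vscale (lookup z p * snd p) (fst p * videm x)"]]
  have zw: "z - e w 1 \<in> R" by (simp add: w_def)
  have wx: "w * videm x = w" by (simp add: w_def sum_distrib_right vscale_mult_left mult.assoc)
  have "dproj i x w = 0"
    using z by (simp add: w_def dproj_sum dproj_scale dproj_mult_videm tensor_dproj_def)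
  then have "w \<in> V.span (kgens i x w)" using dproj_eq_0D[of i x w] wx by simp
  \<comment> \<open>The span consists of combinations of products v c_j with c_j in P_i. Moved
    across the tensor sign, c_j acts on L(x) as zero.\<close>
  moreover have "e u 1 \<in> R" if "u \<in> V.span (kgens i x w)" for u
    using that
  proof (induction rule: V.span_induct_alt)
    case base
    show ?case by (rule e0)
  next
    case (step c g u)
    then obtain j v where g: "g = v * vpath (x - arrow_step (karrow i j), [karrow i j])" and j: "j \<noteq> i"
      by (auto simp: kgens_def)
    have "vpath (x - arrow_step (karrow i j), [karrow i j]) \<in> (P_alg i :: ('k, 'r) valg set)"
      using j by (cases j i rule: linorder_cases) (auto simp: karrow_def intro: P_alg.intros)
    from g5[OF this, of v 1] have "e g 1 - e v 0 \<in> R" by (simp add: g idem_coeff_vpath)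
    from Ra[OF this e0'[of v]] have "e g 1 \<in> R" by simp
    from Ra[OF g3[of c g 1] Rs[OF this, of c]] have "e (vscale c g) 1 \<in> R" by simp
    from Ra[OF Ra[OF g1[of "vscale c g" u 1] this] step.IH] show ?case by simp
  qed
  ultimately have "e w 1 \<in> R" by blast
  from Ra[OF zw this] show ?thesis by (simp add: R_def)
qed

lemma tensor_dproj_act:
  "tensor_dproj i x (act (tensor_free L) a z) = dproj i x (a * Psi x (tensor_dproj i x z))"
proof -
  have *: "dproj i x (a * Psi x (sum f S)) = (\<Sum>s\<in>S. dproj i x (a * Psi x (f s)))"
    for f :: "'d \<Rightarrow> 'a arrow multiset \<Rightarrow>\<^sub>0 'b" and S
    by (simp add: Psi_sum sum_distrib_left dproj_sum)
  show ?thesis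
    unfolding tensor_free_simps tensor_dproj_sum tensor_dproj_def[of i x z] *
    by (simp add: tensor_dproj_single Psi_scale vscale_mult_right dproj_scale dproj_mult_dproj)
qed

lemma tensor_graded_iso:
  "graded_iso UNIV (\<lambda>p. {u \<in> carrier (tensor_free (simple_module x)). tensor_dproj i x u = p})
     (delta_module UNIV i x)
     (V_std_module i x :: ('k::field, 'r::{finite, linorder}, (('k, 'r) valg \<times> 'k \<Rightarrow>\<^sub>0 'k) set) vmodule)"
  unfolding V_std_module_def V_tensor_def
proof (rule graded_basis.quotient_iso[OF delta_graded_basis[OF UNIV_I], unfolded V_sub_UNIV])
  let ?F = "tensor_free (simple_module x) :: ('k, 'r, ('k, 'r) valg \<times> 'k \<Rightarrow>\<^sub>0 'k) vmodule"
  show "abelian_group ?F"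
  proof (rule abelian_groupI)
    fix u assume "u \<in> carrier ?F"
    show "\<exists>v\<in>carrier ?F. v \<oplus>\<^bsub>?F\<^esub> u = \<zero>\<^bsub>?F\<^esub>" by (intro bexI[of _ "- u"]) auto
  qed (auto simp: add_ac)
  have keys: "keys (tensor_dproj i x z) \<subseteq> dmon i" for z :: "('k, 'r) valg \<times> 'k \<Rightarrow>\<^sub>0 'k"
    unfolding tensor_dproj_def
    by (intro keys_sum_subset subset_trans[OF keys_pm_scale keys_dproj])
  have inv: "tensor_dproj i x (single (Psi x p, 1) 1) = p" if "keys p \<subseteq> dmon i"
    for p :: "'r arrow multiset \<Rightarrow>\<^sub>0 'k"
    using dproj_Psi[OF that, of x] by (simp add: tensor_dproj_single)
  show "tensor_dproj i x ` carrier ?F = carrier (delta_module UNIV i x)"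
  proof (intro equalityI subsetI)
    fix p :: "'r arrow multiset \<Rightarrow>\<^sub>0 'k" assume "p \<in> carrier (delta_module UNIV i x)"
    then have "keys p \<subseteq> dmon i" by simp
    from inv[OF this] show "p \<in> tensor_dproj i x ` carrier ?F" by (metis UNIV_I image_eqI tensor_free_simps(1))
  qed (use keys in auto)
  show "tensor_dproj i x ` deg ?F n = deg (delta_module UNIV i x) n" for n
  proof (intro equalityI subsetI)
    fix p :: "'r arrow multiset \<Rightarrow>\<^sub>0 'k" assume "p \<in> deg (delta_module UNIV i x) n"
    then have p: "keys p \<subseteq> dmon i" "keys p \<subseteq> {m. int (size m) = n}" by auto
    have "(Psi x p, 1) \<in> vdeg n \<times> deg (simple_module x) (n - n)" using Psi_vdeg[OF p(2), of x] by simp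
    then have "(Psi x p, 1) \<in> (\<Union>k. vdeg k \<times> deg (simple_module x) (n - k))" by blast
    then have "single (Psi x p, 1) 1 \<in> deg ?F n" by simp
    then show "p \<in> tensor_dproj i x ` deg ?F n" using inv[OF p(1)] by (metis image_eqI)
  next
    fix p assume "p \<in> tensor_dproj i x ` deg ?F n"
    then obtain z where z: "p = tensor_dproj i x z"
      "keys z \<subseteq> (\<Union>k. vdeg k \<times> deg (simple_module x) (n - k))" by auto
    \<comment> \<open>A pair with second entry 0 may have a first entry of any degree, since 0 lies
      in every component of the simple module; its contribution vanishes.\<close>
    have "keys (pm_scale (lookup z q * snd q) (dproj i x (fst q))) \<subseteq> {m. int (size m) = n}"
      if "q \<in> keys z" for q
    proof (cases "snd q = 0")
      case False
      then have "fst q \<in> vdeg n" using z(2) that by (fastforce split: if_splits)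
      then have "keys (dproj i x (fst q)) \<subseteq> {m. int (size m) = n}"
        using co_vdeg[of "fst q" n i x] by (auto simp: dproj_def)
      then show ?thesis using keys_pm_scale by (rule subset_trans[rotated])
    qed simp
    then have "keys p \<subseteq> {m. int (size m) = n}"
      unfolding z(1) tensor_dproj_def by (rule keys_sum_subset)
    then show "p \<in> deg (delta_module UNIV i x) n" using keys[of z] z(1) by auto
  qed
  show "tensor_relations (P_alg i) (simple_module x) =
      {u \<in> carrier ?F. tensor_dproj i x u = \<zero>\<^bsub>delta_module UNIV i x\<^esub>}"
    using tensor_relations_simple_le[of i x] tensor_relations_simple_ge[of i x] by auto
  show "tensor_dproj i x (act ?F a u) = act (delta_module UNIV i x) a (tensor_dproj i x u)" for a u
    unfolding delta_module_simps by (rule tensor_dproj_act)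
qed (auto simp: tensor_dproj_add tensor_dproj_scale)

lemma restrict_tensor_graded_iso:
  "graded_iso A (\<lambda>p. {u \<in> carrier (tensor_free (simple_module x)). tensor_dproj i x u = p})
     (delta_module X i x)
     (restrict_module X (V_std_module i x :: ('k::field, 'r::{finite, linorder}, (('k, 'r) valg \<times> 'k \<Rightarrow>\<^sub>0 'k) set) vmodule))"
proof -
  define C where "C = {p :: 'r arrow multiset \<Rightarrow>\<^sub>0 'k. keys p \<subseteq> {m \<in> dmon i. x - wt m \<in> X}}"
  have "delta_module X i x = (delta_module UNIV i x)\<lparr>carrier := C, deg := \<lambda>n. deg (delta_module UNIV i x) n \<inter> C\<rparr>"
    by (auto simp: delta_module_def C_def intro!: ext)
  moreover have "graded_iso A (\<lambda>p. {u \<in> carrier (tensor_free (simple_module x)). tensor_dproj i x u = p})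
     ((delta_module UNIV i x)\<lparr>carrier := C, deg := \<lambda>n. deg (delta_module UNIV i x) n \<inter> C\<rparr>)
     (restrict_module X (V_std_module i x :: ('k::field, 'r::{finite, linorder}, (('k, 'r) valg \<times> 'k \<Rightarrow>\<^sub>0 'k) set) vmodule))"
    by (rule restrict_iso[OF delta_graded_basis[OF UNIV_I, unfolded V_sub_UNIV] tensor_graded_iso])
      (simp add: C_def)
  ultimately show ?thesis by simp
qed

section \<open>Generation and projectivity of finite sums of shifted V_X f_y\<close>

subsection \<open>Projective modules\<close>

lemma additive_finsum:
  assumes M: "abelian_group M" and N: "abelian_group N"
    and cl: "\<And>m. m \<in> carrier M \<Longrightarrow> f m \<in> carrier N"
    and add: "\<And>m n. m \<in> carrier M \<Longrightarrow> n \<in> carrier M \<Longrightarrow> f (m \<oplus>\<^bsub>M\<^esub> n) = f m \<oplus>\<^bsub>N\<^esub> f n"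
    and S: "finite S" "\<And>s. s \<in> S \<Longrightarrow> u s \<in> carrier M"
  shows "f (\<Oplus>\<^bsub>M\<^esub>s\<in>S. u s) = (\<Oplus>\<^bsub>N\<^esub>s\<in>S. f (u s))"
proof -
  interpret M: abelian_group M by (rule M)
  interpret N: abelian_group N by (rule N)
  have f0: "f \<zero>\<^bsub>M\<^esub> = \<zero>\<^bsub>N\<^esub>"
    using add[of "\<zero>\<^bsub>M\<^esub>" "\<zero>\<^bsub>M\<^esub>"] cl[of "\<zero>\<^bsub>M\<^esub>"]
      N.add.r_cancel_one'[of "f \<zero>\<^bsub>M\<^esub>" "f \<zero>\<^bsub>M\<^esub>"] by simp
  show ?thesis
    using S
  proof (induction S)
    case (insert s S)
    then have "f (\<Oplus>\<^bsub>M\<^esub>s\<in>insert s S. u s) = f (u s \<oplus>\<^bsub>M\<^esub> (\<Oplus>\<^bsub>M\<^esub>s\<in>S. u s))"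
      by (subst M.finsum_insert) auto
    also have "\<dots> = f (u s) \<oplus>\<^bsub>N\<^esub> f (\<Oplus>\<^bsub>M\<^esub>s\<in>S. u s)"
      using insert.prems by (intro add M.finsum_closed) auto
    also have "\<dots> = f (u s) \<oplus>\<^bsub>N\<^esub> (\<Oplus>\<^bsub>N\<^esub>s\<in>S. f (u s))" using insert by simp
    also have "\<dots> = (\<Oplus>\<^bsub>N\<^esub>s\<in>insert s S. f (u s))"
      using insert.hyps insert.prems cl by (subst N.finsum_insert) auto
    finally show ?case .
  qed (simp add: f0)
qed

lemma (in graded_module) deg_submodule: "submodule class_ring (deg M n) M"
  using deg_decomposition unfolding internal_direct_sum_def VectorSpace.subspace_def by blast

lemma (in graded_module) deg_closed: "m \<in> deg M n \<Longrightarrow> m \<in> carrier M"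
  using submodule.subset[OF deg_submodule] by blast

lemma (in graded_module) finsum_deg:
  assumes "finite S" "\<And>s. s \<in> S \<Longrightarrow> u s \<in> deg M n"
  shows "(\<Oplus>\<^bsub>M\<^esub>s\<in>S. u s) \<in> deg M n"
proof -
  interpret D: submodule class_ring "deg M n" M by (rule deg_submodule)
  show ?thesis
    using assms
  proof (induction S)
    case (insert s S)
    then show ?case by (subst finsum_insert) (auto intro: deg_closed)
  qed simp
qed

lemma ghomD:
  assumes "f \<in> ghom A M N"
  shows "m \<in> carrier M \<Longrightarrow> f m \<in> carrier N"
    and "m \<in> carrier M \<Longrightarrow> n \<in> carrier M \<Longrightarrow> f (m \<oplus>\<^bsub>M\<^esub> n) = f m \<oplus>\<^bsub>N\<^esub> f n"
    and "m \<in> carrier M \<Longrightarrow> f (c \<odot>\<^bsub>M\<^esub> m) = c \<odot>\<^bsub>N\<^esub> f m"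
    and "a \<in> A \<Longrightarrow> m \<in> carrier M \<Longrightarrow> f (act M a m) = act N a (f m)"
    and "m \<in> deg M k \<Longrightarrow> f m \<in> deg N k"
  using assms unfolding ghom_def LinearCombinations.module_hom_def
  by (auto simp: image_subset_iff)

text \<open>Apply \<open>g\<close> to the homogeneous components of any preimage: by uniqueness of
  the decomposition of \<open>l\<close>, the component in degree \<open>k\<close> maps to
  \<open>l\<close>.\<close>

lemma graded_surj_deg:
  assumes N: "graded_module A X N" and L: "graded_module A X L"
    and g: "g \<in> ghom A N L" and surj: "g ` carrier N = carrier L" and l: "l \<in> deg L k"
  obtains n where "n \<in> deg N k" "g n = l"
proof -
  interpret N: graded_module A X N by (rule N)
  interpret L: graded_module A X L by (rule L)
  note g' = ghomD[OF g]
  have lL: "l \<in> carrier L" using l by (rule L.deg_closed)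
  then have "l \<in> g ` carrier N" using surj by simp
  then obtain n0 where n0: "n0 \<in> carrier N" "g n0 = l" by auto
  obtain c where c: "\<And>i. c i \<in> deg N i" "finite {i. c i \<noteq> \<zero>\<^bsub>N\<^esub>}"
    "n0 = (\<Oplus>\<^bsub>N\<^esub>i\<in>{i. c i \<noteq> \<zero>\<^bsub>N\<^esub>}. c i)"
    using N.deg_decomposition[unfolded internal_direct_sum_def, THEN conjunct2, rule_format,
        OF n0(1), THEN ex1_implies_ex] by blast
  let ?P = "\<lambda>c'. (\<forall>i\<in>UNIV. c' i \<in> deg L i) \<and> (\<forall>i. i \<notin> UNIV \<longrightarrow> c' i = \<zero>\<^bsub>L\<^esub>) \<and>
        finite {i. c' i \<noteq> \<zero>\<^bsub>L\<^esub>} \<and> l = (\<Oplus>\<^bsub>L\<^esub>i\<in>{i. c' i \<noteq> \<zero>\<^bsub>L\<^esub>}. c' i)"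
  have uniq: "\<exists>!c'. ?P c'"
    by (rule L.deg_decomposition[unfolded internal_direct_sum_def, THEN conjunct2, rule_format, OF lL])
  have g0: "g \<zero>\<^bsub>N\<^esub> = \<zero>\<^bsub>L\<^esub>"
    using g'(3)[of "\<zero>\<^bsub>N\<^esub>" 0] g'(1)[of "\<zero>\<^bsub>N\<^esub>"] N.lmult_0[of "\<zero>\<^bsub>N\<^esub>"] L.lmult_0[of "g \<zero>\<^bsub>N\<^esub>"] by simp
  have sub: "{i. g (c i) \<noteq> \<zero>\<^bsub>L\<^esub>} \<subseteq> {i. c i \<noteq> \<zero>\<^bsub>N\<^esub>}" using g0 by auto
  have cc: "c i \<in> carrier N" for i using c(1) by (rule N.deg_closed)
  have "l = (\<Oplus>\<^bsub>L\<^esub>i\<in>{i. c i \<noteq> \<zero>\<^bsub>N\<^esub>}. g (c i))"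
    unfolding n0(2)[symmetric] c(3)
    by (rule additive_finsum[OF N.abelian_group_axioms L.abelian_group_axioms]) (use g' c cc in auto)
  also have "\<dots> = (\<Oplus>\<^bsub>L\<^esub>i\<in>{i. g (c i) \<noteq> \<zero>\<^bsub>L\<^esub>}. g (c i))"
    by (rule L.add.finprod_mono_neutral_cong_left[OF c(2) sub, symmetric]) (use g'(1) cc in auto)
  finally have 1: "?P (\<lambda>i. g (c i))"
    using g'(5)[OF c(1)] finite_subset[OF sub c(2)] by auto
  have 0: "\<zero>\<^bsub>L\<^esub> \<in> deg L i" for i using submodule.zero_closed[OF L.deg_submodule] .
  have "{i. (if i = k then l else \<zero>\<^bsub>L\<^esub>) \<noteq> \<zero>\<^bsub>L\<^esub>} = (if l = \<zero>\<^bsub>L\<^esub> then {} else {k})" by auto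
  then have 2: "?P (\<lambda>i. if i = k then l else \<zero>\<^bsub>L\<^esub>)"
    using l 0 lL by (auto simp: L.finsum_insert)
  have "(\<lambda>i. g (c i)) = (\<lambda>i. if i = k then l else \<zero>\<^bsub>L\<^esub>)"
  proof (rule alt_ex1E[OF uniq])
    assume u: "\<forall>c c'. ?P c \<and> ?P c' \<longrightarrow> c = c'"
    show ?thesis by (rule u[rule_format, OF conjI, OF 1 2])
  qed
  then have "g (c k) = l" by metis
  then show ?thesis using that c(1) by blast
qed

definition psum :: "'r::finite pt set \<Rightarrow> int \<Rightarrow> 'r pt set \<Rightarrow> ('k::field, 'r, 'r pt \<Rightarrow> ('k, 'r) valg) vmodule" where
  "psum X n I = gsum I (\<lambda>y. gshift n (proj_module X y))"

lemma psum_simps: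
  assumes "finite I" "I \<subseteq> X"
  shows "carrier (psum X n I) = {g \<in> extensional I. \<forall>y\<in>I. g y \<in> V_sub X \<and> g y * videm y = g y}"
    and "zero (psum X n I) = (\<lambda>y\<in>I. 0)"
    and "add (psum X n I) = (\<lambda>g h. \<lambda>y\<in>I. g y + h y)"
    and "smult (psum X n I) = (\<lambda>c g. \<lambda>y\<in>I. vscale c (g y))"
    and "act (psum X n I) = (\<lambda>a g. \<lambda>y\<in>I. a * g y)"
    and "deg (psum X n I) k = {g \<in> extensional I. \<forall>y\<in>I. g y \<in> V_sub X \<and> g y * videm y = g y \<and> g y \<in> vdeg (k - n)}"
proof -
  have *: "(\<lambda>a. a * videm y) ` V_sub X = {v \<in> V_sub X. v * videm y = v}" if "y \<in> I" for y
    using that assms(2) by (intro proj_carrier) auto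
  show c: "carrier (psum X n I) = {g \<in> extensional I. \<forall>y\<in>I. g y \<in> V_sub X \<and> g y * videm y = g y}"
    using assms(1) by (auto simp: psum_def gsum_def PiE_def Pi_def *)
  show "deg (psum X n I) k = {g \<in> extensional I. \<forall>y\<in>I. g y \<in> V_sub X \<and> g y * videm y = g y \<and> g y \<in> vdeg (k - n)}"
    using assms(1) by (auto simp: psum_def gsum_def PiE_def Pi_def *)
qed (simp_all add: psum_def gsum_def)

text \<open>Coordinates on a sum of several V f_y are indexed by pairs of a summand and a monomial;
  \<open>slice\<close> extracts those of one summand as a finitely supported function.\<close>

definition slice :: "'c \<Rightarrow> ('c \<times> 'b \<Rightarrow>\<^sub>0 'k::zero) \<Rightarrow> ('b \<Rightarrow>\<^sub>0 'k)" where
  "slice y q = Abs_poly_mapping (\<lambda>m. lookup q (y, m))"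

lemma lookup_slice [simp]: "lookup (slice y q) m = lookup q (y, m)"
proof -
  have "{m. lookup q (y, m) \<noteq> 0} \<subseteq> snd ` keys q"
    by (force simp: in_keys_iff)
  then have "finite {m. lookup q (y, m) \<noteq> 0}" by (rule finite_subset) simp
  then show ?thesis by (simp add: slice_def lookup_Abs_poly_mapping)
qed

lemma keys_slice: "keys (slice y q) = {m. (y, m) \<in> keys q}"
  by (auto simp: in_keys_iff)

lemma unslice:
  fixes p :: "'c \<Rightarrow> 'b \<Rightarrow>\<^sub>0 'k::zero"
  assumes "finite I"
  obtains q where "\<And>y m. lookup q (y, m) = (if y \<in> I then lookup (p y) m else 0)"
proof -
  define f where "f = (\<lambda>(y, m). if y \<in> I then lookup (p y) m else 0)"
  have "{b. f b \<noteq> 0} \<subseteq> (\<Union>y\<in>I. Pair y ` keys (p y))"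
    by (auto simp: f_def in_keys_iff split: if_splits)
  then have "finite {b. f b \<noteq> 0}" by (rule finite_subset) (use assms in auto)
  then have "lookup (Abs_poly_mapping f) (y, m) = (if y \<in> I then lookup (p y) m else 0)" for y m
    by (simp add: lookup_Abs_poly_mapping f_def)
  then show ?thesis by (rule that)
qed

lemma psum_graded_basis:
  fixes X :: "'r::finite pt set" and i :: 'r
  assumes I: "finite I" "I \<subseteq> X"
  shows "graded_basis (\<lambda>q. \<lambda>y\<in>I. Psi y (slice y q)) {(y, m). y \<in> I \<and> nf i m \<and> y - wt m \<in> X}
     (psum X n I :: ('k::field, 'r, 'r pt \<Rightarrow> ('k, 'r) valg) vmodule)
     (V_sub X) X (\<lambda>(y, m). y - wt m) (\<lambda>(y, m). int (size m) + n)"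
proof
  let ?B = "{(y, m). y \<in> I \<and> nf i m \<and> y - wt m \<in> X}"
  let ?M = "psum X n I :: ('k, 'r, 'r pt \<Rightarrow> ('k, 'r) valg) vmodule"
  let ?psi = "\<lambda>q :: 'r pt \<times> 'r arrow multiset \<Rightarrow>\<^sub>0 'k. \<lambda>y\<in>I. Psi y (slice y q)"
  note simps = psum_simps[OF I]
  have rep: "\<exists>q. keys q \<subseteq> ?B \<and> ?psi q = g \<and> (\<forall>y\<in>I. slice y q = co i y (g y))"
    if g: "g \<in> carrier ?M" for g
  proof -
    obtain q where q: "\<And>y m. lookup q (y, m) = (if y \<in> I then lookup (co i y (g y)) m else 0)"
      using unslice[OF I(1), of "\<lambda>y. co i y (g y)"] by blast
    have s: "slice y q = co i y (g y)" if "y \<in> I" for y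
      by (rule poly_mapping_eqI) (simp add: q that)
    have "keys q \<subseteq> ?B"
    proof
      fix b :: "'r pt \<times> 'r arrow multiset" assume b: "b \<in> keys q"
      obtain y m where bb: "b = (y, m)" by (cases b)
      have ym: "y \<in> I" "m \<in> keys (co i y (g y))"
        using b q[of y m] by (auto simp: bb in_keys_iff split: if_splits)
      have "g y \<in> V_sub X" using g ym(1) by (simp add: simps)
      from V_sub_source[OF this, of i y] co_nf[of i y "g y"] ym show "b \<in> ?B" by (auto simp: bb)
    qed
    moreover have "?psi q = g"
    proof
      fix y show "?psi q y = g y"
      proof (cases "y \<in> I")
        case True
        then show ?thesis using g by (simp add: s Psi_co simps)
      next
        case False
        then show ?thesis using g by (simp add: simps extensional_def)
      qed
    qed
    ultimately show ?thesis using s by blast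
  qed
  have slB: "keys (slice y q) \<subseteq> {m. nf i m \<and> y - wt m \<in> X}" if "keys q \<subseteq> ?B"
    for y and q :: "'r pt \<times> 'r arrow multiset \<Rightarrow>\<^sub>0 'k"
    using that by (auto simp: keys_slice)
  have cl: "?psi q \<in> carrier ?M" if "keys q \<subseteq> ?B" for q
  proof -
    have "Psi y (slice y q) \<in> V_sub X" if "y \<in> I" for y
      by (rule Psi_V_sub) (use that I(2) slB[OF \<open>keys q \<subseteq> ?B\<close>, of y] in auto)
    then show ?thesis by (simp add: simps Psi_mult_videm)
  qed
  have "inj_on ?psi {q. keys q \<subseteq> ?B}"
  proof (rule inj_onI)
    fix q r assume q: "q \<in> {q. keys q \<subseteq> ?B}" and r: "r \<in> {q. keys q \<subseteq> ?B}"
      and eq: "?psi q = ?psi r"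
    have sl: "slice y q = slice y r" if "y \<in> I" for y
    proof (rule Psi_inj[of _ i _ y])
      show "Psi y (slice y q) = Psi y (slice y r)" using fun_cong[OF eq, of y] that by simp
    qed (use slB[of q y] slB[of r y] q r in auto)
    show "q = r"
    proof (rule poly_mapping_eqI)
      fix b :: "'r pt \<times> 'r arrow multiset"
      obtain y m where b: "b = (y, m)" by (cases b)
      show "lookup q b = lookup r b"
      proof (cases "y \<in> I")
        case True
        then show ?thesis using sl[OF True] by (metis b lookup_slice)
      next
        case False
        then have "b \<notin> keys q" "b \<notin> keys r" using q r by (auto simp: b)
        then show ?thesis by (simp add: in_keys_iff)
      qed
    qed
  qed
  moreover have "?psi ` {q. keys q \<subseteq> ?B} = carrier ?M"
    using cl rep by (force simp: image_iff)
  ultimately show "bij_betw ?psi {q. keys q \<subseteq> ?B} (carrier ?M)" by (simp add: bij_betw_def)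
  have sla: "slice y (p + q) = slice y p + slice y q" and sls: "slice y (pm_scale c p) = pm_scale c (slice y p)"
    for y c and p q :: "'r pt \<times> 'r arrow multiset \<Rightarrow>\<^sub>0 'k"
    by (rule poly_mapping_eqI; simp add: lookup_add)+
  show "?psi (p + q) = ?psi p \<oplus>\<^bsub>?M\<^esub> ?psi q" for p q
    by (auto simp: simps sla Psi_add)
  show "?psi (pm_scale c p) = c \<odot>\<^bsub>?M\<^esub> ?psi p" for c p
    by (auto simp: simps sls Psi_scale)
  have "slice y 0 = (0 :: 'r arrow multiset \<Rightarrow>\<^sub>0 'k)" for y :: "'r pt" by (rule poly_mapping_eqI) simp
  then show "?psi 0 = \<zero>\<^bsub>?M\<^esub>" by (simp add: simps)
  show "(\<lambda>(y, m). y - wt m) ` ?B \<subseteq> X" by auto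
  show "act ?M (videm z) (?psi p) = ?psi (restr {b. (\<lambda>(y, m). y - wt m) b = z} p)" for z p
  proof -
    have "slice y (restr {b. (\<lambda>(y, m). y - wt m) b = z} p) = restr {m. y - wt m = z} (slice y p)" for y
      by (rule poly_mapping_eqI) simp
    then show ?thesis by (auto simp: simps videm_mult_Psi)
  qed
  show "deg ?M k = ?psi ` {p. keys p \<subseteq> {b \<in> ?B. (\<lambda>(y, m). int (size m) + n) b = k}}" for k
  proof (intro equalityI subsetI)
    fix g assume g: "g \<in> deg ?M k"
    then have "g \<in> carrier ?M" by (simp add: simps)
    from rep[OF this] obtain q where q: "keys q \<subseteq> ?B" "?psi q = g" "\<forall>y\<in>I. slice y q = co i y (g y)"
      by blast
    have "int (size m) + n = k" if "(y, m) \<in> keys q" for y m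
    proof -
      have y: "y \<in> I" using that q(1) by auto
      have "m \<in> keys (co i y (g y))" using that q(3) y by (metis keys_slice mem_Collect_eq)
      moreover have "g y \<in> vdeg (k - n)" using g y by (simp add: simps)
      ultimately have "int (size m) = k - n" using co_vdeg by blast
      then show ?thesis by simp
    qed
    then show "g \<in> ?psi ` {p. keys p \<subseteq> {b \<in> ?B. (\<lambda>(y, m). int (size m) + n) b = k}}"
      using q(1,2) by (intro image_eqI[of _ _ q]) auto
  next
    fix g assume "g \<in> ?psi ` {p. keys p \<subseteq> {b \<in> ?B. (\<lambda>(y, m). int (size m) + n) b = k}}"
    then obtain q where q: "keys q \<subseteq> {b \<in> ?B. (\<lambda>(y, m). int (size m) + n) b = k}" "g = ?psi q" by blast
    have "g \<in> carrier ?M" unfolding q(2) by (rule cl) (use q(1) in auto)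
    moreover have "Psi y (slice y q) \<in> vdeg (k - n)" for y
      by (rule Psi_vdeg) (use q(1) in \<open>auto simp: keys_slice\<close>)
    ultimately show "g \<in> deg ?M k" by (simp add: simps q(2))
  qed
  show "act_axioms (V_sub X) ?M"
    unfolding act_axioms_def
  proof (intro conjI allI ballI impI)
    fix k l and a :: "('k, 'r) valg" and g assume "a \<in> V_sub X" "g \<in> deg ?M l" "a \<in> vdeg k"
    then show "act ?M a g \<in> deg ?M (k + l)"
      using vdeg_mult[of a k _ "l - n"] by (auto simp: simps V_sub_mult mult.assoc add_diff_eq)
  qed (auto simp: simps V_sub_mult mult.assoc distrib_left distrib_right vscale_mult_left vscale_mult_right
      restrict_def extensional_def)
qed

lemma psum_graded_module:
  fixes X :: "'r::finite pt set"
  assumes "finite I" "I \<subseteq> X"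
  shows "graded_module (V_sub X) X (psum X n I)"
  using graded_basis.graded_module[OF psum_graded_basis[OF assms]] .

definition psum_unit :: "'r::finite pt set \<Rightarrow> 'r pt \<Rightarrow> 'r pt \<Rightarrow> ('k::field, 'r) valg" where
  "psum_unit I y = (\<lambda>z\<in>I. if z = y then videm y else 0)"

lemma psum_unit_deg:
  assumes I: "finite I" "I \<subseteq> X" and y: "y \<in> I"
  shows "psum_unit I y \<in> deg (psum X n I) n" "psum_unit I y \<in> carrier (psum X n I)"
proof -
  have "videm y \<in> vdeg 0" using bas_vdeg[of y "{#}"] by (simp add: videm_eq_bas)
  then show "psum_unit I y \<in> deg (psum X n I) n" "psum_unit I y \<in> carrier (psum X n I)"
    using y I(2) by (auto simp: psum_simps[OF I] psum_unit_def videm_V_sub)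
qed

text \<open>Each entry satisfies g y = g y * f_y, so the generators f_y, which sit in degree n after
  the shift, reproduce the element. Generation and projectivity both rest on this expansion.\<close>

lemma psum_expand:
  fixes X :: "'r::finite pt set"
  assumes I: "finite I" "I \<subseteq> X" and g: "g \<in> carrier (psum X n I :: ('k::field, 'r, 'r pt \<Rightarrow> ('k, 'r) valg) vmodule)"
  shows "g = (\<Oplus>\<^bsub>psum X n I\<^esub>y\<in>I. act (psum X n I) (g y) (psum_unit I y))"
proof -
  let ?M = "psum X n I :: ('k, 'r, 'r pt \<Rightarrow> ('k, 'r) valg) vmodule"
  interpret M: graded_module "V_sub X" X ?M by (rule psum_graded_module[OF I])
  note simps = psum_simps[OF I]
  have cl: "act ?M (g y) (psum_unit I y) \<in> carrier ?M" if "y \<in> I" for y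
    using g that psum_unit_deg(2)[OF I that] by (intro M.act_closed) (auto simp: simps)
  have "(\<Oplus>\<^bsub>?M\<^esub>y\<in>J. act ?M (g y) (psum_unit I y)) = (\<lambda>z\<in>I. if z \<in> J then g z else 0)"
    if "finite J" "J \<subseteq> I" for J
    using that
  proof (induction J)
    case empty
    show ?case by (simp add: simps)
  next
    case (insert y J)
    have "(\<Oplus>\<^bsub>?M\<^esub>y\<in>insert y J. act ?M (g y) (psum_unit I y)) =
        act ?M (g y) (psum_unit I y) \<oplus>\<^bsub>?M\<^esub> (\<Oplus>\<^bsub>?M\<^esub>y\<in>J. act ?M (g y) (psum_unit I y))"
      using insert.hyps insert.prems cl by (subst M.finsum_insert) auto
    also have "\<dots> = act ?M (g y) (psum_unit I y) \<oplus>\<^bsub>?M\<^esub> (\<lambda>z\<in>I. if z \<in> J then g z else 0)"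
      by (subst insert.IH) (use insert.prems in simp_all)
    also have "\<dots> = (\<lambda>z\<in>I. if z \<in> insert y J then g z else 0)"
    proof
      fix z
      show "(act ?M (g y) (psum_unit I y) \<oplus>\<^bsub>?M\<^esub> (\<lambda>z\<in>I. if z \<in> J then g z else 0)) z =
          (\<lambda>z\<in>I. if z \<in> insert y J then g z else 0) z"
        using insert.prems insert.hyps g by (cases "z = y") (auto simp: simps psum_unit_def)
    qed
    finally show ?case .
  qed
  from this[of I] have "(\<Oplus>\<^bsub>?M\<^esub>y\<in>I. act ?M (g y) (psum_unit I y)) = (\<lambda>z\<in>I. g z)"
    using I(1) by (auto simp: restrict_def)
  also have "\<dots> = g" using g by (auto simp: simps intro: extensional_restrict)
  finally show ?thesis ..
qed

lemma psum_generated: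
  fixes X :: "'r::finite pt set"
  assumes I: "finite I" "I \<subseteq> X"
  shows "generated_in_degree (V_sub X) (psum X n I :: ('k::field, 'r, 'r pt \<Rightarrow> ('k, 'r) valg) vmodule) n"
proof -
  let ?M = "psum X n I :: ('k, 'r, 'r pt \<Rightarrow> ('k, 'r) valg) vmodule"
  interpret M: graded_module "V_sub X" X ?M by (rule psum_graded_module[OF I])
  let ?S = "{act ?M a m | a m. a \<in> V_sub X \<and> m \<in> deg ?M n}"
  have S: "?S \<subseteq> carrier ?M" using M.act_closed M.deg_closed by blast
  interpret sp: submodule class_ring "M.span ?S" ?M by (rule M.span_is_submodule[OF S])
  have "g \<in> M.span ?S" if g: "g \<in> carrier ?M" for g
  proof -
    have gy: "act ?M (g y) (psum_unit I y) \<in> M.span ?S" if "y \<in> I" for y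
    proof -
      have "g y \<in> V_sub X" using g that by (simp add: psum_simps[OF I])
      then have "act ?M (g y) (psum_unit I y) \<in> ?S" using psum_unit_deg(1)[OF I that] by blast
      then show ?thesis using M.in_own_span[OF S] by blast
    qed
    have "(\<Oplus>\<^bsub>?M\<^esub>y\<in>J. act ?M (g y) (psum_unit I y)) \<in> M.span ?S" if "finite J" "J \<subseteq> I" for J
      using that
    proof (induction J)
      case (insert y J)
      then show ?case
        using gy sp.subset by (subst M.finsum_insert) auto
    qed simp
    from this[of I] show ?thesis using psum_expand[OF I g] I(1) by simp
  qed
  then show ?thesis
    unfolding generated_in_degree_def using M.span_is_subset2[OF S] by blast
qed

lemma psum_projective:
  fixes X :: "'r::finite pt set"
  assumes I: "finite I" "I \<subseteq> X"
  shows "graded_projective TYPE('n) TYPE('l) (V_sub X) X (psum X n I :: ('k::field, 'r, 'r pt \<Rightarrow> ('k, 'r) valg) vmodule)"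
  unfolding graded_projective_def
proof (intro conjI allI impI)
  let ?M = "psum X n I :: ('k, 'r, 'r pt \<Rightarrow> ('k, 'r) valg) vmodule"
  show "graded_module (V_sub X) X ?M" by (rule psum_graded_module[OF I])
  interpret M: graded_module "V_sub X" X ?M by (rule psum_graded_module[OF I])
  note simps = psum_simps[OF I]
  fix N :: "('k, 'r, 'n) vmodule" and L :: "('k, 'r, 'l) vmodule" and g h
  assume "graded_module (V_sub X) X N \<and> graded_module (V_sub X) X L \<and>
        g \<in> ghom (V_sub X) N L \<and> g ` carrier N = carrier L \<and> h \<in> ghom (V_sub X) ?M L"
  then have N: "graded_module (V_sub X) X N" and L: "graded_module (V_sub X) X L"
    and g: "g \<in> ghom (V_sub X) N L" and surj: "g ` carrier N = carrier L" and h: "h \<in> ghom (V_sub X) ?M L" by auto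
  interpret N: graded_module "V_sub X" X N by (rule N)
  interpret L: graded_module "V_sub X" X L by (rule L)
  \<comment> \<open>The generators are lifted to homogeneous elements of degree n, which makes the
    extension \<open>h'\<close> preserve degrees.\<close>
  have "\<forall>y\<in>I. \<exists>m. m \<in> deg N n \<and> g m = h (psum_unit I y)"
    using graded_surj_deg[OF N L g surj] ghomD(5)[OF h] psum_unit_deg(1)[OF I] by metis
  from bchoice[OF this] obtain u where u: "\<And>y. y \<in> I \<Longrightarrow> u y \<in> deg N n"
    "\<And>y. y \<in> I \<Longrightarrow> g (u y) = h (psum_unit I y)" by blast
  have uc: "y \<in> I \<Longrightarrow> u y \<in> carrier N" for y using u(1) by (rule N.deg_closed)
  have unit: "psum_unit I y \<in> carrier ?M" if "y \<in> I" for y by (rule psum_unit_deg(2)[OF I that])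
  have pV: "p y \<in> V_sub X" if "p \<in> carrier ?M" "y \<in> I" for p y using that by (simp add: simps)
  have auc: "act N (p y) (u y) \<in> carrier N" if "p \<in> carrier ?M" "y \<in> I" for p y
    using N.act_closed pV uc that by blast
  define h' where "h' = (\<lambda>p. \<Oplus>\<^bsub>N\<^esub>y\<in>I. act N (p y) (u y))"
  have "h' \<in> ghom (V_sub X) ?M N"
  proof (rule ghomI)
    show "h' p \<in> carrier N" if "p \<in> carrier ?M" for p
      unfolding h'_def using auc[OF that] by (intro N.finsum_closed) auto
    show "h' (p \<oplus>\<^bsub>?M\<^esub> q) = h' p \<oplus>\<^bsub>N\<^esub> h' q" if p: "p \<in> carrier ?M" and q: "q \<in> carrier ?M" for p q
    proof -
      have "h' (p \<oplus>\<^bsub>?M\<^esub> q) = (\<Oplus>\<^bsub>N\<^esub>y\<in>I. act N (p y) (u y) \<oplus>\<^bsub>N\<^esub> act N (q y) (u y))"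
        unfolding h'_def
        by (rule N.finsum_cong') (use auc[OF p] auc[OF q] pV[OF p] pV[OF q] uc in \<open>auto simp: simps N.act_add_left\<close>)
      also have "\<dots> = h' p \<oplus>\<^bsub>N\<^esub> h' q"
        unfolding h'_def using auc[OF p] auc[OF q] by (intro N.finsum_addf) auto
      finally show ?thesis .
    qed
    show "h' (c \<odot>\<^bsub>?M\<^esub> p) = c \<odot>\<^bsub>N\<^esub> h' p" if p: "p \<in> carrier ?M" for c p
    proof -
      have "c \<odot>\<^bsub>N\<^esub> h' p = (\<Oplus>\<^bsub>N\<^esub>y\<in>I. c \<odot>\<^bsub>N\<^esub> act N (p y) (u y))"
        unfolding h'_def using auc[OF p] I(1) by (intro N.finsum_smult_ldistr) auto
      also have "\<dots> = h' (c \<odot>\<^bsub>?M\<^esub> p)"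
        unfolding h'_def
        by (rule N.finsum_cong') (use auc[OF p] pV[OF p] uc in
            \<open>auto simp: simps N.act_scale_left N.act_closed V_sub_scale simp flip: N.act_scale_left\<close>)
      finally show ?thesis ..
    qed
    show "h' (act ?M a p) = act N a (h' p)" if a: "a \<in> V_sub X" and p: "p \<in> carrier ?M" for a p
    proof -
      have "act N a (h' p) = (\<Oplus>\<^bsub>N\<^esub>y\<in>I. act N a (act N (p y) (u y)))"
        unfolding h'_def
        by (rule additive_finsum[OF N.abelian_group_axioms N.abelian_group_axioms])
          (use auc[OF p] a I(1) in \<open>auto simp: N.act_closed N.act_add_right\<close>)
      also have "\<dots> = h' (act ?M a p)"
        unfolding h'_def
        by (rule N.finsum_cong') (use a pV[OF p] uc in \<open>auto simp: simps N.act_mult N.act_closed V_sub_mult\<close>)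
      finally show ?thesis ..
    qed
    show "h' p \<in> deg N k" if p: "p \<in> deg ?M k" for k p
      unfolding h'_def
    proof (rule N.finsum_deg[OF I(1)])
      fix y assume y: "y \<in> I"
      then have "p y \<in> V_sub X" "p y \<in> vdeg (k - n)" using p by (auto simp: simps)
      from N.act_deg[OF this u(1)[OF y]] show "act N (p y) (u y) \<in> deg N k" by simp
    qed
  qed
  moreover have "g (h' p) = h p" if p: "p \<in> carrier ?M" for p
  proof -
    have "g (h' p) = (\<Oplus>\<^bsub>L\<^esub>y\<in>I. g (act N (p y) (u y)))"
      unfolding h'_def
      by (rule additive_finsum[OF N.abelian_group_axioms L.abelian_group_axioms])
        (use auc[OF p] I(1) ghomD[OF g] in auto)
    also have "\<dots> = (\<Oplus>\<^bsub>L\<^esub>y\<in>I. h (act ?M (p y) (psum_unit I y)))"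
      by (rule L.finsum_cong')
        (use pV[OF p] uc u(2) unit ghomD(1,4)[OF g] ghomD(1,4)[OF h] L.act_closed in auto)
    also have "\<dots> = h (\<Oplus>\<^bsub>?M\<^esub>y\<in>I. act ?M (p y) (psum_unit I y))"
      by (rule additive_finsum[OF M.abelian_group_axioms L.abelian_group_axioms, symmetric])
        (use pV[OF p] unit ghomD(1,2)[OF h] M.act_closed I(1) in auto)
    also have "\<dots> = h p" using psum_expand[OF I p] by simp
    finally show ?thesis .
  qed
  ultimately show "\<exists>h'\<in>ghom (V_sub X) ?M N. \<forall>p\<in>carrier ?M. g (h' p) = h p" by blast
qed

section \<open>The Koszul complex over V_X as a resolution\<close>

section \<open>The linear resolution\<close>

text \<open>The corner from which the arrows c_j with j in \<open>T\<close> lead back to x;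
  subtracting their steps gives the signs in \<open>F_set i\<close>. Subsets \<open>T\<close>
  avoiding i thus index the corners of \<lambda> x, and \<open>kdir\<close> recovers
  \<open>T\<close>.\<close>

definition kvert :: "'r::linorder \<Rightarrow> 'r pt \<Rightarrow> 'r set \<Rightarrow> 'r pt" where
  "kvert i x T = (\<lambda>j. if j \<in> T then x j - arrow_step (karrow i j) j else x j)"

definition kdir :: "'r pt \<Rightarrow> 'r pt \<Rightarrow> 'r set" where
  "kdir x y = {j. y j \<noteq> x j}"

lemma arrow_step_karrow: "arrow_step (karrow i j) l = (if l = j then if j < i then -1 else 1 else 0)"
  by (auto simp: karrow_def unit_pt_def)

lemma kdir_kvert [simp]: "kdir x (kvert i x T) = T"
  by (auto simp: kdir_def kvert_def arrow_step_karrow)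

lemma kvert_empty [simp]: "kvert i x {} = x"
  by (simp add: kvert_def)

lemma kvert_insert: "j \<notin> T \<Longrightarrow> kvert i x T - arrow_step (karrow i j) = kvert i x (insert j T)"
  by (rule ext) (auto simp: kvert_def arrow_step_karrow)

lemma dist_kvert: "dist_pt x (kvert i x T) = card T"
proof -
  have "(\<Sum>j\<in>UNIV. \<bar>x j - kvert i x T j\<bar>) = (\<Sum>j\<in>UNIV. if j \<in> T then 1 else 0)"
    by (intro sum.cong) (auto simp: kvert_def arrow_step_karrow)
  then show ?thesis by (simp add: dist_pt_def sum.If_cases)
qed

lemma lambda_set_kvert:
  fixes x :: "'r::{finite, linorder} pt"
  shows "y \<in> lambda_set X x \<longleftrightarrow> (\<exists>T \<subseteq> - {cub_index X x}. y = kvert (cub_index X x) x T)"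
proof
  assume y: "y \<in> lambda_set X x"
  have "y = kvert (cub_index X x) x (kdir x y)"
  proof
    fix j
    show "y j = kvert (cub_index X x) x (kdir x y) j"
      using y unfolding mem_lambda_set kvert_def kdir_def arrow_step_karrow
      by (cases j "cub_index X x" rule: linorder_cases) force+
  qed
  moreover have "kdir x y \<subseteq> - {cub_index X x}" using y by (auto simp: mem_lambda_set kdir_def)
  ultimately show "\<exists>T \<subseteq> - {cub_index X x}. y = kvert (cub_index X x) x T" by blast
next
  assume "\<exists>T \<subseteq> - {cub_index X x}. y = kvert (cub_index X x) x T"
  then obtain T where T: "cub_index X x \<notin> T" "y = kvert (cub_index X x) x T" by blast
  show "y \<in> lambda_set X x"
    unfolding mem_lambda_set T(2) kvert_def arrow_step_karrow
    using T(1) by (simp add: less_imp_not_less)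
qed

definition kface :: "'r::{finite, linorder} pt set \<Rightarrow> 'r pt \<Rightarrow> nat \<Rightarrow> 'r pt set" where
  "kface X x n = {y \<in> lambda_set X x. dist_pt x y = n}"

text \<open>The signed Koszul differential: entries at the neighbouring corners one step farther
  from x are multiplied on the right by the arrow c_j leading to y.\<close>

definition kmap :: "'r::{finite, linorder} pt set \<Rightarrow> 'r pt \<Rightarrow> nat \<Rightarrow> ('r pt \<Rightarrow> ('k::field, 'r) valg) \<Rightarrow>
    'r pt \<Rightarrow> ('k, 'r) valg" where
  "kmap X x n g = (\<lambda>y\<in>kface X x n. \<Sum>j\<in>- {cub_index X x} - kdir x y.
     vscale (ksgn j (kdir x y)) (g (y - arrow_step (karrow (cub_index X x) j)) *
       vpath (y - arrow_step (karrow (cub_index X x) j), [karrow (cub_index X x) j])))"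

text \<open>Translates a family indexed by corners into the coefficient functions on which
  \<open>kdiff\<close> and \<open>khom\<close> operate.\<close>

definition kcoeff :: "'r::{finite, linorder} \<Rightarrow> 'r pt \<Rightarrow> ('r pt \<Rightarrow> ('k::field, 'r) valg) \<Rightarrow>
    'r set \<Rightarrow> 'r arrow multiset \<Rightarrow> 'k" where
  "kcoeff i x g T m = lookup (co i (kvert i x T) (g (kvert i x T))) m"

locale cubist_vertex =
  fixes X :: "'r::{finite, linorder} pt set" and x :: "'r pt"
  assumes cubist: "cubist X" and x: "x \<in> X"
begin

abbreviation "i \<equiv> cub_index X x"
abbreviation "J \<equiv> - {i}"
abbreviation "F \<equiv> kface X x"
abbreviation "v \<equiv> kvert i x"
abbreviation "c \<equiv> karrow i"
abbreviation "P n \<equiv> psum X (int n) (F n)"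

lemma mem_face: "y \<in> F n \<longleftrightarrow> (\<exists>T\<subseteq>J. card T = n \<and> y = v T)"
  unfolding kface_def mem_Collect_eq lambda_set_kvert by (auto simp: dist_kvert)

lemma vert_face: "T \<subseteq> J \<Longrightarrow> v T \<in> F (card T)"
  by (auto simp: mem_face)

lemma finite_face: "finite (F n)"
proof -
  have "F n \<subseteq> v ` Pow J" by (auto simp: mem_face)
  then show ?thesis by (rule finite_subset) auto
qed

lemma face_subset: "F n \<subseteq> X"
  using lambda_set_subset[OF cubist x] by (auto simp: kface_def)

lemmas psimps = psum_simps[OF finite_face face_subset]

lemma face_0: "F 0 = {x}"
proof -
  have "T = {}" if "card T = 0" for T :: "'r set" using that by simp
  then show ?thesis by (auto simp: mem_face intro!: exI[of _ "{}"])
qed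

lemma vert_step:
  assumes "T \<subseteq> J" "j \<in> J - T"
  shows "v T - arrow_step (c j) = v (insert j T)" "v (insert j T) \<in> F (Suc (card T))"
  using assms kvert_insert[of j T i x] vert_face[of "insert j T"] by auto

lemma face_step:
  assumes "y \<in> F n" "j \<in> J - kdir x y"
  shows "y - arrow_step (c j) \<in> F (Suc n)"
  using assms vert_step by (auto simp: mem_face)

lemma varrow_face:
  assumes "y \<in> F n" "j \<in> J - kdir x y"
  shows "vpath (y - arrow_step (c j), [c j]) \<in> V_sub X"
  using assms face_step[OF assms] face_subset by (intro varrow_V_sub) auto

text \<open>Every summand of \<open>kmap\<close> is a right multiplication by some c_j, hence a
  shift of coordinates by \<open>lookup_co_mult_arrow\<close>.\<close>

lemma kcoeff_kmap:
  assumes T: "T \<subseteq> J"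
  shows "kcoeff i x (kmap X x (card T) g) T m = kdiff c J (kcoeff i x g) T m"
proof -
  have "kcoeff i x (kmap X x (card T) g) T m = (\<Sum>j\<in>J - T.
      ksgn j T * lookup (co i (v T) (g (v T - arrow_step (c j)) * vpath (v T - arrow_step (c j), [c j]))) m)"
    using vert_face[OF T] by (simp add: kcoeff_def kmap_def co_sum co_scale lookup_sum)
  also have "\<dots> = kdiff c J (kcoeff i x g) T m"
    unfolding kdiff_def
  proof (intro sum.cong refl)
    fix j assume j: "j \<in> J - T"
    then show "ksgn j T * lookup (co i (v T) (g (v T - arrow_step (c j)) * vpath (v T - arrow_step (c j), [c j]))) m =
        (if c j \<in># m then ksgn j T * kcoeff i x g (insert j T) (m - {#c j#}) else 0)"
      by (subst lookup_co_mult_arrow) (auto simp: karrow_neq kcoeff_def vert_step(1)[OF T j])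
  qed
  finally show ?thesis .
qed

lemma kcoeff_eqI:
  assumes "g \<in> carrier (P n)" "h \<in> carrier (P n)"
    and "\<And>T m. T \<subseteq> J \<Longrightarrow> card T = n \<Longrightarrow> kcoeff i x g T m = kcoeff i x h T m"
  shows "g = h"
proof
  fix y show "g y = h y"
  proof (cases "y \<in> F n")
    case True
    then obtain T where T: "T \<subseteq> J" "card T = n" "y = v T" by (auto simp: mem_face)
    have "co i y (g y) = co i y (h y)"
      using assms(3)[OF T(1,2)] by (intro poly_mapping_eqI) (simp add: kcoeff_def T(3))
    then have "Psi y (co i y (g y)) = Psi y (co i y (h y))" by simp
    then show ?thesis using assms(1,2) True by (simp add: Psi_co psimps)
  next
    case False
    then show ?thesis using assms(1,2) by (simp add: psimps extensional_def)
  qed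
qed

lemma kmap_closed:
  assumes g: "g \<in> carrier (P (Suc n))"
  shows "kmap X x n g \<in> carrier (P n)"
proof -
  have "g (y - arrow_step (c j)) * vpath (y - arrow_step (c j), [c j]) \<in> V_sub X"
    if "y \<in> F n" "j \<in> J - kdir x y" for y j
    using g face_step[OF that] varrow_face[OF that] by (intro V_sub_mult) (auto simp: psimps)
  then show ?thesis
    by (auto simp: psimps kmap_def sum_distrib_right vscale_mult_left mult.assoc varrow_mult_videm
        intro!: V_sub_sum V_sub_scale)
qed

lemma kmap_hom: "kmap X x n \<in> ghom (V_sub X) (P (Suc n)) (P n)"
proof (rule ghomI)
  show "kmap X x n g \<in> carrier (P n)" if "g \<in> carrier (P (Suc n))" for g
    by (rule kmap_closed[OF that])
  show "kmap X x n (g \<oplus>\<^bsub>P (Suc n)\<^esub> h) = kmap X x n g \<oplus>\<^bsub>P n\<^esub> kmap X x n h" for g h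
  proof
    fix y
    show "(kmap X x n (g \<oplus>\<^bsub>P (Suc n)\<^esub> h)) y = (kmap X x n g \<oplus>\<^bsub>P n\<^esub> kmap X x n h) y"
    proof (cases "y \<in> F n")
      case True
      then have st: "y - arrow_step (c j) \<in> F (Suc n)" if "j \<in> J - kdir x y" for j
        using that by (rule face_step)
      show ?thesis
        by (simp add: psimps kmap_def True flip: sum.distrib, intro sum.cong refl)
          (simp add: st distrib_right V.scale_right_distrib)
    qed (simp add: psimps kmap_def)
  qed
  show "kmap X x n (d \<odot>\<^bsub>P (Suc n)\<^esub> g) = d \<odot>\<^bsub>P n\<^esub> kmap X x n g" for d g
  proof
    fix y
    show "(kmap X x n (d \<odot>\<^bsub>P (Suc n)\<^esub> g)) y = (d \<odot>\<^bsub>P n\<^esub> kmap X x n g) y"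
    proof (cases "y \<in> F n")
      case True
      then have st: "y - arrow_step (c j) \<in> F (Suc n)" if "j \<in> J - kdir x y" for j
        using that by (rule face_step)
      show ?thesis
        by (simp add: psimps kmap_def True V.scale_sum_right, intro sum.cong refl)
          (simp add: st vscale_mult_left mult.commute)
    qed (simp add: psimps kmap_def)
  qed
  show "kmap X x n (act (P (Suc n)) a g) = act (P n) a (kmap X x n g)" for a g
  proof
    fix y
    show "(kmap X x n (act (P (Suc n)) a g)) y = (act (P n) a (kmap X x n g)) y"
    proof (cases "y \<in> F n")
      case True
      then have st: "y - arrow_step (c j) \<in> F (Suc n)" if "j \<in> J - kdir x y" for j
        using that by (rule face_step)
      show ?thesis
        by (simp add: psimps kmap_def True sum_distrib_left, intro sum.cong refl)
          (simp add: st vscale_mult_right mult.assoc)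
    qed (simp add: psimps kmap_def)
  qed
  show "kmap X x n g \<in> deg (P n) k" if g: "g \<in> deg (P (Suc n)) k" for g k
  proof -
    have "g \<in> carrier (P (Suc n))" using g by (simp add: psimps)
    from kmap_closed[OF this] have cl: "kmap X x n g \<in> carrier (P n)" .
    have "g (y - arrow_step (c j)) * vpath (y - arrow_step (c j), [c j]) \<in> vdeg (k - int n)"
      if "y \<in> F n" "j \<in> J - kdir x y" for y j
    proof -
      have "g (y - arrow_step (c j)) \<in> vdeg (k - int (Suc n))" using g face_step[OF that] by (simp add: psimps)
      moreover have "vpath (y - arrow_step (c j), [c j]) \<in> vdeg 1"
        using bas_vdeg[of y "{#c j#}"] by (simp add: vpath_eq_bas)
      ultimately show ?thesis using vdeg_mult by fastforce
    qed
    then have "kmap X x n g y \<in> vdeg (k - int n)" if "y \<in> F n" for y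
      using that by (auto simp: kmap_def intro!: vdeg_sum vdeg_scale)
    then show ?thesis using cl by (simp add: psimps)
  qed
qed

lemma kmap_kmap:
  assumes g: "g \<in> carrier (P (Suc (Suc n)))"
  shows "kmap X x n (kmap X x (Suc n) g) = zero (P n)"
proof (rule kcoeff_eqI)
  show "kmap X x n (kmap X x (Suc n) g) \<in> carrier (P n)" by (intro kmap_closed g)
  show "zero (P n) \<in> carrier (P n)" by (simp add: psimps)
  fix T m assume T: "T \<subseteq> J" "card T = n"
  have "kcoeff i x (kmap X x n (kmap X x (Suc n) g)) T m = kdiff c J (kcoeff i x (kmap X x (Suc n) g)) T m"
    using kcoeff_kmap[OF T(1)] T(2) by simp
  also have "\<dots> = kdiff c J (kdiff c J (kcoeff i x g)) T m"
    unfolding kdiff_def[of c J _ T]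
  proof (intro sum.cong refl)
    fix j assume j: "j \<in> J - T"
    then have "card (insert j T) = Suc n" "insert j T \<subseteq> J" using T finite_subset[OF T(1)] by auto
    then show "(if c j \<in># m then ksgn j T * kcoeff i x (kmap X x (Suc n) g) (insert j T) (m - {#c j#}) else 0) =
      (if c j \<in># m then ksgn j T * kdiff c J (kcoeff i x g) (insert j T) (m - {#c j#}) else 0)"
      using kcoeff_kmap[of "insert j T" g] by simp
  qed
  also have "\<dots> = 0" by (rule kdiff_kdiff) (use T inj_karrow in auto)
  finally show "kcoeff i x (kmap X x n (kmap X x (Suc n) g)) T m = kcoeff i x (zero (P n)) T m"
    using vert_face[OF T(1)] T(2) by (simp add: kcoeff_def psimps)
qed

text \<open>Turns the combinatorial contraction into an actual preimage: the contracted coefficients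
  must have finite support, sit on normal monomials and have sources in \<open>X\<close>.\<close>

lemma kmap_lift:
  fixes g :: "'r pt \<Rightarrow> ('k::field, 'r) valg"
  assumes g: "g \<in> carrier (P n)"
    and eq: "\<And>T m. T \<subseteq> J \<Longrightarrow> card T = n \<Longrightarrow> kdiff c J (khom c J (kcoeff i x g)) T m = kcoeff i x g T m"
  shows "\<exists>h\<in>carrier (P (Suc n)). kmap X x n h = g"
proof -
  let ?G = "kcoeff i x g"
  define q where "q = (\<lambda>T. Abs_poly_mapping (khom c J ?G T))"
  have supp: "\<exists>j\<in>T. add_mset (c j) m \<in> keys (co i (v (T - {j})) (g (v (T - {j}))))"
    if "khom c J ?G T m \<noteq> 0" for T m
    using that by (auto simp: khom_def Let_def kcoeff_def in_keys_iff split: if_splits)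
  have "finite {m. khom c J ?G T m \<noteq> 0}" for T
  proof (rule finite_subset)
    show "{m. khom c J ?G T m \<noteq> 0} \<subseteq>
      (\<Union>j\<in>T. (\<lambda>m. m - {#c j#}) ` keys (co i (v (T - {j})) (g (v (T - {j})))))"
    proof
      fix m assume "m \<in> {m. khom c J ?G T m \<noteq> 0}"
      then obtain j where "j \<in> T" "add_mset (c j) m \<in> keys (co i (v (T - {j})) (g (v (T - {j}))))"
        using supp by blast
      then show "m \<in> (\<Union>j\<in>T. (\<lambda>m. m - {#c j#}) ` keys (co i (v (T - {j})) (g (v (T - {j})))))"
        by (intro UN_I[of j] image_eqI[of _ _ "add_mset (c j) m"]) auto
    qed
  qed auto
  then have q: "lookup (q T) m = khom c J ?G T m" for T m
    by (simp add: q_def lookup_Abs_poly_mapping)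
  have qkeys: "keys (q T) \<subseteq> {m. nf i m \<and> v T - wt m \<in> X}" if T: "T \<subseteq> J" "card T = Suc n" for T
  proof
    fix m assume "m \<in> keys (q T)"
    then have "khom c J ?G T m \<noteq> 0" by (simp add: in_keys_iff q)
    from supp[OF this] obtain j where j: "j \<in> T"
      "add_mset (c j) m \<in> keys (co i (v (T - {j})) (g (v (T - {j}))))" by blast
    have fT: "finite T" using T by (simp add: finite_subset)
    have "nf i (add_mset (c j) m)" using j(2) co_nf by blast
    then have 1: "nf i m" by (auto simp: nf_def)
    have "card (T - {j}) = n" using j(1) T(2) fT by simp
    then have vF: "v (T - {j}) \<in> F n" using vert_face[of "T - {j}"] T by auto
    then have "g (v (T - {j})) \<in> V_sub X" using g by (simp add: psimps)
    from V_sub_source[OF this, of i "v (T - {j})"] j(2) have "v (T - {j}) - wt (add_mset (c j) m) \<in> X" by blast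
    \<comment> \<open>The contraction keeps the source of the path: the step of c_j passes from the
      monomial to the vertex.\<close>
    moreover have "v (T - {j}) - wt (add_mset (c j) m) = v T - wt m"
      using kvert_insert[of j "T - {j}" i x] j(1) by (simp add: insert_absorb flip: diff_diff_eq)
    ultimately have "v T - wt m \<in> X" by (simp only:)
    then show "m \<in> {m. nf i m \<and> v T - wt m \<in> X}" using 1 by simp
  qed
  define h where "h = (\<lambda>y\<in>F (Suc n). Psi y (q (kdir x y)))"
  have "Psi y (q (kdir x y)) \<in> V_sub X" if y: "y \<in> F (Suc n)" for y
  proof -
    obtain T where T: "T \<subseteq> J" "card T = Suc n" "y = v T" using y by (auto simp: mem_face)
    show ?thesis
      by (rule Psi_V_sub) (use y face_subset qkeys[OF T(1,2)] T(3) in auto)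
  qed
  then have h: "h \<in> carrier (P (Suc n))" by (auto simp: psimps h_def Psi_mult_videm)
  have kh: "kcoeff i x h T m = khom c J ?G T m" if T: "T \<subseteq> J" "card T = Suc n" for T m
  proof -
    have "h (v T) = Psi (v T) (q T)" using vert_face[OF T(1)] T(2) by (simp add: h_def)
    moreover have "co i (v T) (Psi (v T) (q T)) = q T" by (rule co_Psi) (use qkeys[OF T] in auto)
    ultimately show ?thesis by (simp add: kcoeff_def q)
  qed
  have "kmap X x n h = g"
  proof (rule kcoeff_eqI[OF kmap_closed[OF h] g])
    fix T m assume T: "T \<subseteq> J" "card T = n"
    have "kcoeff i x (kmap X x n h) T m = kdiff c J (kcoeff i x h) T m"
      using kcoeff_kmap[OF T(1)] T(2) by simp
    also have "\<dots> = kdiff c J (khom c J ?G) T m"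
      unfolding kdiff_def
    proof (intro sum.cong refl)
      fix j assume "j \<in> J - T"
      then have "card (insert j T) = Suc n" "insert j T \<subseteq> J" using T finite_subset[OF T(1)] by auto
      then show "(if c j \<in># m then ksgn j T * kcoeff i x h (insert j T) (m - {#c j#}) else 0) =
        (if c j \<in># m then ksgn j T * khom c J ?G (insert j T) (m - {#c j#}) else 0)"
        by (simp add: kh)
    qed
    also have "\<dots> = ?G T m" by (rule eq[OF T])
    finally show "kcoeff i x (kmap X x n h) T m = ?G T m" .
  qed
  then show ?thesis using h by blast
qed

text \<open>In positive homological degree the support contains the nonempty face itself, so the
  contraction is available for every monomial.\<close>

lemma kmap_exact:
  "kmap X x (Suc n) ` carrier (P (Suc (Suc n))) =
     a_kernel (P (Suc n)) (P n :: ('k::field, 'r, 'r pt \<Rightarrow> ('k, 'r) valg) vmodule) (kmap X x n)"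
proof (intro equalityI subsetI)
  fix g assume "g \<in> kmap X x (Suc n) ` carrier (P (Suc (Suc n)))"
  then obtain h where h: "h \<in> carrier (P (Suc (Suc n)))" "g = kmap X x (Suc n) h" by blast
  show "g \<in> a_kernel (P (Suc n)) (P n) (kmap X x n)"
    unfolding a_kernel_def' h(2) by (intro CollectI conjI kmap_closed kmap_kmap h(1))
next
  fix g :: "'r pt \<Rightarrow> ('k, 'r) valg" assume "g \<in> a_kernel (P (Suc n)) (P n) (kmap X x n)"
  then have g: "g \<in> carrier (P (Suc n))" and 0: "kmap X x n g = zero (P n)"
    unfolding a_kernel_def' by blast+
  have "\<exists>h\<in>carrier (P (Suc (Suc n))). kmap X x (Suc n) h = g"
  proof (rule kmap_lift[OF g])
    fix T m assume T: "T \<subseteq> J" "card T = Suc n"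
    have fT: "finite T" using T by (simp add: finite_subset)
    \<comment> \<open>The contraction evaluates the differential only at faces with one element
      removed, where its values are coordinates of \<open>kmap X x n g\<close>, which is
      zero.\<close>
    have "kdiff c J (kcoeff i x g) (T - {j}) l = 0" if "j \<in> T" for j l
    proof -
      have T': "T - {j} \<subseteq> J" "card (T - {j}) = n" using T fT that by auto
      have "kdiff c J (kcoeff i x g) (T - {j}) l = kcoeff i x (zero (P n)) (T - {j}) l"
        using kcoeff_kmap[OF T'(1), of g l] by (simp only: T'(2) 0)
      also have "\<dots> = 0" using vert_face[OF T'(1)] T'(2) by (simp add: kcoeff_def psimps)
      finally show ?thesis .
    qed
    then have "khom c J (kdiff c J (kcoeff i x g)) T m = 0" by (simp add: khom_def Let_def)
    moreover have "kdiff c J (khom c J (kcoeff i x g)) T m + khom c J (kdiff c J (kcoeff i x g)) T m = kcoeff i x g T m"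
      by (rule kdiff_khom) (use T inj_karrow in \<open>auto simp: ksupp_def\<close>)
    ultimately show "kdiff c J (khom c J (kcoeff i x g)) T m = kcoeff i x g T m" by simp
  qed
  then show "g \<in> kmap X x (Suc n) ` carrier (P (Suc (Suc n)))" by blast
qed

text \<open>At the empty face the support can be empty. The normal monomials with this property form
  \<open>dmon i\<close>, and their coefficients, read off by \<open>dproj\<close>, are the only
  obstruction to lifting.\<close>

lemma kmap_0_image:
  "kmap X x 0 ` carrier (P 1) =
     {g \<in> carrier (P 0 :: ('k::field, 'r, 'r pt \<Rightarrow> ('k, 'r) valg) vmodule). dproj i x (g x) = 0}"
proof (intro equalityI subsetI)
  fix g assume "g \<in> kmap X x 0 ` carrier (P 1)"
  then obtain h where h: "h \<in> carrier (P (Suc 0))" "g = kmap X x 0 h" by auto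
  have "lookup (dproj i x (g x)) m = 0" for m
  proof -
    have "kcoeff i x g {} m = kdiff c J (kcoeff i x h) {} m"
      using kcoeff_kmap[of "{}" h m] by (simp add: h(2))
    moreover have "kdiff c J (kcoeff i x h) {} m = 0" if "m \<in> dmon i"
      unfolding kdiff_def by (rule sum.neutral) (use that in \<open>auto simp: dmon_def\<close>)
    ultimately show ?thesis by (simp add: dproj_def kcoeff_def)
  qed
  then have "dproj i x (g x) = 0" by (intro poly_mapping_eqI) simp
  then show "g \<in> {g \<in> carrier (P 0). dproj i x (g x) = 0}" using kmap_closed[OF h(1)] h(2) by simp
next
  fix g :: "'r pt \<Rightarrow> ('k, 'r) valg" assume "g \<in> {g \<in> carrier (P 0). dproj i x (g x) = 0}"
  then have g: "g \<in> carrier (P 0)" and 0: "dproj i x (g x) = 0" by auto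
  have "\<exists>h\<in>carrier (P (Suc 0)). kmap X x 0 h = g"
  proof (rule kmap_lift[OF g])
    fix T m assume T: "T \<subseteq> J" "card T = 0"
    then have T0: "T = {}" by (simp add: finite_subset)
    show "kdiff c J (khom c J (kcoeff i x g)) T m = kcoeff i x g T m"
    proof (cases "ksupp c J {} m = {}")
      case True
      then have cj: "c j \<notin># m" if "j \<in> J" for j using that by (auto simp: ksupp_def)
      have "kcoeff i x g {} m = 0"
      proof (cases "nf i m")
        case True
        then have "m \<in> dmon i" using cj by (auto simp: dmon_def)
        moreover have "lookup (dproj i x (g x)) m = 0" using 0 by simp
        ultimately show ?thesis by (simp add: dproj_def kcoeff_def)
      next
        case False
        then have "m \<notin> keys (co i x (g x))" using co_nf[of i x "g x"] by blast
        then show ?thesis by (simp add: kcoeff_def in_keys_iff)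
      qed
      moreover have "kdiff c J (khom c J (kcoeff i x g)) {} m = 0"
        unfolding kdiff_def by (rule sum.neutral) (use cj in auto)
      ultimately show ?thesis by (simp add: T0)
    next
      case False
      have "khom c J (kdiff c J (kcoeff i x g)) {} m = 0" by (simp add: khom_def Let_def)
      moreover have "kdiff c J (khom c J (kcoeff i x g)) {} m + khom c J (kdiff c J (kcoeff i x g)) {} m = kcoeff i x g {} m"
        by (rule kdiff_khom) (use False inj_karrow in auto)
      ultimately show ?thesis by (simp add: T0)
    qed
  qed
  then show "g \<in> kmap X x 0 ` carrier (P 1)" by auto
qed

text \<open>The coset of \<open>g x\<close>, written as a fibre of \<open>dproj\<close> in agreement
  with the isomorphism obtained from \<open>quotient_iso\<close>.\<close>

definition aug :: "('r pt \<Rightarrow> ('k::field, 'r) valg) \<Rightarrow> ('k, 'r) valg set" where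
  "aug g = {u \<in> carrier (proj_module X x). dproj i x u = dproj i x (g x)}"

lemma aug_facts:
  fixes S :: "('k::field, 'r, ('k, 'r) valg set) vmodule"
  assumes S: "S = std_module X x"
  shows "aug \<in> ghom (V_sub X) (P 0 :: ('k, 'r, 'r pt \<Rightarrow> ('k, 'r) valg) vmodule) S"
    and "aug ` carrier (P 0 :: ('k, 'r, 'r pt \<Rightarrow> ('k, 'r) valg) vmodule) = carrier S"
    and "a_kernel (P 0) S aug = {g \<in> carrier (P 0 :: ('k, 'r, 'r pt \<Rightarrow> ('k, 'r) valg) vmodule). dproj i x (g x) = 0}"
proof -
  let ?P = "P 0 :: ('k, 'r, 'r pt \<Rightarrow> ('k, 'r) valg) vmodule"
  let ?D = "delta_module X i x :: ('k, 'r, 'r arrow multiset \<Rightarrow>\<^sub>0 'k) vmodule"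
  define f where "f = (\<lambda>p :: 'r arrow multiset \<Rightarrow>\<^sub>0 'k. {u \<in> carrier (proj_module X x). dproj i x u = p})"
  have "graded_iso (V_sub X) f ?D S"
    unfolding f_def S by (rule std_graded_iso[OF cubist x])
  then have bij: "bij_betw f (carrier ?D) (carrier S)"
    and fadd: "\<And>p q. p \<in> carrier ?D \<Longrightarrow> q \<in> carrier ?D \<Longrightarrow> f (p + q) = f p \<oplus>\<^bsub>S\<^esub> f q"
    and fscale: "\<And>b p. p \<in> carrier ?D \<Longrightarrow> f (pm_scale b p) = b \<odot>\<^bsub>S\<^esub> f p"
    and fzero: "f 0 = \<zero>\<^bsub>S\<^esub>"
    and fact: "\<And>a p. a \<in> V_sub X \<Longrightarrow> p \<in> carrier ?D \<Longrightarrow> f (dproj i x (a * Psi x p)) = act S a (f p)"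
    and fdeg: "\<And>n. deg S n = f ` deg ?D n"
    unfolding graded_iso_def by (simp_all del: delta_module_simps(1,6))
  have aug: "aug g = f (dproj i x (g x))" for g by (simp add: aug_def f_def)
  have xF: "x \<in> F 0" by (simp add: face_0)
  have D: "dproj i x (g x) \<in> carrier ?D" if "g \<in> carrier ?P" for g
    using that dproj_V_sub[of "g x" X i x] by (simp add: psimps xF)
  have fc: "f p \<in> carrier S" if "p \<in> carrier ?D" for p using bij that by (auto dest: bij_betwE)
  show "aug \<in> ghom (V_sub X) ?P S"
  proof (rule ghomI)
    show "aug g \<in> carrier S" if "g \<in> carrier ?P" for g unfolding aug by (intro fc D that)
    show "aug (g \<oplus>\<^bsub>?P\<^esub> h) = aug g \<oplus>\<^bsub>S\<^esub> aug h" if "g \<in> carrier ?P" "h \<in> carrier ?P" for g h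
      unfolding aug fadd[OF D[OF that(1)] D[OF that(2)], symmetric]
      by (simp add: psimps(3) xF dproj_add)
    show "aug (b \<odot>\<^bsub>?P\<^esub> g) = b \<odot>\<^bsub>S\<^esub> aug g" if "g \<in> carrier ?P" for b g
      unfolding aug fscale[OF D[OF that], symmetric] by (simp add: psimps(4) xF dproj_scale)
    show "aug (act ?P a g) = act S a (aug g)" if "a \<in> V_sub X" "g \<in> carrier ?P" for a g
      unfolding aug fact[OF that(1) D[OF that(2)], symmetric]
      by (simp add: psimps(5) xF dproj_mult_dproj)
    show "aug g \<in> deg S n" if g: "g \<in> deg ?P n" for g n
    proof -
      have "g \<in> carrier ?P" "g x \<in> vdeg n" using g by (auto simp: psimps xF)
      then have "dproj i x (g x) \<in> deg ?D n"
        using D[of g] co_vdeg[of "g x" n i x] by (auto simp: dproj_def)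
      then show ?thesis unfolding aug fdeg by (rule imageI)
    qed
  qed
  show "aug ` carrier ?P = carrier S"
  proof (intro equalityI subsetI)
    fix s assume "s \<in> carrier S"
    then have "s \<in> f ` carrier ?D" using bij by (simp only: bij_betw_def)
    then obtain p where p: "p \<in> carrier ?D" "s = f p" by blast
    define g where "g = (\<lambda>y\<in>F 0. Psi x p)"
    have "Psi x p \<in> V_sub X" by (rule Psi_V_sub[OF x]) (use p(1) in auto)
    moreover have "y = x" if "y \<in> F 0" for y using that by (simp add: face_0)
    ultimately have "g \<in> carrier ?P" by (auto simp: psimps g_def Psi_mult_videm)
    moreover have "dproj i x (g x) = p" using p(1) by (auto simp: g_def xF intro!: dproj_Psi)
    ultimately show "s \<in> aug ` carrier ?P" unfolding p(2) by (intro image_eqI[of _ _ g]) (simp_all add: aug)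
  qed (auto simp: aug intro!: fc D)
  have "aug g = \<zero>\<^bsub>S\<^esub> \<longleftrightarrow> dproj i x (g x) = 0" if "g \<in> carrier ?P" for g
  proof -
    have "0 \<in> carrier ?D" by simp
    then show ?thesis
      unfolding aug fzero[symmetric] using bij D[OF that] by (auto simp: bij_betw_def inj_on_eq_iff)
  qed
  then show "a_kernel ?P S aug = {g \<in> carrier ?P. dproj i x (g x) = 0}"
    by (auto simp: a_kernel_def')
qed

lemma resolution:
  "linear_projective_resolution TYPE('n) TYPE('l) (V_sub X :: ('k::field, 'r) valg set) X P (kmap X x) aug
     (std_module X x)"
  unfolding linear_projective_resolution_def
proof (intro conjI allI)
  show "graded_module (V_sub X) X (std_module X x :: ('k, 'r, ('k, 'r) valg set) vmodule)"
    using graded_basis.graded_module[OF graded_basis.transport_iso[OF delta_graded_basis[OF x]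
          std_graded_iso[OF cubist x] unital_subalgebra_V_sub]] .
  show "kmap X x 0 ` carrier (P (Suc 0)) =
      a_kernel (P 0) (std_module X x) (aug :: ('r pt \<Rightarrow> ('k, 'r) valg) \<Rightarrow> _)"
    unfolding aug_facts(3)[OF refl] One_nat_def[symmetric] by (rule kmap_0_image)
qed (intro psum_projective psum_generated finite_face face_subset kmap_hom kmap_exact
    aug_facts(1)[OF refl] aug_facts(2)[OF refl])+

end

theorem lemma39:
  fixes X :: "('r::{finite, linorder} \<Rightarrow> int) set" and x :: "'r \<Rightarrow> int"
  assumes "cubist X" and "x \<in> X"
  shows
    "(\<exists>d e. linear_projective_resolution TYPE('n) TYPE('l)
        (V_sub X :: ('k::field, 'r) valg set) X
        (\<lambda>n. gsum {y \<in> lambda_set X x. dist_pt x y = n}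
               (\<lambda>y. gshift (int n) (proj_module X y)))
        d e (std_module X x))
     \<and> gmod_iso (V_sub X :: ('k, 'r) valg set) X (std_module X x)
         (restrict_module X (V_std_module (cub_index X x) x))
     \<and> (\<forall>u\<in>X. \<forall>y\<in>X.
          has_gdim (std_module X u :: ('k, 'r, ('k, 'r) valg set) vmodule) y \<and>
          std_matrix TYPE('k) X u y = tilde_matrix X u y)"
proof (intro conjI ballI)
  interpret cubist_vertex X x by unfold_locales (fact assms)+
  show "\<exists>d e. linear_projective_resolution TYPE('n) TYPE('l)
        (V_sub X :: ('k::field, 'r) valg set) X
        (\<lambda>n. gsum {y \<in> lambda_set X x. dist_pt x y = n}
               (\<lambda>y. gshift (int n) (proj_module X y)))
        d e (std_module X x)"
    using resolution unfolding psum_def kface_def by blast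
  \<comment> \<open>Both sides are images of the same \<open>delta_module X\<close>, so the
    comparison goes through this model.\<close>
  show "gmod_iso (V_sub X :: ('k, 'r) valg set) X (std_module X x)
         (restrict_module X (V_std_module (cub_index X x) x))"
    by (rule graded_basis.gmod_iso[OF delta_graded_basis[OF assms(2)] std_graded_iso[OF assms]
          restrict_tensor_graded_iso unital_subalgebra_V_sub])
  fix u y assume "u \<in> X" "y \<in> X"
  then show "has_gdim (std_module X u :: ('k, 'r, ('k, 'r) valg set) vmodule) y"
    and "std_matrix TYPE('k) X u y = tilde_matrix X u y"
    unfolding std_matrix_def by (rule std_gdim[OF assms(1)])+
qed

end
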